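(* Let $\mathfrak G$ be the group defined in the context, with the subgroups $N_m$, the modules $V_n$, their subspaces $V_n^r$, and the isomorphisms $\alpha\oplus\beta: N_m/N_{m+1}\to V_m\oplus V_{m-1}$. Let $\mathfrak G_n$ ($n\ge1$) denote the series of $\mathbb F_2$-dimension subgroups of $\mathfrak G$. For all $m\ge 1$: 1. $\mathfrak G_{2^m+1}=N_m$. 2. $$\mathfrak G_{2^m+1+r}=\begin{cases}N_{m+1}\,\alpha^{-1}(V_m^r)\,\beta^{-1}(V_{m-1}^{r/2})&\text{if }0\le r\le2^m\text{ is even},\\ N_{m+1}\,\alpha^{-1}(V_m^r)\,\beta^{-1}(V_{m-1}^{(r-1)/2})&\text{if }0\le r\le2^m\text{ is odd}.\end{cases}$$ 3. $$\operatorname{rank}(\mathfrak G_i/\mathfrak G_{i+1})=\begin{cases}3&\text{if }i=1,\\2&\text{if }i>1\text{ is even},\\1&\text{if }i>1\text{ is odd}.\end{cases}$$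
   Context: Let $\Sigma=\mathbb F_2=\{0,1\}$ and let $\Sigma^*$ be the set of finite words over $\Sigma$, viewed as a rooted binary tree. For $x\in\Sigma$ write $\overline x=1-x$. Define tree automorphisms $a,b,c,d$ of $\Sigma^*$ (acting on the left; words too short for a rule to apply are fixed) by $a(x\sigma)=\overline x\sigma$; $b(0x\sigma)=0\overline x\sigma$, $b(1\sigma)=1c(\sigma)$; $c(0x\sigma)=0\overline x\sigma$, $c(1\sigma)=1d(\sigma)$; $d(0x\sigma)=0x\sigma$, $d(1\sigma)=1b(\sigma)$. Put $\mathfrak G=\langle a,b,c,d\rangle$. The $\mathbb F_2$-dimension subgroups of a group $G$ are $G_n=\{g\in G: g-1\in\Delta^n\}$, where $\Delta$ is the augmentation ideal of $\mathbb F_2[G]$. An automorphism fixing all words of length $m$ is identified with the $2^m$-tuple $(g_\sigma)_{\sigma\in\Sigma^m}$ (lexicographic order) of its actions on the subtrees below the words of length $m$: $g(\sigma\tau)=\sigma g_\sigma(\tau)$. Conventions: $[g,h]=ghg^{-1}h^{-1}$. Let $x=[a,b]$, let $K$ be the normal closure of $x$ in $\mathfrak G$, and let $T$ be the normal closure of $x^2$ in $\mathfrak G$. One has $K\times K\le K$. For $Q\le K$ let $Q_m=Q\times\dots\times Q$ ($2^m$ copies), a subgroup of $\mathfrak G$ acting on each subtree starting on level $m$ by the corresponding factor ($Q_0=Q$). For $m\ge1$ let $N_m=K_m\cdot T_{m-1}$. For $n\ge0$ let $V_n=\mathbb F_2[X_1,\dots,X_n]/(X_1^2-1,\dots,X_n^2-1)$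 (so $V_0=\mathbb F_2$); the word $\sigma_1\cdots\sigma_n\in\Sigma^n$ corresponds to the monomial $X_1^{\sigma_1}\cdots X_n^{\sigma_n}$. For $0\le r\le 2^n-1$ with binary expansion $r=\sum_{i=1}^n r_i2^{i-1}$, $r_i\in\{0,1\}$, put $v_n^r=(1-X_1)^{r_1}\cdots(1-X_n)^{r_n}$ and let $V_n^r$ be the span of $v_n^r,v_n^{r+1},\dots,v_n^{2^n-1}$; put $V_n^r=0$ for $r\ge2^n$. For $m\ge1$ there is an isomorphism $\alpha\oplus\beta:N_m/N_{m+1}\to V_m\oplus V_{m-1}$ in which $\alpha$ sends the class of $(1,\dots,1,x,1,\dots,1)\in K_m$ to the monomial of $V_m$ corresponding to the vertex at which $x$ stands, and $\beta$ sends the class of $(1,\dots,1,x^2,1,\dots,1)\in T_{m-1}$ to the corresponding monomial of $V_{m-1}$. For subspaces $V\subseteq V_m$, $W\subseteq V_{m-1}$, $N_{m+1}\alpha^{-1}(V)\beta^{-1}(W)$ denotes the full preimage of $V\oplus W$ in $N_m$ under $N_m\to N_m/N_{m+1}\cong V_m\oplus V_{m-1}$. The rank of an abelian group $M$ here means $\dim_{\mathbb F_2}(M\otimes\mathbb F_2)$. *)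

theory Defs
  imports
    "HOL-Library.Z2"
    "HOL-Algebra.Free_Abelian_Groups"
    "HOL-Algebra.QuotRing"
    "HOL-Algebra.Ideal_Product"
    "HOL-Algebra.Algebraic_Closure_Type"
    "Jordan_Normal_Form.Missing_VectorSpace"
begin

abbreviation F2 :: "bit ring" where
  "F2 \<equiv> ring_of_type_algebra"

text \<open>An abelian group of exponent 2, as a vector space over \<^term>\<open>F2\<close>. The
  components \<open>mult\<close> and \<open>one\<close> of the record play no role for modules.\<close>

definition F2_space :: "('a, 'm) monoid_scheme \<Rightarrow> (bit, 'a) module" where
  "F2_space M = \<lparr>carrier = carrier M, monoid.mult = undefined, one = undefined,
     ring.zero = \<one>\<^bsub>M\<^esub>, add = monoid.mult M, module.smult = (\<lambda>c v. if c = 0 then \<one>\<^bsub>M\<^esub> else v)\<rparr>"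

text \<open>The tensor product over the integers of two abelian groups: the free abelian group on
  the pairs, modulo biadditivity (balancedness over the integers follows).\<close>

definition tensor :: "('a, 'm) monoid_scheme \<Rightarrow> ('b, 'n) monoid_scheme \<Rightarrow> (('a \<times> 'b) \<Rightarrow>\<^sub>0 int) set monoid" where
  "tensor M N =
    (let e = (\<lambda>p. Poly_Mapping.single p (1::int));
         F = free_Abelian_group (carrier M \<times> carrier N)
     in F Mod generate F
       ({e (x \<otimes>\<^bsub>M\<^esub> x', y) - e (x, y) - e (x', y) | x x' y.
           x \<in> carrier M \<and> x' \<in> carrier M \<and> y \<in> carrier N} \<union>
        {e (x, y \<otimes>\<^bsub>N\<^esub> y') - e (x, y) - e (x, y') | x y y'.
           x \<in> carrier M \<and> y \<in> carrier N \<and> y' \<in> carrier N}))"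

definition rank_F2 :: "('a, 'm) monoid_scheme \<Rightarrow> nat" where
  "rank_F2 M = vectorspace.dim F2 (F2_space (tensor M (add_monoid F2)))"

definition group_algebra :: "('a, 'm) monoid_scheme \<Rightarrow> ('a \<Rightarrow>\<^sub>0 'k::comm_ring_1) ring" where
  "group_algebra G =
    \<lparr>carrier = {f. Poly_Mapping.keys f \<subseteq> carrier G},
     monoid.mult = (\<lambda>f h. \<Sum>u\<in>Poly_Mapping.keys f. \<Sum>w\<in>Poly_Mapping.keys h.
       Poly_Mapping.single (u \<otimes>\<^bsub>G\<^esub> w) (Poly_Mapping.lookup f u * Poly_Mapping.lookup h w)),
     one = Poly_Mapping.single \<one>\<^bsub>G\<^esub> 1, ring.zero = 0, add = (+)\<rparr>"

definition augmentation_ideal :: "('a, 'm) monoid_scheme \<Rightarrow> ('a \<Rightarrow>\<^sub>0 'k::comm_ring_1) set" where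
  "augmentation_ideal G =
    {f \<in> carrier (group_algebra G). (\<Sum>g\<in>Poly_Mapping.keys f. Poly_Mapping.lookup f g) = 0}"

primrec ideal_pow :: "('a, 'm) ring_scheme \<Rightarrow> 'a set \<Rightarrow> nat \<Rightarrow> 'a set" where
  "ideal_pow R I 0 = carrier R"
| "ideal_pow R I (Suc n) = ideal_prod R (ideal_pow R I n) I"

definition dimension_subgroup :: "('a, 'm) monoid_scheme \<Rightarrow> nat \<Rightarrow> 'a set" where
  "dimension_subgroup G n =
    {g \<in> carrier G. Poly_Mapping.single g (1::bit) - Poly_Mapping.single \<one>\<^bsub>G\<^esub> 1
       \<in> ideal_pow (group_algebra G) (augmentation_ideal G) n}"

type_synonym word = "bit list"

definition tree_aut :: "(word \<Rightarrow> word) set" where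
  "tree_aut = {f. bij f \<and> f [] = [] \<and> (\<forall>w x. \<exists>y. f (w @ [x]) = f w @ [y])}"

definition AutT :: "(word \<Rightarrow> word) monoid" where
  "AutT = \<lparr>carrier = tree_aut, monoid.mult = (\<circ>), one = id\<rparr>"

fun gen_a :: "word \<Rightarrow> word" where
  "gen_a [] = []"
| "gen_a (x # \<sigma>) = (1 - x) # \<sigma>"

fun gen_b :: "word \<Rightarrow> word" and gen_c :: "word \<Rightarrow> word" and gen_d :: "word \<Rightarrow> word" where
  "gen_b [] = []"
| "gen_b (y # \<sigma>) = (if y = 0 then 0 # gen_a \<sigma> else 1 # gen_c \<sigma>)"
| "gen_c [] = []"
| "gen_c (y # \<sigma>) = (if y = 0 then 0 # gen_a \<sigma> else 1 # gen_d \<sigma>)"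
| "gen_d [] = []"
| "gen_d (y # \<sigma>) = (if y = 0 then 0 # \<sigma> else 1 # gen_b \<sigma>)"

text \<open>Doubled capitals \<open>GG\<close>, \<open>KK\<close>, \<open>TT\<close>, \<open>NN\<close> and \<open>xx\<close> stand for the Grigorchuk group, the
  subgroups \<open>K\<close>, \<open>T\<close>, \<open>N\<^sub>m\<close> and \<open>x = [a, b]\<close>, so that the single letters remain free as variables.\<close>

definition GG :: "(word \<Rightarrow> word) monoid" where
  "GG = AutT\<lparr>carrier := generate AutT {gen_a, gen_b, gen_c, gen_d}\<rparr>"

definition normal_closure :: "('a, 'm) monoid_scheme \<Rightarrow> 'a set \<Rightarrow> 'a set" where
  "normal_closure G S = \<Inter>{H. H \<lhd> G \<and> S \<subseteq> H}"

definition xx :: "word \<Rightarrow> word" where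
  "xx = gen_a \<otimes>\<^bsub>GG\<^esub> gen_b \<otimes>\<^bsub>GG\<^esub> inv\<^bsub>GG\<^esub> gen_a \<otimes>\<^bsub>GG\<^esub> inv\<^bsub>GG\<^esub> gen_b"

definition KK :: "(word \<Rightarrow> word) set" where
  "KK = normal_closure GG {xx}"

definition TT :: "(word \<Rightarrow> word) set" where
  "TT = normal_closure GG {xx \<otimes>\<^bsub>GG\<^esub> xx}"

text \<open>\<open>level_power Q m\<close> is \<open>Q \<times> \<dots> \<times> Q\<close> (\<open>2 ^ m\<close> copies), one factor acting below each
  word of length \<open>m\<close>; the words of length \<open>m\<close> are fixed since \<open>h [] = []\<close>.\<close>

definition level_power :: "(word \<Rightarrow> word) set \<Rightarrow> nat \<Rightarrow> (word \<Rightarrow> word) set" where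
  "level_power Q m =
    {g \<in> tree_aut. \<forall>\<sigma>. length \<sigma> = m \<longrightarrow> (\<exists>h\<in>Q. \<forall>\<tau>. g (\<sigma> @ \<tau>) = \<sigma> @ h \<tau>)}"

text \<open>The tuple \<open>(1, \<dots>, 1, g, 1, \<dots>, 1)\<close> with \<open>g\<close> standing at the word \<open>\<sigma>\<close>.\<close>

definition at_vertex :: "word \<Rightarrow> (word \<Rightarrow> word) \<Rightarrow> word \<Rightarrow> word" where
  "at_vertex \<sigma> g w =
    (if take (length \<sigma>) w = \<sigma> then \<sigma> @ g (drop (length \<sigma>) w) else w)"

definition NN :: "nat \<Rightarrow> (word \<Rightarrow> word) set" where
  "NN m = level_power KK m <#>\<^bsub>GG\<^esub> level_power TT (m - 1)"

text \<open>Polynomials are finitely supported functions from exponent vectors to coefficients;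
  \<open>poly_ring_F2 n\<close> is the ring of those in which only \<open>X\<^sub>1, \<dots>, X\<^sub>n\<close> occur.\<close>

type_synonym mpoly2 = "(nat \<Rightarrow>\<^sub>0 nat) \<Rightarrow>\<^sub>0 bit"

definition X_var :: "nat \<Rightarrow> mpoly2" where
  "X_var i = Poly_Mapping.single (Poly_Mapping.single i 1) 1"

definition poly_ring_F2 :: "nat \<Rightarrow> mpoly2 ring" where
  "poly_ring_F2 n = ring_of_type_algebra
     \<lparr>carrier := {p. \<forall>e\<in>Poly_Mapping.keys p. Poly_Mapping.keys e \<subseteq> {1..n}}\<rparr>"

definition V_ideal :: "nat \<Rightarrow> mpoly2 set" where
  "V_ideal n = genideal (poly_ring_F2 n) {X_var i ^ 2 - 1 | i. i \<in> {1..n}}"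

definition V_mod :: "nat \<Rightarrow> mpoly2 set ring" where
  "V_mod n = poly_ring_F2 n Quot V_ideal n"

definition V_class :: "nat \<Rightarrow> mpoly2 \<Rightarrow> mpoly2 set" where
  "V_class n p = V_ideal n +>\<^bsub>poly_ring_F2 n\<^esub> p"

text \<open>The letter \<open>\<sigma>\<^sub>i\<close> of a word is \<open>\<sigma> ! (i - 1)\<close>.\<close>

definition V_monomial :: "word \<Rightarrow> mpoly2 set" where
  "V_monomial \<sigma> = V_class (length \<sigma>)
     (\<Prod>i = 1..length \<sigma>. X_var i ^ (if \<sigma> ! (i - 1) = 1 then 1 else 0))"

definition v_elt :: "nat \<Rightarrow> nat \<Rightarrow> mpoly2 set" where
  "v_elt n r = V_class n (\<Prod>i = 1..n. (1 - X_var i) ^ (r div 2 ^ (i - 1) mod 2))"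

text \<open>For \<open>r \<ge> 2 ^ n\<close> this is the span of the empty set.\<close>

definition V_sub :: "nat \<Rightarrow> nat \<Rightarrow> mpoly2 set set" where
  "V_sub n r = module.span F2 (F2_space (add_monoid (V_mod n))) {v_elt n s | s. r \<le> s \<and> s < 2 ^ n}"

definition is_alpha_beta ::
    "nat \<Rightarrow> ((word \<Rightarrow> word) set \<Rightarrow> mpoly2 set \<times> mpoly2 set) \<Rightarrow> bool" where
  "is_alpha_beta m \<phi> \<longleftrightarrow>
     \<phi> \<in> iso (GG\<lparr>carrier := NN m\<rparr> Mod NN (m + 1)) (add_monoid (V_mod m) \<times>\<times> add_monoid (V_mod (m - 1))) \<and>
     (\<forall>\<sigma>. length \<sigma> = m \<longrightarrow>
        \<phi> (NN (m + 1) #>\<^bsub>GG\<^esub> at_vertex \<sigma> xx) = (V_monomial \<sigma>, \<zero>\<^bsub>V_mod (m - 1)\<^esub>)) \<and>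
     (\<forall>\<sigma>. length \<sigma> = m - 1 \<longrightarrow>
        \<phi> (NN (m + 1) #>\<^bsub>GG\<^esub> at_vertex \<sigma> (xx \<otimes>\<^bsub>GG\<^esub> xx)) = (\<zero>\<^bsub>V_mod m\<^esub>, V_monomial \<sigma>))"

text \<open>The isomorphism is unique on cosets, because its values are prescribed on classes that
  map to bases of the two summands; the choice operator only picks its values elsewhere.\<close>

definition alpha_beta :: "nat \<Rightarrow> (word \<Rightarrow> word) set \<Rightarrow> mpoly2 set \<times> mpoly2 set" where
  "alpha_beta m = (SOME \<phi>. is_alpha_beta m \<phi>)"

definition alpha_map :: "nat \<Rightarrow> (word \<Rightarrow> word) set \<Rightarrow> mpoly2 set" where
  "alpha_map m C = fst (alpha_beta m C)"

definition beta_map :: "nat \<Rightarrow> (word \<Rightarrow> word) set \<Rightarrow> mpoly2 set" where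
  "beta_map m C = snd (alpha_beta m C)"

definition N_preimage :: "nat \<Rightarrow> mpoly2 set set \<Rightarrow> mpoly2 set set \<Rightarrow> (word \<Rightarrow> word) set" where
  "N_preimage m A B =
    {g \<in> NN m. alpha_map m (NN (m + 1) #>\<^bsub>GG\<^esub> g) \<in> A \<and> beta_map m (NN (m + 1) #>\<^bsub>GG\<^esub> g) \<in> B}"

end

theory Submission imports Defs begin

text \<open>By Lazard's theorem the dimension subgroups form the only series \<open>M\<^sub>n\<close> of normal subgroups with \<open>M\<^sub>1 = G\<close>
  such that \<open>M\<^sub>n\<close> is generated by the commutators of elements of \<open>G\<close> with elements of \<open>M\<^sub>n\<^sub>-\<^sub>1\<close> and by the squares of
  the elements of \<open>M\<^sub>k\<close>, where \<open>k\<close> is \<open>n / 2\<close> rounded up. An element outside \<open>M\<^sub>n\<close> is separated from \<open>\<Delta>\<^sup>n\<close> by a function to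
  \<open>\<F>\<^sub>2\<close> that is polynomial of small degree with respect to the series; such functions are extended from the
  last layers to the group one generator at a time.

  For the Grigorchuk group, the parities of activity on the first three levels define \<open>\<GG>\<^sub>2\<close> and two
  conjugation invariant homomorphisms \<open>\<kappa>, \<mu>\<close> from \<open>\<GG>\<^sub>2\<close> to \<open>\<F>\<^sub>2\<close> with common kernel \<open>N\<^sub>1\<close>. Applied to the sections of
  \<open>g \<in> N\<^sub>m\<close> at the vertices of level \<open>m\<close> they yield functions \<open>A g\<close> and \<open>B g\<close> on words, which are \<open>\<alpha>\<close> and
  \<open>\<beta>\<close>. On functions, \<open>V\<^sub>m\<^sup>r\<close> becomes a bound on a weighted degree. A commutator with a group element acts as a
  difference operator and lowers this degree; for every degree, one of the four generators lowers it by exactly one.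
  Squaring is expressed by \<open>\<kappa>\<close> and \<open>\<mu>\<close> on the next level.\<close>

subsection \<open>Group algebras over \<open>\<F>\<^sub>2\<close>\<close>

text \<open>The two summands of N_m / N_(m+1) do not sink in step. A commutator lowers the degrees
  of \<open>Af\<close> and \<open>Bf\<close> alike, but the bound on \<open>Bf\<close> tightens only
  at every second index, so commutators with the preceding term never reach a new leading
  coefficient of \<open>Bf\<close>. It has to come from a square: doubling the index
  \<open>2 ^ k + 1 + s\<close> gives \<open>2 ^ Suc k + 1 + (2 * s + 1)\<close>, always with an odd
  remainder. Hence the halved exponent of the second summand and the alternation of the ranks 2 and
  1. Squaring, however, is not additive: by \<open>M2_square_sec1\<close> its \<alpha> part contains
  a product of \<open>Bf\<close> and \<open>Af\<close>. Therefore the filtration is described by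
  degrees of functions, for which products can be estimated. The start of a block, r = 0, needs a
  separate argument, because the preceding term belongs to the previous level of the tree; there N_m
  is normally generated from its entries at a single vertex.\<close>

lemma poly_mapping_bit_add_self [simp]: "(p :: 'b \<Rightarrow>\<^sub>0 bit) + p = 0"
  by (rule poly_mapping_eqI) (simp add: lookup_add)

lemma poly_mapping_bit_add_self_left [simp]: "(p :: 'b \<Rightarrow>\<^sub>0 bit) + (p + q) = q"
  by (simp flip: add.assoc)

lemma poly_mapping_bit_diff: "(p :: 'b \<Rightarrow>\<^sub>0 bit) - q = p + q"
  by (rule poly_mapping_eqI) (simp add: lookup_add lookup_minus)

text \<open>Bilinearity is proved by comparing sums over one index set; replacing the exact supports
  in the definition of the product by finite supersets makes the sums comparable.\<close>

lemma keys_sum_bilinear: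
  fixes p q :: "'a \<Rightarrow>\<^sub>0 'k::comm_ring_1"
  assumes "finite S" "Poly_Mapping.keys p \<subseteq> S" "finite T" "Poly_Mapping.keys q \<subseteq> T"
  shows "p \<otimes>\<^bsub>group_algebra G\<^esub> q = (\<Sum>u\<in>S. \<Sum>w\<in>T.
       Poly_Mapping.single (u \<otimes>\<^bsub>G\<^esub> w) (Poly_Mapping.lookup p u * Poly_Mapping.lookup q w))"
proof -
  have "(\<Sum>u\<in>S. \<Sum>w\<in>T. Poly_Mapping.single (u \<otimes>\<^bsub>G\<^esub> w) (Poly_Mapping.lookup p u * Poly_Mapping.lookup q w))
     = (\<Sum>u\<in>Poly_Mapping.keys p. \<Sum>w\<in>T. Poly_Mapping.single (u \<otimes>\<^bsub>G\<^esub> w) (Poly_Mapping.lookup p u * Poly_Mapping.lookup q w))"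
    by (rule sum.mono_neutral_right) (use assms in \<open>auto simp: in_keys_iff\<close>)
  also have "\<dots> = (\<Sum>u\<in>Poly_Mapping.keys p. \<Sum>w\<in>Poly_Mapping.keys q. Poly_Mapping.single (u \<otimes>\<^bsub>G\<^esub> w) (Poly_Mapping.lookup p u * Poly_Mapping.lookup q w))"
    by (intro sum.cong refl sum.mono_neutral_right) (use assms in \<open>auto simp: in_keys_iff\<close>)
  finally show ?thesis by (simp add: group_algebra_def)
qed

lemma group_algebra_simps [simp]:
  "carrier (group_algebra G) = {f. Poly_Mapping.keys f \<subseteq> carrier G}"
  "one (group_algebra G) = Poly_Mapping.single \<one>\<^bsub>G\<^esub> 1"
  "ring.zero (group_algebra G) = 0"
  "add (group_algebra G) = (+)"
  by (auto simp: group_algebra_def)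

lemma mult_single_single [simp]:
  "Poly_Mapping.single g c \<otimes>\<^bsub>group_algebra G\<^esub> Poly_Mapping.single h d
     = Poly_Mapping.single (g \<otimes>\<^bsub>G\<^esub> h) (c * (d::'k::comm_ring_1))"
  by (subst keys_sum_bilinear[of "{g}" _ "{h}"]) (auto simp: lookup_single)

lemma group_algebra_distrib_left:
  fixes p q r :: "'a \<Rightarrow>\<^sub>0 'k::comm_ring_1"
  shows "p \<otimes>\<^bsub>group_algebra G\<^esub> (q + r) = p \<otimes>\<^bsub>group_algebra G\<^esub> q + p \<otimes>\<^bsub>group_algebra G\<^esub> r"
proof -
  let ?S = "Poly_Mapping.keys p" and ?T = "Poly_Mapping.keys q \<union> Poly_Mapping.keys r"
  have *: "Poly_Mapping.keys (q + r) \<subseteq> ?T" by (rule keys_add)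
  show ?thesis
    by (subst (1 2 3) keys_sum_bilinear[of ?S _ ?T])
       (use * in \<open>auto simp: lookup_add ring_distribs single_add sum.distrib\<close>)
qed

lemma group_algebra_distrib_right:
  fixes p q r :: "'a \<Rightarrow>\<^sub>0 'k::comm_ring_1"
  shows "(q + r) \<otimes>\<^bsub>group_algebra G\<^esub> p = q \<otimes>\<^bsub>group_algebra G\<^esub> p + r \<otimes>\<^bsub>group_algebra G\<^esub> p"
proof -
  let ?S = "Poly_Mapping.keys p" and ?T = "Poly_Mapping.keys q \<union> Poly_Mapping.keys r"
  have *: "Poly_Mapping.keys (q + r) \<subseteq> ?T" by (rule keys_add)
  show ?thesis
    by (subst (1 2 3) keys_sum_bilinear[of ?T _ ?S])
       (use * in \<open>auto simp: lookup_add ring_distribs single_add sum.distrib\<close>)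
qed

lemma group_algebra_mult_zero [simp]:
  fixes p :: "'a \<Rightarrow>\<^sub>0 'k::comm_ring_1"
  shows "p \<otimes>\<^bsub>group_algebra G\<^esub> 0 = 0" "0 \<otimes>\<^bsub>group_algebra G\<^esub> p = 0"
  by (auto simp: group_algebra_def)

text \<open>Both summands keep their support in \<open>A\<close>, so that closure hypotheses survive
  the induction. Nothing refers to a group; the rule also serves for polynomials.\<close>

lemma group_algebra_induct [consumes 1, case_names zero single add]:
  fixes p :: "'a \<Rightarrow>\<^sub>0 'k::comm_ring_1"
  assumes "Poly_Mapping.keys p \<subseteq> A" "P 0"
    "\<And>g c. g \<in> A \<Longrightarrow> P (Poly_Mapping.single g c)"
    "\<And>p q. Poly_Mapping.keys p \<subseteq> A \<Longrightarrow> Poly_Mapping.keys q \<subseteq> A \<Longrightarrow> P p \<Longrightarrow> P q \<Longrightarrow> P (p + q)"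
  shows "P p"
proof -
  have p: "p = (\<Sum>g\<in>Poly_Mapping.keys p. Poly_Mapping.single g (Poly_Mapping.lookup p g))"
    by (rule poly_mapping_eqI) (simp add: lookup_sum lookup_single when_def in_keys_iff)
  have "P (\<Sum>g\<in>S. Poly_Mapping.single g (Poly_Mapping.lookup p g)) \<and>
      Poly_Mapping.keys (\<Sum>g\<in>S. Poly_Mapping.single g (Poly_Mapping.lookup p g)) \<subseteq> A"
    if "finite S" "S \<subseteq> A" for S
    using that
  proof (induction S rule: finite_induct)
    case (insert g S)
    have "Poly_Mapping.keys (Poly_Mapping.single g (Poly_Mapping.lookup p g)) \<subseteq> A" using insert by auto
    with insert assms(3,4) show ?case by (simp del: keys_single) (meson Un_least keys_add subset_trans)
  qed (use assms in auto)
  from this[of "Poly_Mapping.keys p"] assms p show ?thesis by auto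
qed

lemma (in group) group_algebra_closed:
  fixes p q :: "'a \<Rightarrow>\<^sub>0 'k::comm_ring_1"
  assumes "Poly_Mapping.keys p \<subseteq> carrier G" "Poly_Mapping.keys q \<subseteq> carrier G"
  shows "Poly_Mapping.keys (p \<otimes>\<^bsub>group_algebra G\<^esub> q) \<subseteq> carrier G"
  using assms(1)
proof (induction p rule: group_algebra_induct)
  case (single g c)
  show ?case using assms(2)
  proof (induction q rule: group_algebra_induct)
    case (add p q) then show ?case
      unfolding group_algebra_distrib_left by (meson Un_least keys_add subset_trans)
  qed (use single in auto)
next
  case (add p q) then show ?case
    unfolding group_algebra_distrib_right by (meson Un_least keys_add subset_trans)
qed auto

lemma (in group) group_algebra_assoc:
  fixes p q r :: "'a \<Rightarrow>\<^sub>0 'k::comm_ring_1"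
  assumes "Poly_Mapping.keys p \<subseteq> carrier G" "Poly_Mapping.keys q \<subseteq> carrier G" "Poly_Mapping.keys r \<subseteq> carrier G"
  shows "p \<otimes>\<^bsub>group_algebra G\<^esub> q \<otimes>\<^bsub>group_algebra G\<^esub> r = p \<otimes>\<^bsub>group_algebra G\<^esub> (q \<otimes>\<^bsub>group_algebra G\<^esub> r)"
  using assms(1)
proof (induction p rule: group_algebra_induct)
  case (single g c)
  show ?case using assms(2)
  proof (induction q rule: group_algebra_induct)
    case (single h d)
    show ?case using assms(3)
    proof (induction r rule: group_algebra_induct)
      case (single k e)
      then show ?case using \<open>g \<in> _\<close> \<open>h \<in> _\<close> by (simp add: m_assoc mult.assoc)
    qed (auto simp: group_algebra_distrib_left)
  qed (auto simp: group_algebra_distrib_left group_algebra_distrib_right)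
qed (auto simp: group_algebra_distrib_right)

lemma (in group) ring_group_algebra: "ring (group_algebra G :: ('a \<Rightarrow>\<^sub>0 'k::comm_ring_1) ring)"
proof (rule ringI)
  show "abelian_group (group_algebra G :: ('a \<Rightarrow>\<^sub>0 'k) ring)"
  proof (rule abelian_groupI; simp)
    fix x y :: "'a \<Rightarrow>\<^sub>0 'k"
    assume "Poly_Mapping.keys x \<subseteq> carrier G"
    then show "\<exists>y. Poly_Mapping.keys y \<subseteq> carrier G \<and> y + x = 0" by (intro exI[of _ "-x"]) auto
  next
    fix x y :: "'a \<Rightarrow>\<^sub>0 'k"
    assume "Poly_Mapping.keys x \<subseteq> carrier G" "Poly_Mapping.keys y \<subseteq> carrier G"
    then show "Poly_Mapping.keys (x + y) \<subseteq> carrier G" using keys_add by fastforce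
  qed
  show "Group.monoid (group_algebra G :: ('a \<Rightarrow>\<^sub>0 'k) ring)"
  proof (rule monoidI; (simp add: group_algebra_closed group_algebra_assoc)?)
    fix x :: "'a \<Rightarrow>\<^sub>0 'k" assume "Poly_Mapping.keys x \<subseteq> carrier G"
    then show "Poly_Mapping.single \<one> 1 \<otimes>\<^bsub>group_algebra G\<^esub> x = x"
      by (induction x rule: group_algebra_induct) (auto simp: group_algebra_distrib_left)
  next
    fix x :: "'a \<Rightarrow>\<^sub>0 'k" assume "Poly_Mapping.keys x \<subseteq> carrier G"
    then show "x \<otimes>\<^bsub>group_algebra G\<^esub> Poly_Mapping.single \<one> 1 = x"
      by (induction x rule: group_algebra_induct) (auto simp: group_algebra_distrib_right)
  qed
qed (simp_all add: group_algebra_distrib_left group_algebra_distrib_right)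

section \<open>The augmentation ideal, its powers and the dimension subgroups\<close>

definition augmentation :: "('a \<Rightarrow>\<^sub>0 'k::comm_ring_1) \<Rightarrow> 'k" where
  "augmentation f = (\<Sum>g\<in>Poly_Mapping.keys f. Poly_Mapping.lookup f g)"

lemma augmentation_superset:
  "finite S \<Longrightarrow> Poly_Mapping.keys f \<subseteq> S \<Longrightarrow> augmentation f = (\<Sum>g\<in>S. Poly_Mapping.lookup f g)"
  unfolding augmentation_def by (rule sum.mono_neutral_left) (auto simp: in_keys_iff)

lemma augmentation_add [simp]: "augmentation (p + q) = augmentation p + augmentation q"
proof -
  have *: "Poly_Mapping.keys (p + q) \<subseteq> Poly_Mapping.keys p \<union> Poly_Mapping.keys q" by (rule keys_add)
  show ?thesis
    by (subst (1 2 3) augmentation_superset[of "Poly_Mapping.keys p \<union> Poly_Mapping.keys q"])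
       (use * in \<open>auto simp: lookup_add sum.distrib\<close>)
qed

lemma augmentation_single [simp]: "augmentation (Poly_Mapping.single g c) = c"
  by (subst augmentation_superset[of "{g}"]) (auto simp: lookup_single)

lemma augmentation_zero [simp]: "augmentation 0 = 0"
  by (simp add: augmentation_def)

lemma augmentation_uminus [simp]: "augmentation (- p) = - augmentation p"
  by (simp add: augmentation_def sum_negf)

lemma augmentation_diff [simp]: "augmentation (p - q) = augmentation p - augmentation q"
  using augmentation_add[of p "-q"] by simp

lemma augmentation_mult:
  fixes p q :: "'a \<Rightarrow>\<^sub>0 'k::comm_ring_1"
  shows "augmentation (p \<otimes>\<^bsub>group_algebra G\<^esub> q) = augmentation p * augmentation q"
  using subset_UNIV[of "Poly_Mapping.keys p"]
proof (induction p rule: group_algebra_induct)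
  case (single g c)
  show ?case
    using subset_UNIV[of "Poly_Mapping.keys q"]
    by (induction q rule: group_algebra_induct)
       (auto simp: group_algebra_distrib_left ring_distribs)
qed (auto simp: group_algebra_distrib_right ring_distribs)

lemma augmentation_ideal_eq:
  "augmentation_ideal G = {f. Poly_Mapping.keys f \<subseteq> carrier G \<and> augmentation f = 0}"
  by (auto simp: augmentation_ideal_def augmentation_def)

lemma (in group) ideal_augmentation_ideal:
  "ideal (augmentation_ideal G) (group_algebra G :: ('a \<Rightarrow>\<^sub>0 'k::comm_ring_1) ring)"
proof (rule idealI)
  interpret R: ring "group_algebra G :: ('a \<Rightarrow>\<^sub>0 'k) ring" by (rule ring_group_algebra)
  show "ring (group_algebra G :: ('a \<Rightarrow>\<^sub>0 'k) ring)" by (rule ring_group_algebra)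
  show "subgroup (augmentation_ideal G) (add_monoid (group_algebra G :: ('a \<Rightarrow>\<^sub>0 'k) ring))"
  proof (rule R.add.subgroupI)
    fix p :: "'a \<Rightarrow>\<^sub>0 'k" assume p: "p \<in> augmentation_ideal G"
    have "\<ominus>\<^bsub>group_algebra G\<^esub> p = - p"
      by (rule R.minus_equality) (use p in \<open>auto simp: augmentation_ideal_eq\<close>)
    with p show "\<ominus>\<^bsub>group_algebra G\<^esub> p \<in> augmentation_ideal G"
      by (auto simp: augmentation_ideal_eq)
  next
    fix p q :: "'a \<Rightarrow>\<^sub>0 'k" assume "p \<in> augmentation_ideal G" "q \<in> augmentation_ideal G"
    then show "p \<oplus>\<^bsub>group_algebra G\<^esub> q \<in> augmentation_ideal G"
      using keys_add[of p q] by (auto simp: augmentation_ideal_eq)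
  next
    have "0 \<in> (augmentation_ideal G :: ('a \<Rightarrow>\<^sub>0 'k) set)" by (auto simp: augmentation_ideal_eq)
    then show "augmentation_ideal G \<noteq> ({} :: ('a \<Rightarrow>\<^sub>0 'k) set)" by blast
  qed (auto simp: augmentation_ideal_eq)
next
  fix a x :: "'a \<Rightarrow>\<^sub>0 'k"
  assume "a \<in> augmentation_ideal G" "x \<in> carrier (group_algebra G)"
  then show "x \<otimes>\<^bsub>group_algebra G\<^esub> a \<in> augmentation_ideal G" "a \<otimes>\<^bsub>group_algebra G\<^esub> x \<in> augmentation_ideal G"
    using group_algebra_closed[of x a] group_algebra_closed[of a x]
    by (auto simp: augmentation_ideal_eq augmentation_mult)
qed

lemma (in ring) ideal_ideal_pow:
  assumes "ideal I R" shows "ideal (ideal_pow R I n) R"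
  by (induction n) (auto simp: oneideal ideal_prod_is_ideal assms)

lemma (in ring) ideal_pow_Suc_subset:
  assumes "ideal I R" shows "ideal_pow R I (Suc n) \<subseteq> ideal_pow R I n"
  using ideal_prod_inter[OF ideal_ideal_pow[OF assms, of n] assms] by auto

text \<open>Powers are built by multiplying with \<open>I\<close> on the right; induction on the
  second exponent moves that last factor out by associativity.\<close>

lemma (in ring) ideal_pow_mult:
  assumes I: "ideal I R" and i: "i \<in> ideal_pow R I m" and j: "j \<in> ideal_pow R I n"
  shows "i \<otimes> j \<in> ideal_pow R I (m + n)"
  using j
proof (induction n arbitrary: j)
  case 0
  then show ?case using ideal.I_r_closed[OF ideal_ideal_pow[OF I] i] by simp
next
  case (Suc n)
  have i': "i \<in> carrier R" using ideal.Icarr[OF ideal_ideal_pow[OF I] i] .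
  from Suc.prems have "j \<in> ideal_prod R (ideal_pow R I n) I" by simp
  then show ?case
  proof (induction j rule: ideal_prod.induct)
    case (prod j1 j2)
    have "j1 \<in> carrier R" "j2 \<in> carrier R"
      using prod ideal.Icarr[OF I] ideal.Icarr[OF ideal_ideal_pow[OF I]] by auto
    then have "i \<otimes> (j1 \<otimes> j2) = (i \<otimes> j1) \<otimes> j2" using i' by (simp add: m_assoc)
    also have "\<dots> \<in> ideal_pow R I (Suc (m + n))"
      using ideal_prod.prod[of "i \<otimes> j1" "ideal_pow R I (m+n)" j2 I R] Suc.IH[OF prod(1)] prod(2) by simp
    finally show ?case by simp
  next
    case (sum s1 s2)
    have "s1 \<in> carrier R" "s2 \<in> carrier R"
      using sum(1,2) ideal_prod_in_carrier[OF ideal_ideal_pow[OF I] I] by auto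
    then have "i \<otimes> (s1 \<oplus> s2) = i \<otimes> s1 \<oplus> i \<otimes> s2" using i' by (simp add: r_distr)
    then show ?case using sum additive_subgroup.a_closed[OF ideal.axioms(1)[OF ideal_ideal_pow[OF I]]]
      by metis
  qed
qed

context group
begin

abbreviation Aug_pow :: "nat \<Rightarrow> ('a \<Rightarrow>\<^sub>0 bit) set" where
  "Aug_pow n \<equiv> ideal_pow (group_algebra G) (augmentation_ideal G) n"

lemma ideal_Aug_pow: "ideal (Aug_pow n) (group_algebra G)"
  by (rule ring.ideal_ideal_pow[OF ring_group_algebra ideal_augmentation_ideal])

lemma Aug_pow_add: "p \<in> Aug_pow n \<Longrightarrow> q \<in> Aug_pow n \<Longrightarrow> p + q \<in> Aug_pow n"
  using additive_subgroup.a_closed[OF ideal.axioms(1)[OF ideal_Aug_pow]] by force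

lemma Aug_pow_mult: "p \<in> Aug_pow m \<Longrightarrow> q \<in> Aug_pow n \<Longrightarrow> p \<otimes>\<^bsub>group_algebra G\<^esub> q \<in> Aug_pow (m + n)"
  by (rule ring.ideal_pow_mult[OF ring_group_algebra ideal_augmentation_ideal])

lemma Aug_pow_mult_right: "p \<in> Aug_pow n \<Longrightarrow> Poly_Mapping.keys q \<subseteq> carrier G \<Longrightarrow> p \<otimes>\<^bsub>group_algebra G\<^esub> q \<in> Aug_pow n"
  using ideal.I_r_closed[OF ideal_Aug_pow, of p n q] by simp

lemma Aug_pow_antimono: "m \<le> n \<Longrightarrow> Aug_pow n \<subseteq> Aug_pow m"
  by (rule lift_Suc_antimono_le[of Aug_pow], rule ring.ideal_pow_Suc_subset[OF ring_group_algebra ideal_augmentation_ideal])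

text \<open>By definition the first power is the product of the whole ring with the ideal;
  multiplying by the unit of the group algebra shows that it is no smaller than the ideal.\<close>

lemma Aug_pow_1: "Aug_pow 1 = augmentation_ideal G"
proof
  show "Aug_pow 1 \<subseteq> augmentation_ideal G"
    using ring.ideal_prod_inter[OF ring_group_algebra ring.oneideal[OF ring_group_algebra] ideal_augmentation_ideal]
    by auto
  show "augmentation_ideal G \<subseteq> Aug_pow 1"
  proof
    fix p :: "'a \<Rightarrow>\<^sub>0 bit" assume p: "p \<in> augmentation_ideal G"
    have "Poly_Mapping.single \<one> 1 \<otimes>\<^bsub>group_algebra G\<^esub> p \<in> Aug_pow 1"
      using ideal_prod.prod[of "Poly_Mapping.single \<one> (1::bit)" "carrier (group_algebra G)" p "augmentation_ideal G" "group_algebra G"] p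
      by auto
    moreover have "Poly_Mapping.single \<one> 1 \<otimes>\<^bsub>group_algebra G\<^esub> p = p"
      using monoid.l_one[OF ring.is_monoid[OF ring_group_algebra], of p] p by (simp add: augmentation_ideal_eq)
    ultimately show "p \<in> Aug_pow 1" by simp
  qed
qed

abbreviation aug_elt :: "'a \<Rightarrow> 'a \<Rightarrow>\<^sub>0 bit" where
  "aug_elt g \<equiv> Poly_Mapping.single g 1 - Poly_Mapping.single \<one> 1"

lemma keys_aug_elt: "g \<in> carrier G \<Longrightarrow> Poly_Mapping.keys (aug_elt g) \<subseteq> carrier G"
  using keys_diff[of "Poly_Mapping.single g (1::bit)" "Poly_Mapping.single \<one> 1"] by auto

lemma dimension_subgroup_iff: "g \<in> dimension_subgroup G n \<longleftrightarrow> g \<in> carrier G \<and> aug_elt g \<in> Aug_pow n"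
  by (simp add: dimension_subgroup_def)

lemma aug_elt_mult:
  assumes "g \<in> carrier G" "h \<in> carrier G"
  shows "aug_elt (g \<otimes> h) = aug_elt g \<otimes>\<^bsub>group_algebra G\<^esub> aug_elt h + aug_elt g + aug_elt h"
  using assms
  by (simp add: poly_mapping_bit_diff group_algebra_distrib_left group_algebra_distrib_right algebra_simps)

lemma dimension_subgroup_one: "dimension_subgroup G 1 = carrier G"
  unfolding set_eq_iff dimension_subgroup_iff Aug_pow_1
  by (auto simp: augmentation_ideal_eq dest: subsetD[OF keys_aug_elt])

lemma subgroup_dimension_subgroup: "subgroup (dimension_subgroup G n) G"
proof (rule subgroupI)
  fix g h assume gh: "g \<in> dimension_subgroup G n" "h \<in> dimension_subgroup G n"
  then show "g \<otimes> h \<in> dimension_subgroup G n"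
    unfolding dimension_subgroup_iff
    by (auto simp: aug_elt_mult intro!: Aug_pow_add Aug_pow_mult_right keys_aug_elt)
next
  fix g assume g: "g \<in> dimension_subgroup G n"
  then have gc: "g \<in> carrier G" by (simp add: dimension_subgroup_iff)
  have "aug_elt (inv g) = aug_elt g \<otimes>\<^bsub>group_algebra G\<^esub> Poly_Mapping.single (inv g) 1"
    using gc by (simp add: poly_mapping_bit_diff group_algebra_distrib_right add.commute)
  with g show "inv g \<in> dimension_subgroup G n"
    by (auto simp: dimension_subgroup_iff intro!: Aug_pow_mult_right)
next
  have "(0 :: 'a \<Rightarrow>\<^sub>0 bit) \<in> Aug_pow n"
    using additive_subgroup.zero_closed[OF ideal.axioms(1)[OF ideal_Aug_pow]] by force
  then have "\<one> \<in> dimension_subgroup G n" by (simp add: dimension_subgroup_iff)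
  then show "dimension_subgroup G n \<noteq> {}" by blast
qed (auto simp: dimension_subgroup_iff)

lemma dimension_subgroup_antimono: "m \<le> n \<Longrightarrow> dimension_subgroup G n \<subseteq> dimension_subgroup G m"
  using Aug_pow_antimono[of m n] by (auto simp: dimension_subgroup_iff)

text \<open>gh - hg = (g-1)(h-1) - (h-1)(g-1), and multiplication on the right by the inverse of hg
  turns the left side into [g,h] - 1.\<close>

lemma dimension_subgroup_commutator:
  assumes "g \<in> dimension_subgroup G m" "h \<in> dimension_subgroup G n"
  shows "g \<otimes> h \<otimes> inv g \<otimes> inv h \<in> dimension_subgroup G (m + n)"
proof -
  have gh: "g \<in> carrier G" "h \<in> carrier G" using assms by (auto simp: dimension_subgroup_iff)
  let ?A = "group_algebra G"
  have "aug_elt (g \<otimes> h \<otimes> inv g \<otimes> inv h) =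
    (aug_elt g \<otimes>\<^bsub>?A\<^esub> aug_elt h + aug_elt h \<otimes>\<^bsub>?A\<^esub> aug_elt g) \<otimes>\<^bsub>?A\<^esub> Poly_Mapping.single (inv g \<otimes> inv h) 1"
  proof -
    have "aug_elt g \<otimes>\<^bsub>?A\<^esub> aug_elt h + aug_elt h \<otimes>\<^bsub>?A\<^esub> aug_elt g =
        Poly_Mapping.single (g \<otimes> h) 1 + Poly_Mapping.single (h \<otimes> g) 1"
      using gh by (simp add: poly_mapping_bit_diff group_algebra_distrib_left group_algebra_distrib_right algebra_simps)
    moreover have "h \<otimes> g \<otimes> (inv g \<otimes> inv h) = \<one>"
      using gh by (simp add: inv_mult_group[symmetric])
    ultimately show ?thesis
      using gh by (simp add: poly_mapping_bit_diff group_algebra_distrib_right m_assoc)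
  qed
  also have "\<dots> \<in> Aug_pow (m + n)"
    using Aug_pow_mult[of "aug_elt g" m "aug_elt h" n] Aug_pow_mult[of "aug_elt h" n "aug_elt g" m] assms gh
    by (intro Aug_pow_mult_right[OF Aug_pow_add]) (auto simp: dimension_subgroup_iff add.commute)
  finally show ?thesis using gh by (simp add: dimension_subgroup_iff)
qed

text \<open>In characteristic 2, g^2 - 1 = (g-1)^2.\<close>

lemma dimension_subgroup_square:
  assumes "g \<in> dimension_subgroup G n" shows "g \<otimes> g \<in> dimension_subgroup G (2 * n)"
proof -
  have g: "g \<in> carrier G" using assms by (auto simp: dimension_subgroup_iff)
  have "aug_elt (g \<otimes> g) = aug_elt g \<otimes>\<^bsub>group_algebra G\<^esub> aug_elt g"
    using aug_elt_mult[OF g g] by (simp add: add.assoc)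
  with assms g Aug_pow_mult[of "aug_elt g" n "aug_elt g" n] show ?thesis
    by (simp add: dimension_subgroup_iff mult_2)
qed

end

section \<open>Arithmetic of bits and commutator identities\<close>

declare add_bit_eq_xor [simp del] mult_bit_eq_and [simp del]

lemma bit_add_self [simp]: "(x::bit) + x = 0" "x + (x + y) = y" "x + y + y = x"
  by (cases x; cases y; simp add: add_bit_eq_xor)+

lemma bit_add_eq_zero_iff [simp]: "(x::bit) + y = 0 \<longleftrightarrow> x = y"
  by (cases x; cases y) auto

lemma bit_add_eq_self_iff [simp]: "(x::bit) + y = x \<longleftrightarrow> y = 0" "(x::bit) = x + y \<longleftrightarrow> y = 0"
    "(x::bit) + y = y \<longleftrightarrow> x = 0" "(y::bit) = x + y \<longleftrightarrow> x = 0"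
  by (cases x; cases y; auto)+

context group
begin

abbreviation cmt :: "'a \<Rightarrow> 'a \<Rightarrow> 'a" where
  "cmt g h \<equiv> g \<otimes> h \<otimes> inv g \<otimes> inv h"

lemma inv_cancel_left [simp]:
  "g \<in> carrier G \<Longrightarrow> h \<in> carrier G \<Longrightarrow> g \<otimes> (inv g \<otimes> h) = h"
  "g \<in> carrier G \<Longrightarrow> h \<in> carrier G \<Longrightarrow> inv g \<otimes> (g \<otimes> h) = h"
  by (simp_all flip: m_assoc)

lemma normal_conj_closed:
  "N \<lhd> G \<Longrightarrow> g \<in> carrier G \<Longrightarrow> h \<in> N \<Longrightarrow> g \<otimes> h \<otimes> inv g \<in> N"
  by (rule normal.inv_op_closed2)

lemma normal_conj_closed':
  "N \<lhd> G \<Longrightarrow> g \<in> carrier G \<Longrightarrow> h \<in> N \<Longrightarrow> inv g \<otimes> h \<otimes> g \<in> N"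
  by (rule normal.inv_op_closed1)

text \<open>The Hall-Witt identity for [g,h] = g h g^-1 h^-1. With any two factors in a normal
  subgroup, so is the third; this drives \<open>M_cmt\<close>.\<close>

lemma hall_witt:
  assumes "x \<in> carrier G" "y \<in> carrier G" "z \<in> carrier G"
  shows "cmt (cmt x y) (y \<otimes> z \<otimes> inv y) \<otimes> cmt (cmt y z) (z \<otimes> x \<otimes> inv z) \<otimes> cmt (cmt z x) (x \<otimes> y \<otimes> inv x) = \<one>"
  using assms by (simp add: m_assoc inv_mult_group)

lemma inv_cmt: "g \<in> carrier G \<Longrightarrow> h \<in> carrier G \<Longrightarrow> inv (cmt g h) = cmt h g"
  by (simp add: m_assoc inv_mult_group)

text \<open>[g1 g2, h] is a conjugate of [g2, h] times [g1, h], so a claim about commutators modulo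
  \<open>N\<close> need only be checked on generators.\<close>

lemma subgroup_centralizer_modulo:
  assumes N: "N \<lhd> G" and A: "A \<subseteq> carrier G"
  shows "subgroup {g \<in> carrier G. \<forall>h\<in>A. cmt g h \<in> N} G"
proof (rule subgroupI)
  have one: "\<one> \<in> N" using N by (meson normal_imp_subgroup subgroup.one_closed)
  with A have "\<one> \<in> {g \<in> carrier G. \<forall>h\<in>A. cmt g h \<in> N}" by (auto simp: subset_iff)
  then show "{g \<in> carrier G. \<forall>h\<in>A. cmt g h \<in> N} \<noteq> {}" by blast
next
  fix g assume g: "g \<in> {g \<in> carrier G. \<forall>h\<in>A. cmt g h \<in> N}"
  have "cmt (inv g) h \<in> N" if h: "h \<in> A" for h
  proof -
    have "cmt (inv g) h = inv g \<otimes> inv (cmt g h) \<otimes> g"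
      using g h A by (auto simp: subset_iff m_assoc inv_mult_group)
    moreover have "inv (cmt g h) \<in> N" using g h N by (auto dest: normal_imp_subgroup subgroup.m_inv_closed)
    ultimately show ?thesis using normal_conj_closed'[OF N, of g] g by simp
  qed
  with g show "inv g \<in> {g \<in> carrier G. \<forall>h\<in>A. cmt g h \<in> N}" by auto
next
  fix g1 g2 assume g: "g1 \<in> {g \<in> carrier G. \<forall>h\<in>A. cmt g h \<in> N}" "g2 \<in> {g \<in> carrier G. \<forall>h\<in>A. cmt g h \<in> N}"
  have "cmt (g1 \<otimes> g2) h \<in> N" if h: "h \<in> A" for h
  proof -
    have "cmt (g1 \<otimes> g2) h = (g1 \<otimes> cmt g2 h \<otimes> inv g1) \<otimes> cmt g1 h"
      using g h A by (auto simp: subset_iff m_assoc inv_mult_group)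
    then show ?thesis using g h N by (auto simp: normal_conj_closed normal_imp_subgroup subgroup.m_closed)
  qed
  with g show "g1 \<otimes> g2 \<in> {g \<in> carrier G. \<forall>h\<in>A. cmt g h \<in> N}" by auto
qed auto

end

subsection \<open>Lazard's theorem\<close>

text \<open>Only commutators with the whole group are assumed; the rule for two arbitrary terms is
  derived in \<open>M_cmt\<close>. The last assumption lets functions be extended through a layer
  one element at a time.\<close>

locale restricted_series = group G for G (structure) +
  fixes M :: "nat \<Rightarrow> 'a set"
  assumes M_1: "M 1 = carrier G"
    and M_normal: "\<And>n. M n \<lhd> G"
    and M_Suc: "\<And>n. M (Suc n) \<subseteq> M n"
    and M_cmt1: "\<And>n g h. g \<in> carrier G \<Longrightarrow> h \<in> M n \<Longrightarrow> cmt g h \<in> M (Suc n)"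
    and M_square: "\<And>n g. g \<in> M n \<Longrightarrow> g \<otimes> g \<in> M (2 * n)"
    and M_generated: "\<And>n. 2 \<le> n \<Longrightarrow> M n \<subseteq> generate G
          ({cmt g h | g h. g \<in> carrier G \<and> h \<in> M (n - 1)} \<union> {h \<otimes> h | h. h \<in> M ((n + 1) div 2)})"
    and M_finite: "\<And>n. \<exists>T. finite T \<and> T \<subseteq> M n \<and> M n \<subseteq> generate G (M (Suc n) \<union> T)"
begin

lemma M_subgroup: "subgroup (M n) G"
  using M_normal by (rule normal_imp_subgroup)

lemma M_carrier: "g \<in> M n \<Longrightarrow> g \<in> carrier G"
  using subgroup.subset[OF M_subgroup] by blast

lemma M_antimono: "m \<le> n \<Longrightarrow> M n \<subseteq> M m"
  by (rule lift_Suc_antimono_le[of M, OF M_Suc])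

text \<open>The formal half: by induction both kinds of generators lie in the dimension subgroup,
  the squares because \<open>2 * ((n + 1) div 2)\<close> is at least \<open>n\<close>.\<close>

lemma M_subset_dimension_subgroup: "1 \<le> n \<Longrightarrow> M n \<subseteq> dimension_subgroup G n"
proof (induction n rule: less_induct)
  case (less n)
  show ?case
  proof (cases "n = 1")
    case True then show ?thesis using M_1 dimension_subgroup_one by simp
  next
    case False
    with less have n: "2 \<le> n" by simp
    have "{cmt g h | g h. g \<in> carrier G \<and> h \<in> M (n - 1)} \<subseteq> dimension_subgroup G n"
    proof -
      have "M (n - 1) \<subseteq> dimension_subgroup G (n - 1)" using n by (intro less.IH) auto
      then show ?thesis using n dimension_subgroup_one dimension_subgroup_commutator[of _ 1 _ "n - 1"] by auto
    qed
    moreover have "{h \<otimes> h | h. h \<in> M ((n + 1) div 2)} \<subseteq> dimension_subgroup G n"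
    proof -
      have "h \<otimes> h \<in> dimension_subgroup G n" if "h \<in> M ((n + 1) div 2)" for h
      proof -
        have "h \<in> dimension_subgroup G ((n + 1) div 2)" using subsetD[OF less.IH[of "(n + 1) div 2"] that] n by auto
        then show ?thesis using dimension_subgroup_square dimension_subgroup_antimono[of n "2 * ((n + 1) div 2)"]
          by fastforce
      qed
      then show ?thesis by blast
    qed
    ultimately show ?thesis
      using M_generated[OF n] generate_subgroup_incl[OF _ subgroup_dimension_subgroup] by (meson Un_least subset_trans)
  qed
qed

text \<open>For fixed j, the g with [g, M j] inside \<open>M (i + j)\<close> form a subgroup, so the
  generators of \<open>M i\<close> suffice. Commutators [g, y] with y in \<open>M (i - 1)\<close>
  are handled by the Hall-Witt identity, squares by [y^2, h] = [y, w] w^2 with w = [y, h].\<close>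

lemma M_cmt:
  assumes "1 \<le> i" "1 \<le> j" "g \<in> M i" "h \<in> M j"
  shows "cmt g h \<in> M (i + j)"
  using assms
proof (induction i arbitrary: j g h rule: less_induct)
  case (less i)
  show ?case
  proof (cases "i = 1")
    case True then show ?thesis using M_cmt1[of g h j] less M_carrier by simp
  next
    case False
    with less have i: "2 \<le> i" by simp
    define C where "C = {g \<in> carrier G. \<forall>h\<in>M j. cmt g h \<in> M (i + j)}"
    have C: "subgroup C G"
      unfolding C_def by (rule subgroup_centralizer_modulo[OF M_normal]) (auto dest: M_carrier)
    have inv_in: "cmt u v \<in> M n" if "cmt v u \<in> M n" "u \<in> carrier G" "v \<in> carrier G" for u v n
      using inv_cmt[of v u] subgroup.m_inv_closed[OF M_subgroup that(1)] that by simp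
    have "cmt g y \<in> C" if g: "g \<in> carrier G" and y: "y \<in> M (i - 1)" for g y
    proof -
      have "cmt (cmt g y) h \<in> M (i + j)" if h: "h \<in> M j" for h
      proof -
        \<comment> \<open>\<open>h\<close> is written as a conjugate of \<open>z\<close> by
          \<open>y\<close>, the shape in which it occurs in \<open>hall_witt\<close>.\<close>
        define z where "z = inv y \<otimes> h \<otimes> y"
        have z: "z \<in> M j" unfolding z_def using normal_conj_closed'[OF M_normal] y h M_carrier by blast
        have c: "g \<in> carrier G" "y \<in> carrier G" "z \<in> carrier G" "h \<in> carrier G"
          using g y z h M_carrier by auto
        have h_eq: "h = y \<otimes> z \<otimes> inv y" unfolding z_def using c by (simp add: m_assoc)
        have "cmt y z \<in> M (i - 1 + j)" using less.IH[of "i - 1" j y z] i y z less.prems by simp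
        then have 1: "cmt (cmt y z) (z \<otimes> g \<otimes> inv z) \<in> M (i + j)"
          using M_cmt1[of "z \<otimes> g \<otimes> inv z" "cmt y z" "i - 1 + j"] c i
            inv_in[of "z \<otimes> g \<otimes> inv z" "cmt y z" "i + j"] by simp
        have "cmt z g \<in> M (Suc j)" using inv_in[OF M_cmt1[of g z j]] c z by simp
        moreover have "g \<otimes> y \<otimes> inv g \<in> M (i - 1)" using normal_conj_closed[OF M_normal] c y by blast
        ultimately have "cmt (g \<otimes> y \<otimes> inv g) (cmt z g) \<in> M (i - 1 + Suc j)"
          using i less.IH[of "i - 1" "Suc j" "g \<otimes> y \<otimes> inv g" "cmt z g"] by simp
        then have 2: "cmt (cmt z g) (g \<otimes> y \<otimes> inv g) \<in> M (i + j)"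
          using i c inv_in[of "g \<otimes> y \<otimes> inv g" "cmt z g" "i + j"] by simp
        have "cmt (cmt g y) h = inv (cmt (cmt y z) (z \<otimes> g \<otimes> inv z) \<otimes> cmt (cmt z g) (g \<otimes> y \<otimes> inv g))"
          unfolding h_eq using c hall_witt[of g y z] m_assoc[of "cmt (cmt g y) (y \<otimes> z \<otimes> inv y)"]
          by (intro inv_equality[symmetric]) simp_all
        then show ?thesis using 1 2 M_subgroup by (simp add: subgroup.m_closed subgroup.m_inv_closed)
      qed
      with g y M_carrier[OF y] show ?thesis by (auto simp: C_def)
    qed
    moreover have "y \<otimes> y \<in> C" if y: "y \<in> M ((i + 1) div 2)" for y
    proof -
      let ?k = "(i + 1) div 2"
      have k: "1 \<le> ?k" "?k < i" "i \<le> 2 * ?k" using i by auto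
      have "cmt (y \<otimes> y) h \<in> M (i + j)" if h: "h \<in> M j" for h
      proof -
        define w where "w = cmt y h"
        have w: "w \<in> M (?k + j)" unfolding w_def using less.IH[of ?k j y h] k y h less.prems by simp
        have c: "y \<in> carrier G" "h \<in> carrier G" "w \<in> carrier G" using y h w M_carrier by auto
        have "cmt y w \<in> M (?k + (?k + j))" using less.IH[of ?k "?k + j" y w] k y w by simp
        moreover have "w \<otimes> w \<in> M (2 * (?k + j))" using M_square[OF w] .
        ultimately have "cmt y w \<in> M (i + j)" "w \<otimes> w \<in> M (i + j)"
          using k M_antimono[of "i + j" "?k + (?k + j)"] M_antimono[of "i + j" "2 * (?k + j)"] by auto
        moreover have "cmt (y \<otimes> y) h = cmt y w \<otimes> (w \<otimes> w)"
          using c by (simp add: w_def m_assoc inv_mult_group)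
        ultimately show ?thesis using M_subgroup by (simp add: subgroup.m_closed)
      qed
      with M_carrier[OF y] show ?thesis by (auto simp: C_def)
    qed
    ultimately have "M i \<subseteq> C"
      using M_generated[OF i] generate_subgroup_incl[OF _ C] by (smt (verit, ccfv_SIG) Un_iff mem_Collect_eq subset_iff)
    then show ?thesis using less.prems by (auto simp: C_def)
  qed
qed

text \<open>\<open>pd H f d\<close>: on \<open>H\<close>, the function \<open>f\<close> is polynomial of degree less than \<open>d\<close>, where a difference in a
  direction of weight \<open>i + 1\<close> lowers the degree by \<open>i + 1\<close> (the subtraction truncates at 0).\<close>

fun pd :: "'a set \<Rightarrow> ('a \<Rightarrow> bit) \<Rightarrow> nat \<Rightarrow> bool" where
  "pd H f 0 = (\<forall>y\<in>H. f y = 0)"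
| "pd H f (Suc d) = (\<forall>i. \<forall>g\<in>H \<inter> M (Suc i). pd H (\<lambda>y. f (y \<otimes> g) + f y) (d - i))"

lemma pd_cong:
  assumes H: "subgroup H G" and eq: "\<And>y. y \<in> H \<Longrightarrow> f y = f' y"
  shows "pd H f d \<longleftrightarrow> pd H f' d"
  using eq
proof (induction d arbitrary: f f' rule: less_induct)
  case (less d)
  show ?case
  proof (cases d)
    case (Suc d')
    have "pd H (\<lambda>y. f (y \<otimes> g) + f y) (d' - i) \<longleftrightarrow> pd H (\<lambda>y. f' (y \<otimes> g) + f' y) (d' - i)"
      if "g \<in> H" for g i
      using Suc that less.prems subgroup.m_closed[OF H] by (intro less.IH) auto
    then show ?thesis using Suc by auto
  qed (use less in auto)
qed

lemma pd_transfer: "pd H f d \<Longrightarrow> subgroup H G \<Longrightarrow> (\<And>y. y \<in> H \<Longrightarrow> f' y = f y) \<Longrightarrow> pd H f' d"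
  using pd_cong by blast

lemma pd_zero:
  assumes "subgroup H G" and "\<And>y. y \<in> H \<Longrightarrow> f y = 0" shows "pd H f d"
proof -
  have "pd H (\<lambda>_. 0) d" by (induction d rule: less_induct) (case_tac x; simp)
  with pd_cong[OF assms(1), of f "\<lambda>_. 0"] assms(2) show ?thesis by blast
qed

lemma pd_const: "pd H (\<lambda>_. c) (Suc d)" if "subgroup H G"
  by (simp add: pd_zero[OF that])

lemma pd_mono: "subgroup H G \<Longrightarrow> pd H f d \<Longrightarrow> d \<le> e \<Longrightarrow> pd H f e"
proof (induction d arbitrary: f e rule: less_induct)
  case (less d)
  show ?case
  proof (cases d)
    case 0 with less show ?thesis by (intro pd_zero) auto
  next
    case (Suc d')
    with less(4) obtain e' where e: "e = Suc e'" "d' \<le> e'" by (cases e) auto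
    have "pd H (\<lambda>y. f (y \<otimes> g) + f y) (e' - i)" if "g \<in> H \<inter> M (Suc i)" for g i
      by (rule less.IH[of "d' - i"]) (use that less(2,3) Suc e in auto)
    then show ?thesis using e by simp
  qed
qed

lemma pd_add: "pd H f d \<Longrightarrow> pd H f' d \<Longrightarrow> pd H (\<lambda>y. f y + f' y) d"
proof (induction d arbitrary: f f' rule: less_induct)
  case (less d)
  show ?case
  proof (cases d)
    case (Suc d')
    have "pd H (\<lambda>y. (f (y \<otimes> g) + f' (y \<otimes> g)) + (f y + f' y)) (d' - i)" if "g \<in> H \<inter> M (Suc i)" for g i
      using less.IH[of "d' - i" "\<lambda>y. f (y \<otimes> g) + f y" "\<lambda>y. f' (y \<otimes> g) + f' y"] that less.prems Suc
      by (simp add: add_ac)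
    then show ?thesis using Suc by simp
  qed (use less in simp)
qed

text \<open>The shifted function is \<open>f\<close> plus its derivative along \<open>g\<close>, and
  every element has weight at least 1.\<close>

lemma pd_shift:
  assumes H: "subgroup H G" and f: "pd H f d" and g: "g \<in> H" shows "pd H (\<lambda>y. f (y \<otimes> g)) d"
proof (cases d)
  case 0
  then show ?thesis using f g subgroup.m_closed[OF H] by auto
next
  case (Suc d')
  have "g \<in> M (Suc 0)" using M_1 g subgroup.subset[OF H] by auto
  moreover have "\<forall>i. \<forall>g\<in>H \<inter> M (Suc i). pd H (\<lambda>y. f (y \<otimes> g) + f y) (d' - i)" using f Suc by simp
  ultimately have "pd H (\<lambda>y. f (y \<otimes> g) + f y) (d' - 0)" using g by blast
  then have "pd H (\<lambda>y. f (y \<otimes> g) + f y) d" by (rule pd_mono[OF H]) (use Suc in simp)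
  from pd_add[OF this f] show ?thesis by simp
qed

end

text \<open>One step of the extension of a polynomial function: it is made constant along the new element \<open>t\<close> of weight \<open>j\<close>.\<close>

locale extend_by_element = restricted_series +
  fixes H :: "'a set" and t :: 'a and j :: nat
  assumes H: "subgroup H G" and j: "1 \<le> j" and M_H: "M (Suc j) \<subseteq> H" and H_M: "H \<subseteq> M j"
    and t: "t \<in> M j" "t \<notin> H"
begin

text \<open>Two cosets already form a subgroup, since the square of \<open>t\<close> has weight
  \<open>2 * j\<close> and so lies in \<open>M (Suc j)\<close>, hence in \<open>H\<close>.\<close>

definition H' :: "'a set" where "H' = H \<union> {h \<otimes> t | h. h \<in> H}"

definition ext :: "('a \<Rightarrow> bit) \<Rightarrow> 'a \<Rightarrow> bit" where
  "ext f y = (if y \<in> H then f y else f (y \<otimes> inv t))"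

text \<open>The indicator of the new coset; it plays the part of a coordinate of weight
  \<open>j\<close>.\<close>

definition eps :: "'a \<Rightarrow> bit" where "eps y = (if y \<in> H then 0 else 1)"

lemma t_carrier [simp]: "t \<in> carrier G" using t M_carrier by blast

lemma H_carrier: "h \<in> H \<Longrightarrow> h \<in> carrier G" using subgroup.mem_carrier[OF H] .

lemma H_mult: "h \<in> H \<Longrightarrow> k \<in> H \<Longrightarrow> h \<otimes> k \<in> H" using subgroup.m_closed[OF H] .

lemma conj_H: "h \<in> H \<Longrightarrow> t \<otimes> h \<otimes> inv t \<in> H"
proof -
  assume h: "h \<in> H"
  have "cmt t h \<in> M (Suc j)" using M_cmt1[of t h j] h H_M by auto
  then have "cmt t h \<otimes> h \<in> H" using M_H h H_mult by auto
  then show ?thesis using h H_carrier by (simp add: m_assoc)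
qed

lemma square_t: "t \<otimes> t \<in> M (2 * j)" using M_square t by auto

lemma square_t_H: "t \<otimes> t \<in> H"
  using square_t M_antimono[of "Suc j" "2 * j"] j M_H by auto

lemma mult_t_notin_H: "h \<in> H \<Longrightarrow> h \<otimes> t \<notin> H"
proof
  assume "h \<in> H" "h \<otimes> t \<in> H"
  then have "inv h \<otimes> (h \<otimes> t) \<in> H" using subgroup.m_inv_closed[OF H] H_mult by blast
  then show False using \<open>h \<in> H\<close> H_carrier t by simp
qed

lemma H'_cases:
  assumes "y \<in> H'" obtains "y \<in> H" | h where "h \<in> H" "y = h \<otimes> t" using assms by (auto simp: H'_def)

lemma H'_mult_t: "h \<in> H' \<Longrightarrow> h \<otimes> t \<in> H'"
  by (erule H'_cases) (auto simp: H'_def m_assoc H_carrier H_mult square_t_H)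

lemma H'_mult_H: "h \<in> H' \<Longrightarrow> k \<in> H \<Longrightarrow> h \<otimes> k \<in> H'"
proof (erule H'_cases)
  fix h0 assume k: "k \<in> H" and h: "h0 \<in> H" "h = h0 \<otimes> t"
  have "h \<otimes> k = (h0 \<otimes> (t \<otimes> k \<otimes> inv t)) \<otimes> t" using h k H_carrier by (simp add: m_assoc)
  then show ?thesis using h k conj_H H_mult by (auto simp: H'_def)
qed (auto simp: H'_def H_mult)

lemma H'_subgroup: "subgroup H' G"
proof (rule subgroupI)
  show "H' \<subseteq> carrier G" by (auto simp: H'_def H_carrier)
  show "H' \<noteq> {}" using subgroup.one_closed[OF H] by (auto simp: H'_def)
  show "h \<otimes> k \<in> H'" if "h \<in> H'" "k \<in> H'" for h k
    using that(2)
  proof (cases rule: H'_cases)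
    case (2 k0)
    have "h \<in> carrier G" using that \<open>H' \<subseteq> carrier G\<close> by auto
    with 2 that H'_mult_t[OF H'_mult_H[OF that(1) 2(1)]] show ?thesis by (simp add: m_assoc H_carrier)
  qed (use that H'_mult_H in auto)
  show "inv h \<in> H'" if "h \<in> H'" for h
    using that
  proof (cases rule: H'_cases)
    case 1 then show ?thesis using subgroup.m_inv_closed[OF H] by (auto simp: H'_def)
  next
    case (2 k)
    have "inv h = (inv (t \<otimes> t) \<otimes> t) \<otimes> inv k"
      using 2 H_carrier by (simp add: inv_mult_group m_assoc)
    moreover have "inv (t \<otimes> t) \<otimes> t \<in> H'"
      using square_t_H subgroup.m_inv_closed[OF H] by (auto simp: H'_def)
    ultimately show ?thesis using 2 subgroup.m_inv_closed[OF H] H'_mult_H by simp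
  qed
qed

lemma H_H': "H \<subseteq> H'" by (auto simp: H'_def)

lemma H'_M: "H' \<subseteq> M j"
  using H_M t subgroup.m_closed[OF M_subgroup, of _ j] by (auto simp: H'_def)

lemma t_H': "t \<in> H'"
  using subgroup.one_closed[OF H] t_carrier l_one unfolding H'_def by force

lemma ext_H [simp]: "h \<in> H \<Longrightarrow> ext f h = f h"
  by (simp add: ext_def)

lemma ext_t [simp]: "h \<in> H \<Longrightarrow> ext f (h \<otimes> t) = f h"
  using mult_t_notin_H H_carrier by (simp add: ext_def m_assoc)

lemma eps_H [simp]: "h \<in> H \<Longrightarrow> eps h = 0" and eps_t [simp]: "h \<in> H \<Longrightarrow> eps (h \<otimes> t) = 1"
  using mult_t_notin_H by (auto simp: eps_def)

text \<open>The derivative of an extended function in a direction \<open>u \<in> H\<close>; the second summand comes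
  from moving \<open>u\<close> past \<open>t\<close>.\<close>

lemma ext_derivative:
  assumes u: "u \<in> H" and y: "y \<in> H'"
  defines "c \<equiv> inv u \<otimes> (t \<otimes> u \<otimes> inv t)"
  shows "ext f (y \<otimes> u) + ext f y =
    ext (\<lambda>h. f (h \<otimes> u) + f h) y + eps y * ext (\<lambda>h. f (h \<otimes> u \<otimes> c) + f (h \<otimes> u)) y"
  using y
proof (cases rule: H'_cases)
  case 1 then show ?thesis using u by (simp add: H_mult)
next
  case (2 h)
  have "y \<otimes> u = (h \<otimes> u \<otimes> c) \<otimes> t" using 2 u H_carrier by (simp add: c_def m_assoc)
  moreover have "h \<otimes> u \<otimes> c \<in> H"
    unfolding c_def by (intro H_mult[OF H_mult[OF 2(1) u]] H_mult[OF subgroup.m_inv_closed[OF H u] conj_H[OF u]])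
  ultimately show ?thesis using 2 by (simp add: add_ac)
qed

lemma eps_mult: "u \<in> H \<Longrightarrow> y \<in> H' \<Longrightarrow> eps (y \<otimes> u) = eps y"
proof -
  assume u: "u \<in> H" and "y \<in> H'"
  from this(2) show ?thesis
  proof (cases rule: H'_cases)
    case (2 h)
    have "y \<otimes> u = (h \<otimes> (t \<otimes> u \<otimes> inv t)) \<otimes> t" using 2 u H_carrier by (simp add: m_assoc)
    moreover have "h \<otimes> (t \<otimes> u \<otimes> inv t) \<in> H" using 2 u conj_H H_mult by auto
    ultimately show ?thesis using 2 by simp
  qed (use u H_mult in auto)
qed

text \<open>\<open>M (Suc i)\<close> meets the new coset only if \<open>Suc i\<close> is at most
  \<open>j\<close>; then it contains \<open>t\<close> and hence also the factor
  \<open>u\<close>.\<close>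

lemma H'_M_cases:
  assumes g: "g \<in> H' \<inter> M (Suc i)"
  obtains (H) "g \<in> H" | (T) u where "u \<in> H" "u \<in> M (Suc i)" "g = u \<otimes> t" "Suc i \<le> j"
proof (cases "g \<in> H")
  case False
  with g obtain u where u: "u \<in> H" "g = u \<otimes> t" by (auto simp: H'_def)
  have i: "Suc i \<le> j"
  proof (rule ccontr)
    assume "\<not> Suc i \<le> j"
    then have "M (Suc i) \<subseteq> H" using M_antimono[of "Suc j" "Suc i"] M_H by auto
    with g False show False by auto
  qed
  then have "t \<in> M (Suc i)" using subsetD[OF M_antimono t(1)] by simp
  then have "g \<otimes> inv t \<in> M (Suc i)"
    using g by (intro subgroup.m_closed[OF M_subgroup] subgroup.m_inv_closed[OF M_subgroup]) auto
  moreover have "g \<otimes> inv t = u" using u H_carrier by (simp add: m_assoc)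
  ultimately show ?thesis using that u i by auto
qed (use that in auto)

lemma commutator_weight:
  assumes u: "u \<in> H" "u \<in> M (Suc i)"
  shows "inv u \<otimes> (t \<otimes> u \<otimes> inv t) \<in> H \<inter> M (Suc (i + j))"
proof -
  have "inv u \<in> M (Suc i)" using u subgroup.m_inv_closed[OF M_subgroup] by auto
  then have "cmt (inv u) t \<in> M (Suc i + j)" using t j by (intro M_cmt) auto
  moreover have "cmt (inv u) t = inv u \<otimes> (t \<otimes> u \<otimes> inv t)" using u H_carrier by (simp add: m_assoc)
  moreover have "inv u \<otimes> (t \<otimes> u \<otimes> inv t) \<in> H"
    by (intro H_mult[OF subgroup.m_inv_closed[OF H u(1)] conj_H[OF u(1)]])
  ultimately show ?thesis by simp
qed

text \<open>Both claims are proved together, as the derivatives of each involve the other. Moving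
  \<open>u\<close> of weight i + 1 past \<open>t\<close> yields a factor \<open>eps\<close>, which
  costs \<open>j\<close>, but also a derivative along a commutator of weight i + 1 + j, which gains
  it back. Along \<open>t\<close> itself, \<open>ext f\<close> changes only on the new coset, by a
  derivative along the square of \<open>t\<close>, of weight \<open>2 * j\<close>: one
  \<open>j\<close> pays for \<open>eps\<close>, the other is the required loss.\<close>

lemma pd_ext_and_eps:
  "pd H f d \<Longrightarrow> pd H' (ext f) d \<and> (0 < d \<longrightarrow> pd H' (\<lambda>y. eps y * ext f y) (d + j))"
proof (induction d arbitrary: f rule: less_induct)
  case (less d)
  note S = H'_subgroup
  show ?case
  proof (cases d)
    case 0
    then show ?thesis using less.prems by (auto elim!: H'_cases)
  next
    case (Suc d')
    have eps_ext: "pd H' (\<lambda>y. eps y * ext f' y) (e + j)" if "pd H f' e" "e \<le> d'" for f' e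
    proof (cases "e = 0")
      case True
      then show ?thesis using that by (intro pd_zero[OF S]) (auto elim!: H'_cases)
    qed (use less.IH[of e f'] that Suc in auto)
    have deriv_c: "pd H (\<lambda>h. f (h \<otimes> u \<otimes> c) + f (h \<otimes> u)) (d' - (i + j))"
      if u: "u \<in> H" "u \<in> M (Suc i)" and c: "c = inv u \<otimes> (t \<otimes> u \<otimes> inv t)" for u c i
    proof -
      have "pd H (\<lambda>h. f (h \<otimes> c) + f h) (d' - (i + j))"
        using less.prems Suc commutator_weight[OF u] c by simp
      from pd_shift[OF H this u(1)] show ?thesis .
    qed
    have deriv_u: "pd H (\<lambda>h. f (h \<otimes> u) + f h) (d' - i)" if u: "u \<in> H" "u \<in> M (Suc i)" for u i
      using less.prems u Suc by simp
    \<comment> \<open>Directions of weight \<open>Suc i\<close> are counted by \<open>i\<close> in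
      \<open>pd\<close>, so the weight \<open>2 * j\<close> appears as
      \<open>2 * j - 1\<close>.\<close>
    have deriv_t: "pd H (\<lambda>h. f (h \<otimes> (t \<otimes> t)) + f h) (d' - (2 * j - 1))"
    proof -
      have "t \<otimes> t \<in> H \<inter> M (Suc (2 * j - 1))" using square_t_H square_t j by (simp del: mult_2)
      then show ?thesis using less.prems Suc by simp
    qed
    have 1: "pd H' (\<lambda>y. ext f (y \<otimes> u) + ext f y) (d' - i)" if u: "u \<in> H" "u \<in> M (Suc i)" for u i
    proof -
      define c where "c = inv u \<otimes> (t \<otimes> u \<otimes> inv t)"
      have "pd H' (ext (\<lambda>h. f (h \<otimes> u) + f h)) (d' - i)"
        using less.IH[OF _ deriv_u[OF u]] Suc by simp
      moreover have "pd H' (\<lambda>y. eps y * ext (\<lambda>h. f (h \<otimes> u \<otimes> c) + f (h \<otimes> u)) y) (d' - i)"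
      proof (cases "d' - (i + j) = 0")
        case True
        with deriv_c[OF u c_def] show ?thesis by (intro pd_zero[OF S]) (auto elim!: H'_cases)
      next
        case False
        then show ?thesis using eps_ext[OF deriv_c[OF u c_def] diff_le_self] by (elim pd_mono[OF S]) auto
      qed
      ultimately have "pd H' (\<lambda>y. ext (\<lambda>h. f (h \<otimes> u) + f h) y
          + eps y * ext (\<lambda>h. f (h \<otimes> u \<otimes> c) + f (h \<otimes> u)) y) (d' - i)" by (rule pd_add)
      then show ?thesis by (rule pd_transfer[OF _ S]) (rule ext_derivative[OF u(1), folded c_def])
    qed
    have ext: "pd H' (ext f) d"
    proof -
      have "pd H' (\<lambda>y. ext f (y \<otimes> g) + ext f y) (d' - i)" if g: "g \<in> H' \<inter> M (Suc i)" for g i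
        using g
      proof (cases rule: H'_M_cases)
        case H then show ?thesis using 1 g by blast
      next
        case (T u)
        have "pd H (\<lambda>h. f (h \<otimes> (t \<otimes> t)) + f h) (d' - (2 * j - 1))"
          by (rule deriv_t)
        then have "pd H' (\<lambda>y. eps y * ext (\<lambda>h. f (h \<otimes> (t \<otimes> t)) + f h) y) (d' - (2 * j - 1) + j)"
          by (rule eps_ext) simp
        moreover have "eps y * ext (\<lambda>h. f (h \<otimes> (t \<otimes> t)) + f h) y = ext f (y \<otimes> t) + ext f y" if "y \<in> H'" for y
          using that
        proof (cases rule: H'_cases)
          case (2 h)
          then have "y \<otimes> t = h \<otimes> (t \<otimes> t)" using H_carrier by (simp add: m_assoc)
          with 2 show ?thesis using square_t_H H_mult by simp
        qed simp
        ultimately have *: "pd H' (\<lambda>y. ext f (y \<otimes> t) + ext f y) (d' - (2 * j - 1) + j)"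
          by (elim pd_transfer[OF _ S]) simp
        have "pd H' (\<lambda>y. ext f (y \<otimes> t) + ext f y) (d' - i)"
        \<comment> \<open>For small \<open>d'\<close> truncated subtraction leaves the bound
          \<open>j\<close>, which may exceed \<open>d' - i\<close>; but there the derivative along
          the square of \<open>t\<close> has bound 0 and vanishes.\<close>
        proof (cases "d' \<le> 2 * j - 1")
          case True
          have "pd H (\<lambda>h. f (h \<otimes> (t \<otimes> t)) + f h) 0"
            using deriv_t True by (simp del: pd.simps)
          then have sq: "\<forall>h\<in>H. f (h \<otimes> (t \<otimes> t)) + f h = 0" by simp
          have "ext f (y \<otimes> t) + ext f y = 0" if "y \<in> H'" for y
            using that
          proof (cases rule: H'_cases)
            case (2 h)
            then have "y \<otimes> t = h \<otimes> (t \<otimes> t)" using H_carrier by (simp add: m_assoc)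
            with 2 sq show ?thesis using square_t_H H_mult by simp
          qed simp
          then show ?thesis by (intro pd_zero[OF S])
        next
          case False
          from T(4) j have "d' - (2 * j - 1) + j \<le> d' - i" using False by linarith
          then show ?thesis by (rule pd_mono[OF S *])
        qed
        from pd_add[OF pd_shift[OF S this, of u] 1[OF T(1,2)]] T(1) H_H'
        have "pd H' (\<lambda>y. ext f (y \<otimes> u \<otimes> t) + ext f y) (d' - i)" by (auto simp: add_ac)
        moreover have "y \<otimes> u \<otimes> t = y \<otimes> g" if "y \<in> H'" for y
          using that T H_carrier subgroup.mem_carrier[OF S] by (simp add: m_assoc)
        ultimately show ?thesis by (elim pd_transfer[OF _ S]) simp
      qed
      then show ?thesis using Suc by simp
    qed
    have "pd H' (\<lambda>y. eps (y \<otimes> g) * ext f (y \<otimes> g) + eps y * ext f y) (d' + j - i)" if g: "g \<in> H' \<inter> M (Suc i)" for g i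
    proof -
      have 2: "pd H' (\<lambda>y. eps (y \<otimes> u) * ext f (y \<otimes> u) + eps y * ext f y) (d' + j - i)"
        if u: "u \<in> H" "u \<in> M (Suc i)" for u
      proof -
        define c where "c = inv u \<otimes> (t \<otimes> u \<otimes> inv t)"
        have "pd H' (\<lambda>y. eps y * ext (\<lambda>h. f (h \<otimes> u) + f h) y) (d' + j - i)"
        proof (cases "d' \<le> i")
          case True
          with deriv_u[OF u] show ?thesis by (intro pd_zero[OF S]) (auto elim!: H'_cases)
        next
          case False
          then show ?thesis using eps_ext[OF deriv_u[OF u] diff_le_self] by (elim pd_mono[OF S]) auto
        qed
        moreover have "pd H' (\<lambda>y. eps y * ext (\<lambda>h. f (h \<otimes> u \<otimes> c) + f (h \<otimes> u)) y) (d' + j - i)"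
        proof (cases "d' \<le> i + j")
          case True
          with deriv_c[OF u c_def] show ?thesis by (intro pd_zero[OF S]) (auto elim!: H'_cases)
        next
          case False
          then show ?thesis using eps_ext[OF deriv_c[OF u c_def] diff_le_self] by (elim pd_mono[OF S]) auto
        qed
        moreover have eq: "eps (y \<otimes> u) * ext f (y \<otimes> u) + eps y * ext f y =
          eps y * ext (\<lambda>h. f (h \<otimes> u) + f h) y + eps y * ext (\<lambda>h. f (h \<otimes> u \<otimes> c) + f (h \<otimes> u)) y" if y: "y \<in> H'" for y
        proof -
          have "eps (y \<otimes> u) * ext f (y \<otimes> u) + eps y * ext f y = eps y * (ext f (y \<otimes> u) + ext f y)"
            using eps_mult[OF u(1) y] by (simp add: distrib_left)
          then show ?thesis unfolding ext_derivative[OF u(1) y, folded c_def]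
            by (cases "eps y") (simp_all add: distrib_left)
        qed
        ultimately have "pd H' (\<lambda>y. eps y * ext (\<lambda>h. f (h \<otimes> u) + f h) y
            + eps y * ext (\<lambda>h. f (h \<otimes> u \<otimes> c) + f (h \<otimes> u)) y) (d' + j - i)" using pd_add by blast
        then show ?thesis by (rule pd_transfer[OF _ S]) (rule eq)
      qed
      from g show ?thesis
      proof (cases rule: H'_M_cases)
        case H then show ?thesis using 2 g by blast
      next
        case (T u)
        \<comment> \<open>Exactly one of y and y t lies in \<open>H\<close>, so the derivative of
          the product along \<open>t\<close> is \<open>ext f\<close>: multiplication by
          \<open>eps\<close> integrates along \<open>t\<close>.\<close>
        have "eps (y \<otimes> t) * ext f (y \<otimes> t) + eps y * ext f y = ext f y" if "y \<in> H'" for y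
          using that
        proof (cases rule: H'_cases)
          case (2 h)
          then have "y \<otimes> t = h \<otimes> (t \<otimes> t)" using H_carrier by (simp add: m_assoc)
          with 2 show ?thesis using square_t_H H_mult by simp
        qed simp
        with ext have "pd H' (\<lambda>y. eps (y \<otimes> t) * ext f (y \<otimes> t) + eps y * ext f y) d"
          by (elim pd_transfer[OF _ S]) simp
        then have "pd H' (\<lambda>y. eps (y \<otimes> t) * ext f (y \<otimes> t) + eps y * ext f y) (d' + j - i)"
          using T(4) Suc by (elim pd_mono[OF S]) auto
        from pd_add[OF pd_shift[OF S this, of u] 2[OF T(1,2)]] T(1) H_H'
        have "pd H' (\<lambda>y. eps (y \<otimes> u \<otimes> t) * ext f (y \<otimes> u \<otimes> t) + eps y * ext f y) (d' + j - i)" by (auto simp: add_ac)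
        moreover have "y \<otimes> u \<otimes> t = y \<otimes> g" if "y \<in> H'" for y
          using that T H_carrier subgroup.mem_carrier[OF S] by (simp add: m_assoc)
        ultimately show ?thesis by (elim pd_transfer[OF _ S]) simp
      qed
    qed
    then show ?thesis using ext Suc by simp
  qed
qed

end

context restricted_series
begin

lemma extend_finite:
  assumes "finite T" "T \<subseteq> M j" "1 \<le> j" "subgroup H G" "M (Suc j) \<subseteq> H" "H \<subseteq> M j" "pd H f d"
  shows "\<exists>H' f'. subgroup H' G \<and> H \<union> T \<subseteq> H' \<and> H' \<subseteq> M j \<and> pd H' f' d \<and> (\<forall>y\<in>H. f' y = f y)"
  using assms
proof (induction T)
  case empty
  then show ?case by (intro exI[of _ H] exI[of _ f]) simp
next
  case (insert t T)
  obtain K f' where K: "subgroup K G" "H \<union> T \<subseteq> K" "K \<subseteq> M j" "pd K f' d" "\<forall>y\<in>H. f' y = f y"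
    using insert.IH insert.prems by (metis insert_subset)
  show ?case
  proof (cases "t \<in> K")
    case True
    with K show ?thesis by (intro exI[of _ K] exI[of _ f'] conjI) auto
  next
    case False
    have K': "M (Suc j) \<subseteq> K" "t \<in> M j" using K(2) insert.prems(1,4) by auto
    interpret extend_by_element G M K t j
      by (intro extend_by_element.intro extend_by_element_axioms.intro restricted_series_axioms
          K K' False insert.prems(2))
    have "pd H' (ext f') d" using pd_ext_and_eps[OF K(4)] by simp
    moreover have "\<forall>y\<in>H. ext f' y = f y" using K by auto
    ultimately show ?thesis
      using K(2) H'_subgroup H_H' H'_M t_H' by (intro exI[of _ H'] exI[of _ "ext f'"]) blast
  qed
qed

lemma extend_to_level:
  assumes "1 \<le> j" "subgroup H G" "M (Suc j) \<subseteq> H" "H \<subseteq> M j" "pd H f d"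
  shows "\<exists>f'. pd (M j) f' d \<and> (\<forall>y\<in>H. f' y = f y)"
proof -
  obtain T where T: "finite T" "T \<subseteq> M j" "M j \<subseteq> generate G (M (Suc j) \<union> T)" using M_finite by blast
  obtain K f' where K: "subgroup K G" "H \<union> T \<subseteq> K" "K \<subseteq> M j" "pd K f' d" "\<forall>y\<in>H. f' y = f y"
    using extend_finite[OF T(1,2) assms] by blast
  have "generate G (M (Suc j) \<union> T) \<subseteq> K"
    using K assms(3) by (intro generate_subgroup_incl) auto
  with T K have "K = M j" by blast
  with K show ?thesis by blast
qed

text \<open>The layers are filled one after another, down to the first, whose term is the whole
  group.\<close>

lemma extend_to_group:
  assumes "1 \<le> j" "subgroup H G" "M (Suc j) \<subseteq> H" "H \<subseteq> M j" "pd H f d"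
  shows "\<exists>f'. pd (carrier G) f' d \<and> (\<forall>y\<in>H. f' y = f y)"
  using assms
proof (induction j arbitrary: H f rule: nat_induct_at_least)
  case base
  then show ?case using extend_to_level[of 1 H f d] M_1 by simp
next
  case (Suc j)
  obtain f' where f': "pd (M (Suc j)) f' d" "\<forall>y\<in>H. f' y = f y"
    using extend_to_level[OF _ Suc.prems] by (metis le_add1 plus_1_eq_Suc)
  obtain f'' where f'': "pd (carrier G) f'' d" "\<forall>y\<in>M (Suc j). f'' y = f' y"
    using Suc.IH[OF M_subgroup order.refl M_Suc f'(1)] by blast
  then show ?case using f' Suc.prems(3) by (intro exI[of _ f'']) auto
qed

text \<open>On \<open>M (Suc k)\<close> the constant 1 has degree bound 1. Adjoining
  \<open>g\<close> and multiplying by \<open>eps\<close> gives a function with bound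
  \<open>Suc k\<close> that vanishes on \<open>M (Suc k)\<close> but not at \<open>g\<close>; it is
  then extended layer by layer.\<close>

lemma separating_function:
  assumes k: "1 \<le> k" and g: "g \<in> M k" "g \<notin> M (Suc k)"
  obtains f where "pd (carrier G) f (Suc k)" "f \<one> = 0" "f g = 1"
proof -
  interpret extend_by_element G M "M (Suc k)" g k
    by (intro extend_by_element.intro extend_by_element_axioms.intro restricted_series_axioms k g
        M_subgroup M_Suc order.refl)
  have "pd (M (Suc k)) (\<lambda>_. 1) (Suc 0)" using pd_const[OF M_subgroup] .
  then have "pd H' (\<lambda>y. eps y * ext (\<lambda>_. 1) y) (Suc k)"
    using pd_ext_and_eps[of "\<lambda>_. 1" "Suc 0"] by simp
  then obtain f where f: "pd (carrier G) f (Suc k)" "\<forall>y\<in>H'. f y = eps y * ext (\<lambda>_. 1) y"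
    using extend_to_group[OF k H'_subgroup _ H'_M] H_H' by blast
  have one: "\<one> \<in> M (Suc k)" using subgroup.one_closed[OF H] .
  then have "f \<one> = 0" using f H_H' by auto
  moreover have "f g = 1" using f t_H' g one by (simp add: eps_def ext_def)
  ultimately show ?thesis using that f by blast
qed

end

section \<open>Polynomial functions annihilate powers of the augmentation ideal\<close>

definition linear_ext :: "('a \<Rightarrow> bit) \<Rightarrow> ('a \<Rightarrow>\<^sub>0 bit) \<Rightarrow> bit" where
  "linear_ext f p = (\<Sum>u\<in>Poly_Mapping.keys p. Poly_Mapping.lookup p u * f u)"

lemma linear_ext_superset:
  "finite S \<Longrightarrow> Poly_Mapping.keys p \<subseteq> S \<Longrightarrow> linear_ext f p = (\<Sum>u\<in>S. Poly_Mapping.lookup p u * f u)"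
  unfolding linear_ext_def by (rule sum.mono_neutral_left) (auto simp: in_keys_iff)

lemma linear_ext_add: "linear_ext f (p + q) = linear_ext f p + linear_ext f q"
proof -
  have *: "Poly_Mapping.keys (p + q) \<subseteq> Poly_Mapping.keys p \<union> Poly_Mapping.keys q" by (rule keys_add)
  show ?thesis
    by (subst (1 2 3) linear_ext_superset[of "Poly_Mapping.keys p \<union> Poly_Mapping.keys q"])
       (use * in \<open>auto simp: lookup_add sum.distrib distrib_right\<close>)
qed

lemma linear_ext_zero [simp]: "linear_ext f 0 = 0"
  by (simp add: linear_ext_def)

lemma linear_ext_sum: "linear_ext f (\<Sum>i\<in>I. p i) = (\<Sum>i\<in>I. linear_ext f (p i))"
  by (induction I rule: infinite_finite_induct) (auto simp: linear_ext_add)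

lemma linear_ext_single [simp]: "linear_ext f (Poly_Mapping.single g c) = c * f g"
  by (subst linear_ext_superset[of "{g}"]) (auto simp: lookup_single)

lemma linear_ext_add_fun: "linear_ext (\<lambda>u. f u + f' u) p = linear_ext f p + linear_ext f' p"
  by (simp add: linear_ext_def distrib_left sum.distrib)

lemma linear_ext_mult:
  "linear_ext f (p \<otimes>\<^bsub>group_algebra G\<^esub> q) =
    (\<Sum>w\<in>Poly_Mapping.keys q. Poly_Mapping.lookup q w * linear_ext (\<lambda>u. f (u \<otimes>\<^bsub>G\<^esub> w)) p)"
proof -
  have "linear_ext f (p \<otimes>\<^bsub>group_algebra G\<^esub> q) = (\<Sum>u\<in>Poly_Mapping.keys p. \<Sum>w\<in>Poly_Mapping.keys q.
      Poly_Mapping.lookup p u * Poly_Mapping.lookup q w * f (u \<otimes>\<^bsub>G\<^esub> w))"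
    by (simp add: group_algebra_def linear_ext_sum)
  also have "\<dots> = (\<Sum>w\<in>Poly_Mapping.keys q. \<Sum>u\<in>Poly_Mapping.keys p.
      Poly_Mapping.lookup p u * Poly_Mapping.lookup q w * f (u \<otimes>\<^bsub>G\<^esub> w))"
    by (rule sum.swap)
  finally show ?thesis by (simp add: linear_ext_def sum_distrib_left mult_ac)
qed

context restricted_series
begin

text \<open>In a product i j with j in the augmentation ideal, the coefficients of j sum to 0, so
  each translate \<open>f (u \<otimes> w)\<close> may be replaced by the derivative of
  \<open>f\<close> along w without changing the sum; its degree bound is smaller by one.\<close>

lemma linear_ext_Aug_pow:
  "pd (carrier G) f n \<Longrightarrow> p \<in> Aug_pow n \<Longrightarrow> linear_ext f p = 0"
proof (induction n arbitrary: f p rule: less_induct)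
  case (less n)
  show ?case
  proof (cases n)
    case 0
    with less.prems have "\<forall>y\<in>carrier G. f y = 0" "Poly_Mapping.keys p \<subseteq> carrier G" by auto
    then show ?thesis by (auto simp: linear_ext_def intro!: sum.neutral)
  next
    case (Suc n')
    have "p \<in> ideal_prod (group_algebra G) (Aug_pow n') (augmentation_ideal G)"
      using less.prems Suc by simp
    then show ?thesis
    proof (induction p rule: ideal_prod.induct)
      case (prod i j)
      have j: "Poly_Mapping.keys j \<subseteq> carrier G" "(\<Sum>w\<in>Poly_Mapping.keys j. Poly_Mapping.lookup j w) = 0"
        using prod(2) by (auto simp: augmentation_ideal_def)
      have "linear_ext f (i \<otimes>\<^bsub>group_algebra G\<^esub> j) =
          (\<Sum>w\<in>Poly_Mapping.keys j. Poly_Mapping.lookup j w * linear_ext (\<lambda>u. f (u \<otimes> w)) i)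
          + (\<Sum>w\<in>Poly_Mapping.keys j. Poly_Mapping.lookup j w) * linear_ext f i"
        unfolding linear_ext_mult j by simp
      also have "\<dots> = (\<Sum>w\<in>Poly_Mapping.keys j. Poly_Mapping.lookup j w * linear_ext (\<lambda>u. f (u \<otimes> w) + f u) i)"
        by (simp add: linear_ext_add_fun distrib_left sum.distrib sum_distrib_right)
      also have "\<dots> = 0"
      proof (rule sum.neutral, rule ballI)
        fix w assume w: "w \<in> Poly_Mapping.keys j"
        have "\<forall>i. \<forall>g\<in>carrier G \<inter> M (Suc i). pd (carrier G) (\<lambda>y. f (y \<otimes> g) + f y) (n' - i)"
          using less.prems(1) Suc by simp
        then have "pd (carrier G) (\<lambda>y. f (y \<otimes> w) + f y) (n' - 0)"
          using w j M_1 by (metis Int_iff One_nat_def subsetD)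
        then have "linear_ext (\<lambda>u. f (u \<otimes> w) + f u) i = 0"
          using less.IH[of n'] Suc prod(1) by simp
        then show "Poly_Mapping.lookup j w * linear_ext (\<lambda>u. f (u \<otimes> w) + f u) i = 0" by simp
      qed
      finally show ?case .
    qed (simp add: linear_ext_add)
  qed
qed

text \<open>If g leaves the series at \<open>M k\<close> with k < n, its separating function takes
  the value 1 on g - 1, although it annihilates the power of index \<open>Suc k\<close> of the
  augmentation ideal.\<close>

theorem dimension_subgroup_eq:
  assumes n: "1 \<le> n" shows "dimension_subgroup G n = M n"
proof
  show "M n \<subseteq> dimension_subgroup G n" using M_subset_dimension_subgroup[OF n] .
  show "dimension_subgroup G n \<subseteq> M n"
  proof (rule subsetI, rule ccontr)
    fix g assume g: "g \<in> dimension_subgroup G n" "g \<notin> M n"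
    then have "g \<in> M 1" using M_1 by (simp add: dimension_subgroup_iff)
    have "\<exists>k. 1 \<le> k \<and> k < n \<and> g \<in> M k \<and> g \<notin> M (Suc k)"
    proof (rule ccontr)
      assume *: "\<not> ?thesis"
      have "g \<in> M k" if "1 \<le> k" "k \<le> n" for k
        using that by (induction k rule: nat_induct_at_least) (use \<open>g \<in> M 1\<close> * in auto)
      with g n show False by blast
    qed
    then obtain k where k: "1 \<le> k" "k < n" "g \<in> M k" "g \<notin> M (Suc k)" by blast
    obtain f where f: "pd (carrier G) f (Suc k)" "f \<one> = 0" "f g = 1"
      using separating_function k by blast
    have "aug_elt g \<in> Aug_pow (Suc k)"
      using g k Aug_pow_antimono[of "Suc k" n] by (auto simp: dimension_subgroup_iff)
    from linear_ext_Aug_pow[OF f(1) this] f(2,3) show False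
      by (simp add: poly_mapping_bit_diff linear_ext_add)
  qed
qed

end

section \<open>Automorphisms of the binary tree and their sections\<close>

abbreviation finv :: "('a \<Rightarrow> 'b) \<Rightarrow> 'b \<Rightarrow> 'a" where "finv \<equiv> inv_into UNIV"

lemma tree_autI:
  "bij f \<Longrightarrow> f [] = [] \<Longrightarrow> (\<And>w x. \<exists>y. f (w @ [x]) = f w @ [y]) \<Longrightarrow> f \<in> tree_aut"
  by (simp add: tree_aut_def)

lemma tree_aut_bij: "g \<in> tree_aut \<Longrightarrow> bij g"
  by (simp add: tree_aut_def)

lemma tree_aut_step: "g \<in> tree_aut \<Longrightarrow> \<exists>y. g (w @ [x]) = g w @ [y]"
  by (simp add: tree_aut_def)

lemma tree_aut_Nil [simp]: "g \<in> tree_aut \<Longrightarrow> g [] = []"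
  by (simp add: tree_aut_def)

lemma tree_aut_length [simp]: "g \<in> tree_aut \<Longrightarrow> length (g w) = length w"
proof (induction w rule: rev_induct)
  case (snoc x w)
  then obtain y where "g (w @ [x]) = g w @ [y]" using tree_aut_step by blast
  with snoc show ?case by simp
qed simp

lemma tree_aut_append:
  assumes "g \<in> tree_aut" shows "take (length v) (g (v @ w)) = g v"
proof (induction w rule: rev_induct)
  case (snoc x w)
  obtain y where "g ((v @ w) @ [x]) = g (v @ w) @ [y]" using tree_aut_step[OF assms] by blast
  with snoc assms show ?case by simp
qed (use assms in simp)

text \<open>A tree automorphism acts on the first letter as a translation of the field with two
  elements; \<open>rt\<close> is its amount.\<close>

definition rt :: "(word \<Rightarrow> word) \<Rightarrow> bit" where "rt g = hd (g [0])"

definition sec1 :: "(word \<Rightarrow> word) \<Rightarrow> bit \<Rightarrow> word \<Rightarrow> word" where "sec1 g y w = tl (g (y # w))"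

primrec sec :: "(word \<Rightarrow> word) \<Rightarrow> word \<Rightarrow> word \<Rightarrow> word" where
  "sec g [] = g"
| "sec g (y # v) = sec (sec1 g y) v"

lemma tree_aut_singleton:
  assumes g: "g \<in> tree_aut" shows "g [y] = [y + rt g]"
proof -
  have 1: "g [0] = [rt g]"
    using tree_aut_length[OF g, of "[0]"] by (auto simp: rt_def length_Suc_conv)
  obtain z where z: "g [1] = [z]"
    using tree_aut_length[OF g, of "[1]"] by (auto simp: length_Suc_conv)
  have "g [0] \<noteq> g [1]" using tree_aut_bij[OF g] by (simp add: bij_def inj_def) (metis list.inject zero_neq_one)
  with 1 z have "z = 1 + rt g" by (cases z; cases "rt g") auto
  with 1 z show ?thesis by (cases y) auto
qed

lemma tree_aut_Cons:
  assumes g: "g \<in> tree_aut" shows "g (y # w) = (y + rt g) # sec1 g y w"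
proof -
  have "length (g (y # w)) = Suc (length w)" using g by simp
  then obtain z u where zu: "g (y # w) = z # u" by (auto simp: length_Suc_conv)
  have "take 1 (g (y # w)) = g [y]" using tree_aut_append[OF g, of "[y]" w] by simp
  with zu show ?thesis by (simp add: sec1_def tree_aut_singleton[OF g])
qed

lemma sec1_tree_aut [simp]:
  assumes g: "g \<in> tree_aut" shows "sec1 g y \<in> tree_aut"
proof (rule tree_autI)
  have inj: "inj g" and surj: "surj g" using tree_aut_bij[OF g] by (auto simp: bij_def)
  show "bij (sec1 g y)"
  proof (rule bijI)
    show "inj (sec1 g y)"
    proof (rule injI)
      fix v w assume "sec1 g y v = sec1 g y w"
      then have "g (y # v) = g (y # w)" by (simp add: tree_aut_Cons[OF g])
      then show "v = w" using inj by (auto dest: injD)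
    qed
    show "surj (sec1 g y)"
      unfolding surj_def
    proof
      fix w :: word
      obtain v where v: "g v = (y + rt g) # w" using surj by (metis surjD)
      then obtain z u where zu: "v = z # u" using tree_aut_length[OF g, of v] by (cases v) auto
      with v show "\<exists>u. w = sec1 g y u" by (auto simp: tree_aut_Cons[OF g])
    qed
  qed
  show "sec1 g y [] = []" by (simp add: sec1_def tree_aut_singleton[OF g])
  fix w x
  obtain z where "g ((y # w) @ [x]) = g (y # w) @ [z]" using tree_aut_step[OF g] by blast
  then show "\<exists>z. sec1 g y (w @ [x]) = sec1 g y w @ [z]" by (auto simp: tree_aut_Cons[OF g])
qed

lemma tree_aut_eqI:
  assumes "g \<in> tree_aut" "h \<in> tree_aut" "rt g = rt h" "sec1 g 0 = sec1 h 0" "sec1 g 1 = sec1 h 1"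
  shows "g = h"
proof
  fix w show "g w = h w"
  proof (cases w)
    case (Cons y v) with assms show ?thesis by (cases y) (auto simp: tree_aut_Cons)
  qed (use assms in auto)
qed

lemma tree_aut_ConsI:
  assumes "g [] = []" "\<And>y w. g (y # w) = (y + r) # (if y = 0 then g0 w else g1 w)"
    and g01: "g0 \<in> tree_aut" "g1 \<in> tree_aut"
  shows "g \<in> tree_aut" "rt g = r" "sec1 g 0 = g0" "sec1 g 1 = g1"
proof -
  note b = tree_aut_bij[OF g01(1)] tree_aut_bij[OF g01(2)]
  show "g \<in> tree_aut"
  proof (rule tree_autI)
    show "bij g"
    proof (rule bijI)
      show "inj g"
      proof (rule injI)
        fix v w assume "g v = g w"
        then show "v = w" using assms(1,2) b
          by (cases v; cases w) (auto simp: bij_def split: if_splits dest: injD)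
      qed
      show "surj g"
        unfolding surj_def
      proof
        fix w show "\<exists>v. w = g v"
        proof (cases w)
          case Nil then have "w = g []" using assms(1) by simp
          then show ?thesis by blast
        next
          case (Cons y v)
          obtain v0 v1 where "g0 v0 = v" "g1 v1 = v" using b by (metis bij_pointE)
          then have "w = g ((y + r) # (if y + r = 0 then v0 else v1))"
            using assms(2) Cons by simp
          then show ?thesis by blast
        qed
      qed
    qed
    fix w x show "\<exists>y. g (w @ [x]) = g w @ [y]"
    proof (cases w)
      case Nil then show ?thesis using assms by auto
    next
      case (Cons y v)
      obtain y0 y1 where "g0 (v @ [x]) = g0 v @ [y0]" "g1 (v @ [x]) = g1 v @ [y1]"
        using tree_aut_step[OF g01(1)] tree_aut_step[OF g01(2)] by blast
      then show ?thesis using Cons assms(2) by auto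
    qed
  qed (use assms in auto)
qed (use assms in \<open>auto simp: rt_def sec1_def fun_eq_iff\<close>)

lemma id_tree_aut [simp]: "id \<in> tree_aut" and rt_id [simp]: "rt id = 0" and sec1_id [simp]: "sec1 id y = id"
  by (auto intro: tree_autI simp: rt_def sec1_def fun_eq_iff)

lemma comp_tree_aut [simp]: "g \<in> tree_aut \<Longrightarrow> h \<in> tree_aut \<Longrightarrow> g \<circ> h \<in> tree_aut"
proof (rule tree_autI)
  assume gh: "g \<in> tree_aut" "h \<in> tree_aut"
  show "bij (g \<circ> h)" using gh tree_aut_bij bij_comp by blast
  show "(g \<circ> h) [] = []" using gh by simp
  fix w x show "\<exists>y. (g \<circ> h) (w @ [x]) = (g \<circ> h) w @ [y]"
    using tree_aut_step[OF gh(1)] tree_aut_step[OF gh(2)] by (metis comp_apply)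
qed

lemma rt_comp [simp]: "g \<in> tree_aut \<Longrightarrow> h \<in> tree_aut \<Longrightarrow> rt (g \<circ> h) = rt g + rt h"
  using tree_aut_Cons[of g "rt h" "[]"] by (simp add: rt_def[of "g \<circ> h"] tree_aut_singleton add.commute)

lemma sec1_comp: "g \<in> tree_aut \<Longrightarrow> h \<in> tree_aut \<Longrightarrow> sec1 (g \<circ> h) y = sec1 g (y + rt h) \<circ> sec1 h y"
  by (auto simp: fun_eq_iff sec1_def[of "g \<circ> h"] tree_aut_Cons)

lemma sec1_comp_stab [simp]: "g \<in> tree_aut \<Longrightarrow> h \<in> tree_aut \<Longrightarrow> rt h = 0 \<Longrightarrow> sec1 (g \<circ> h) y = sec1 g y \<circ> sec1 h y"
  by (simp add: sec1_comp)

lemma inv_tree_aut [simp]: assumes g: "g \<in> tree_aut" shows "finv g \<in> tree_aut"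
proof (rule tree_autI)
  note b = tree_aut_bij[OF g]
  show "bij (finv g)" using b by (rule bij_imp_bij_inv)
  show "finv g [] = []" using g b by (metis bij_inv_eq_iff tree_aut_Nil)
  fix w x
  have "length (finv g (w @ [x])) = Suc (length w)"
    using tree_aut_length[OF g, of "finv g (w @ [x])"] b by (simp add: bij_def surj_f_inv_f)
  then obtain v y where v: "finv g (w @ [x]) = v @ [y]" by (metis length_Suc_conv_rev)
  then have "w @ [x] = g (v @ [y])" using b by (metis bij_inv_eq_iff)
  then have "w = g v" using tree_aut_step[OF g, of v y] by auto
  then have "finv g w = v" using b by (metis bij_inv_eq_iff)
  with v show "\<exists>y. finv g (w @ [x]) = finv g w @ [y]" by blast
qed

lemma inv_comp_left: "g \<in> tree_aut \<Longrightarrow> finv g \<circ> g = id" and inv_comp_right: "g \<in> tree_aut \<Longrightarrow> g \<circ> finv g = id"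
  using tree_aut_bij by (auto simp: bij_def surj_iff inj_iff)

lemma rt_inv [simp]: "g \<in> tree_aut \<Longrightarrow> rt (finv g) = rt g"
  using rt_comp[of "finv g" g] inv_comp_left[of g] by (simp add: bit_add_eq_zero_iff del: rt_comp)

lemma sec1_inv: "g \<in> tree_aut \<Longrightarrow> sec1 (finv g) y = finv (sec1 g (y + rt g))"
proof -
  assume g: "g \<in> tree_aut"
  have "sec1 (finv g) y \<circ> sec1 g (y + rt g) = id"
    using sec1_comp[of "finv g" g "y + rt g"] g by (simp add: inv_comp_left add.assoc)
  then show ?thesis using g
    by (metis comp_assoc comp_id id_comp inv_comp_right sec1_tree_aut)
qed

lemma sec_tree_aut [simp]: "g \<in> tree_aut \<Longrightarrow> sec g v \<in> tree_aut"
  by (induction v arbitrary: g) auto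

lemma sec_append: "sec g (v @ w) = sec (sec g v) w"
  by (induction v arbitrary: g) auto

lemma tree_aut_sec: "g \<in> tree_aut \<Longrightarrow> g (v @ w) = g v @ sec g v w"
  by (induction v arbitrary: g) (auto simp: tree_aut_Cons)

lemma sec_id [simp]: "sec id v = id"
  by (induction v) (simp_all only: sec.simps sec1_id)

lemma sec_comp: "g \<in> tree_aut \<Longrightarrow> h \<in> tree_aut \<Longrightarrow> sec (g \<circ> h) v = sec g (h v) \<circ> sec h v"
  by (induction v arbitrary: g h) (auto simp: tree_aut_Cons sec1_comp)

lemma sec_inv: "g \<in> tree_aut \<Longrightarrow> sec (finv g) v = finv (sec g (finv g v))"
proof -
  assume g: "g \<in> tree_aut"
  have "sec g (finv g v) \<circ> sec (finv g) v = id"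
    using sec_comp[of g "finv g" v] g by (simp add: inv_comp_right)
  then show ?thesis using g
    by (metis comp_assoc comp_id id_comp inv_comp_left sec_tree_aut)
qed

lemma AutT_simps [simp]: "carrier AutT = tree_aut" "monoid.mult AutT = (\<circ>)" "one AutT = id"
  by (auto simp: AutT_def)

lemma group_AutT: "group AutT"
proof (rule groupI)
  show "\<exists>h\<in>carrier AutT. h \<otimes>\<^bsub>AutT\<^esub> g = \<one>\<^bsub>AutT\<^esub>" if "g \<in> carrier AutT" for g
    using that inv_comp_left by (intro bexI[of _ "finv g"]) auto
qed (auto simp: comp_assoc)

lemma inv_AutT: "g \<in> tree_aut \<Longrightarrow> inv\<^bsub>AutT\<^esub> g = finv g"
  by (rule group.inv_equality[OF group_AutT]) (auto simp: inv_comp_left)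

subsection \<open>The generators\<close>

definition pair :: "(word \<Rightarrow> word) \<Rightarrow> (word \<Rightarrow> word) \<Rightarrow> word \<Rightarrow> word" where
  "pair g h w = (case w of [] \<Rightarrow> [] | y # v \<Rightarrow> y # (if y = 0 then g v else h v))"

lemma pair_simps [simp]: "pair g h [] = []" "pair g h (y # v) = y # (if y = 0 then g v else h v)"
  by (auto simp: pair_def)

lemma pair_tree_aut:
  assumes "g \<in> tree_aut" "h \<in> tree_aut"
  shows "pair g h \<in> tree_aut" "rt (pair g h) = 0" "sec1 (pair g h) 0 = g" "sec1 (pair g h) 1 = h"
  by (rule tree_aut_ConsI[of "pair g h" 0 g h]; use assms in simp)+

lemmas pair_tree_aut_simps [simp] = pair_tree_aut(1)

lemma rt_pair [simp]: "rt (pair g h) = 0" and sec1_pair_0 [simp]: "sec1 (pair g h) 0 = g"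
  and sec1_pair_1 [simp]: "sec1 (pair g h) 1 = h"
  by (auto simp: rt_def sec1_def fun_eq_iff)

lemma pair_sec1: "g \<in> tree_aut \<Longrightarrow> rt g = 0 \<Longrightarrow> pair (sec1 g 0) (sec1 g 1) = g"
  by (rule tree_aut_eqI) auto

lemma pair_comp: "pair g h \<circ> pair g' h' = pair (g \<circ> g') (h \<circ> h')"
  by (auto simp: fun_eq_iff pair_def split: list.splits)

lemma pair_id [simp]: "pair id id = id"
  by (auto simp: fun_eq_iff pair_def split: list.splits)

lemma gen_eq_pair: "gen_b = pair gen_a gen_c" "gen_c = pair gen_a gen_d" "gen_d = pair id gen_b"
  by (auto simp: fun_eq_iff pair_def split: list.splits)

lemma gen_a_gen_a [simp]: "gen_a (gen_a w) = w"
  by (cases w) (auto simp: add.assoc)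

lemma gen_mult [simp]:
  "gen_b (gen_b w) = w" "gen_c (gen_c w) = w" "gen_d (gen_d w) = w"
  "gen_b (gen_c w) = gen_d w" "gen_c (gen_b w) = gen_d w" "gen_c (gen_d w) = gen_b w"
  "gen_d (gen_c w) = gen_b w" "gen_b (gen_d w) = gen_c w" "gen_d (gen_b w) = gen_c w"
  by (induction w) auto

lemma gen_a_tree_aut: "gen_a \<in> tree_aut" "rt gen_a = 1" "sec1 gen_a 0 = id" "sec1 gen_a 1 = id"
  by (rule tree_aut_ConsI[of gen_a 1 id id]; simp)+

lemma gen_bcd_aux:
  "(\<exists>y. gen_b (w @ [x]) = gen_b w @ [y]) \<and> (\<exists>y. gen_c (w @ [x]) = gen_c w @ [y]) \<and> (\<exists>y. gen_d (w @ [x]) = gen_d w @ [y])"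
proof (induction w)
  case (Cons z w)
  obtain y where "gen_a (w @ [x]) = gen_a w @ [y]" using tree_aut_step[OF gen_a_tree_aut(1)] by blast
  with Cons show ?case by auto
qed auto

lemma involution_bij: "(\<And>w. f (f w) = w) \<Longrightarrow> bij f"
  by (metis bijI' )

lemma gens_tree_aut [simp]: "gen_a \<in> tree_aut" "gen_b \<in> tree_aut" "gen_c \<in> tree_aut" "gen_d \<in> tree_aut"
  using gen_bcd_aux by (auto intro!: tree_autI involution_bij simp: gen_a_tree_aut)

lemma rt_gens [simp]: "rt gen_a = 1" "rt gen_b = 0" "rt gen_c = 0" "rt gen_d = 0"
  by (auto simp: gen_a_tree_aut rt_def)

lemma sec1_gens [simp]: "sec1 gen_a y = id" "sec1 gen_b 0 = gen_a" "sec1 gen_b 1 = gen_c"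
  "sec1 gen_c 0 = gen_a" "sec1 gen_c 1 = gen_d" "sec1 gen_d 0 = id" "sec1 gen_d 1 = gen_b"
  by (auto simp: fun_eq_iff sec1_def)

lemma gens_square [simp]: "gen_a \<circ> gen_a = id" "gen_b \<circ> gen_b = id" "gen_c \<circ> gen_c = id" "gen_d \<circ> gen_d = id"
  by (auto simp: fun_eq_iff)

lemma inv_gens [simp]: "finv gen_a = gen_a" "finv gen_b = gen_b" "finv gen_c = gen_c" "finv gen_d = gen_d"
  by (auto intro!: inv_unique_comp)

subsection \<open>The group\<close>

declare comp_apply [simp del] id_apply [simp del]

lemma GG_simps [simp]: "monoid.mult GG = (\<circ>)" "one GG = id"
  by (auto simp: GG_def)

abbreviation "GC \<equiv> carrier GG"

lemma GG_carrier: "GC = generate AutT {gen_a, gen_b, gen_c, gen_d}"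
  by (simp add: GG_def)

lemma subgroup_GC: "subgroup GC AutT"
  unfolding GG_carrier by (rule group.generate_is_subgroup[OF group_AutT]) auto

lemma group_GG: "group GG"
  using group.subgroup_imp_group[OF group_AutT subgroup_GC] by (simp add: GG_def)

interpretation GG: group GG by (rule group_GG)

lemma GC_tree_aut: "g \<in> GC \<Longrightarrow> g \<in> tree_aut"
  using subgroup.mem_carrier[OF subgroup_GC] by simp

lemma gens_GC [simp]: "gen_a \<in> GC" "gen_b \<in> GC" "gen_c \<in> GC" "gen_d \<in> GC"
  unfolding GG_carrier by (auto intro: generate.incl)

lemma id_GC [simp]: "id \<in> GC"
  using GG.one_closed by simp

lemma comp_GC [simp]: "g \<in> GC \<Longrightarrow> h \<in> GC \<Longrightarrow> g \<circ> h \<in> GC"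
  using GG.m_closed by simp

lemma inv_GG: "g \<in> GC \<Longrightarrow> inv\<^bsub>GG\<^esub> g = finv g"
  using group.m_inv_consistent[OF group_AutT subgroup_GC] inv_AutT GC_tree_aut by (simp add: GG_def)

lemma inv_GC [simp]: "g \<in> GC \<Longrightarrow> finv g \<in> GC"
  using GG.inv_closed[of g] inv_GG[of g] by simp

text \<open>The generators are involutions, so products without inverses suffice.\<close>

lemma GC_induct [consumes 1, case_names id comp]:
  assumes "g \<in> GC" and P: "P id"
    "\<And>x g. x \<in> {gen_a, gen_b, gen_c, gen_d} \<Longrightarrow> g \<in> GC \<Longrightarrow> P g \<Longrightarrow> P (x \<circ> g)"
  shows "P g"
proof -
  \<comment> \<open>An arbitrary right factor is built into the claim because
    \<open>generate\<close> nests products in any shape, whereas the rule peels generators off on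
    the left.\<close>
  have "\<forall>h\<in>GC. P h \<longrightarrow> P (g \<circ> h)"
    using assms(1) unfolding GG_carrier
  proof (induction g rule: generate.induct)
    case (inv x)
    then have "inv\<^bsub>AutT\<^esub> x = x" by (auto simp: inv_AutT)
    with inv P(2) show ?case unfolding GG_carrier[symmetric] by (simp del: o_apply)
  next
    case (eng g h)
    then have "h \<in> GC" by (simp add: GG_carrier)
    have "P (g \<circ> h \<circ> k)" if k: "k \<in> GC" "P k" for k
    proof -
      have IH: "\<forall>k\<in>GC. P k \<longrightarrow> P (g \<circ> k)" "\<forall>k\<in>GC. P k \<longrightarrow> P (h \<circ> k)"
        using eng(3,4) unfolding GG_carrier AutT_simps by blast+
      then have "P (h \<circ> k)" using k by blast
      moreover have "h \<circ> k \<in> GC" by (rule comp_GC[OF \<open>h \<in> GC\<close> k(1)])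
      ultimately have "P (g \<circ> (h \<circ> k))" using IH by blast
      then show ?thesis by (simp only: comp_assoc)
    qed
    then show ?case unfolding GG_carrier AutT_simps by simp
  next
    case one then show ?case by (simp only: AutT_simps id_comp) blast
  next
    case (incl h) then show ?case using P(2) unfolding GG_carrier[symmetric] by blast
  qed
  from bspec[OF this, of id] P(1) show ?thesis by simp
qed

lemma sec1_GC [simp]: "g \<in> GC \<Longrightarrow> sec1 g y \<in> GC"
proof (induction g arbitrary: y rule: GC_induct)
  case (comp x g)
  have "sec1 x z \<in> GC" for z using comp(1) by (cases z) auto
  moreover have "x \<in> tree_aut" "g \<in> tree_aut" using comp GC_tree_aut by auto
  ultimately show ?case using comp(3) by (simp add: sec1_comp)
qed simp

lemma sec_GC [simp]: "g \<in> GC \<Longrightarrow> sec g v \<in> GC"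
  by (induction v arbitrary: g) auto

subsection \<open>Parities of activity\<close>

text \<open>\<open>par j g\<close> is the number modulo 2 of vertices of level j at which
  \<open>g\<close> swaps the two subtrees.\<close>

primrec par :: "nat \<Rightarrow> (word \<Rightarrow> word) \<Rightarrow> bit" where
  "par 0 g = rt g"
| "par (Suc j) g = par j (sec1 g 0) + par j (sec1 g 1)"

lemma par_id [simp]: "par j id = 0"
  by (induction j) auto

lemma par_comp [simp]: "g \<in> tree_aut \<Longrightarrow> h \<in> tree_aut \<Longrightarrow> par j (g \<circ> h) = par j g + par j h"
proof (induction j arbitrary: g h)
  case (Suc j) then show ?case by (cases "rt h") (auto simp: sec1_comp add_ac)
qed simp

lemma par_inv [simp]: "g \<in> tree_aut \<Longrightarrow> par j (finv g) = par j g"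
  using par_comp[of "finv g" g j] inv_comp_left[of g] by (simp add: bit_add_eq_zero_iff del: par_comp)

lemma par_gens [simp]:
  "par 0 gen_a = 1" "par (Suc j) gen_a = 0"
  "par 0 gen_b = 0" "par (Suc j) gen_b = par j gen_a + par j gen_c"
  "par 0 gen_c = 0" "par (Suc j) gen_c = par j gen_a + par j gen_d"
  "par 0 gen_d = 0" "par (Suc j) gen_d = par j gen_b"
  by auto

text \<open>On the generators \<open>b = (a, c)\<close>, \<open>c = (a, d)\<close>, \<open>d = (1, b)\<close> and both of their sections this reads
  \<open>1 = 1\<close>, \<open>1 = 1\<close>, \<open>0 = 0\<close>.\<close>

lemma par_sec1:
  "g \<in> GC \<Longrightarrow> par 0 (sec1 g y) + par 1 (sec1 g y) + par 2 (sec1 g y) = par 1 g"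
proof (induction g arbitrary: y rule: GC_induct)
  case (comp x g)
  have x: "par 0 (sec1 x z) + par 1 (sec1 x z) + par 2 (sec1 x z) = par 1 x" for z
    using comp(1) by (cases z) (auto simp: numeral_2_eq_2 One_nat_def)
  have t: "x \<in> tree_aut" "g \<in> tree_aut" using comp GC_tree_aut by auto
  then show ?case using comp(3)[of y] x[of "y + rt g"] by (simp only: sec1_comp par_comp sec1_tree_aut) (simp add: add_ac)
qed simp

lemma par_numeral:
  "par 1 g = par 0 (sec1 g 0) + par 0 (sec1 g 1)"
  "par 2 g = par 1 (sec1 g 0) + par 1 (sec1 g 1)"
  "par 3 g = par 2 (sec1 g 0) + par 2 (sec1 g 1)"
  by (simp_all add: numeral_3_eq_3 numeral_2_eq_2)

text \<open>Equating \<open>par_sec1\<close> for the two sections eliminates \<open>par 1 g\<close>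
  as their common value: the parities of the first three levels determine that of the
  fourth.\<close>

lemma par_3: "g \<in> GC \<Longrightarrow> par 3 g = par 1 g + par 2 g"
proof -
  assume g: "g \<in> GC"
  have eq: "par 0 (sec1 g 0) + par 1 (sec1 g 0) + par 2 (sec1 g 0) = par 0 (sec1 g 1) + par 1 (sec1 g 1) + par 2 (sec1 g 1)"
    unfolding par_sec1[OF g] ..
  have "a + b + c = a' + b' + c' \<Longrightarrow> c + c' = (a + a') + (b + b')" for a b c a' b' c' :: bit
    by (cases a; cases b; cases c; cases a'; cases b'; cases c'; simp)
  from this[OF eq] show ?thesis by (simp only: par_numeral[of g])
qed

subsection \<open>Adjoining an element to a normal subgroup\<close>

context group
begin

definition adj :: "'a set \<Rightarrow> 'a \<Rightarrow> 'a set" where "adj N w = N \<union> {k \<otimes> w | k. k \<in> N}"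

lemma subset_adj: "N \<subseteq> adj N w" by (auto simp: adj_def)

lemma adj_self: "\<one> \<in> N \<Longrightarrow> w \<in> carrier G \<Longrightarrow> w \<in> adj N w"
  unfolding adj_def using l_one by force

lemma adj_cases:
  assumes "g \<in> adj N w" obtains "g \<in> N" | k where "k \<in> N" "g = k \<otimes> w" using assms by (auto simp: adj_def)

text \<open>\<open>w\<close> is central modulo \<open>N\<close> with square in \<open>N\<close>, so
  \<open>N\<close> and its coset of \<open>w\<close> are together closed under multiplication and
  conjugation.\<close>

lemma normal_adj:
  assumes N: "N \<lhd> G" and w: "w \<in> carrier G" "w \<otimes> w \<in> N" and c: "\<And>g. g \<in> carrier G \<Longrightarrow> cmt g w \<in> N"
  shows "adj N w \<lhd> G"
proof -
  have N_carrier: "k \<in> carrier G" if "k \<in> N" for k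
    using that N by (meson normal_imp_subgroup subgroup.mem_carrier)
  note S = normal_imp_subgroup[OF N]
  note Sm = subgroup.m_closed[OF S] and Si = subgroup.m_inv_closed[OF S]
  have right: "h \<otimes> w \<in> adj N w" if "h \<in> adj N w" for h
    using that
  proof (cases rule: adj_cases)
    case (2 k)
    then have "h \<otimes> w = k \<otimes> (w \<otimes> w)" using w N_carrier by (simp add: m_assoc)
    then show ?thesis using Sm[OF 2(1) w(2)] subset_adj by auto
  qed (auto simp: adj_def)
  have left: "k \<otimes> h \<in> adj N w" if "k \<in> N" "h \<in> adj N w" for k h
    using that(2)
  proof (cases rule: adj_cases)
    case (2 h0)
    then have "k \<otimes> h = (k \<otimes> h0) \<otimes> w" using w N_carrier that by (simp add: m_assoc)
    then show ?thesis using Sm[OF that(1) 2(1)] by (auto simp: adj_def)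
  qed (use that Sm in \<open>auto simp: adj_def\<close>)
  have carrier: "adj N w \<subseteq> carrier G" using N_carrier w by (auto simp: adj_def)
  have mult_N: "h \<otimes> k \<in> adj N w" if "k \<in> N" "h \<in> adj N w" for k h
  proof -
    have h: "h \<in> carrier G" using that carrier by auto
    have "h \<otimes> k = (h \<otimes> k \<otimes> inv h) \<otimes> h" using h N_carrier that by (simp add: m_assoc)
    then show ?thesis using left[OF normal_conj_closed[OF N h that(1)] that(2)] by simp
  qed
  have sub: "subgroup (adj N w) G"
  proof (rule subgroupI)
    show "adj N w \<noteq> {}" using subgroup.one_closed[OF S] subset_adj by blast
    show "h \<otimes> k \<in> adj N w" if hk: "h \<in> adj N w" "k \<in> adj N w" for h k
      using hk(2)
    proof (cases rule: adj_cases)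
      case (2 k0)
      have "h \<in> carrier G" using hk carrier by auto
      then have "h \<otimes> k = (h \<otimes> k0) \<otimes> w" using 2 N_carrier w by (simp add: m_assoc)
      then show ?thesis using right[OF mult_N[OF 2(1) hk(1)]] by simp
    qed (use hk mult_N in auto)
    show "inv h \<in> adj N w" if h: "h \<in> adj N w" for h
      using h
    proof (cases rule: adj_cases)
      case (2 k)
      have "inv h = (inv (w \<otimes> w) \<otimes> w) \<otimes> inv k" using 2 w N_carrier by (simp add: m_assoc inv_mult_group)
      moreover have "inv (w \<otimes> w) \<otimes> w \<in> adj N w" using Si[OF w(2)] by (auto simp: adj_def)
      ultimately show ?thesis using mult_N[OF Si[OF 2(1)]] by simp
    qed (use subset_adj Si in auto)
  qed (use carrier in auto)
  show ?thesis
  proof (rule normal_invI[OF sub])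
    fix g h assume g: "g \<in> carrier G" and h: "h \<in> adj N w"
    from h show "g \<otimes> h \<otimes> inv g \<in> adj N w"
    proof (cases rule: adj_cases)
      case 1 then show ?thesis using normal_conj_closed[OF N g] subset_adj by blast
    next
      case (2 k)
      have "g \<otimes> h \<otimes> inv g = (g \<otimes> k \<otimes> inv g) \<otimes> (cmt g w) \<otimes> w"
        using 2 g w N_carrier by (simp add: m_assoc inv_mult_group)
      moreover have "(g \<otimes> k \<otimes> inv g) \<otimes> cmt g w \<in> N"
        using normal_conj_closed[OF N g 2(1)] c[OF g] by (rule Sm)
      ultimately show ?thesis by (auto simp: adj_def)
    qed
  qed
qed

lemma normal_closure_incl: "S \<subseteq> normal_closure G S"
  by (auto simp: normal_closure_def)

lemma normal_closure_minimal: "H \<lhd> G \<Longrightarrow> S \<subseteq> H \<Longrightarrow> normal_closure G S \<subseteq> H"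
  by (auto simp: normal_closure_def)

lemma normal_carrier: "carrier G \<lhd> G"
  by (rule normal_invI) (auto simp: subgroup_self)

lemma normal_normal_closure: assumes "S \<subseteq> carrier G" shows "normal_closure G S \<lhd> G"
proof -
  let ?F = "{H. H \<lhd> G \<and> S \<subseteq> H}"
  have ne: "carrier G \<in> ?F" using normal_carrier assms by simp
  show ?thesis unfolding normal_closure_def
  proof (rule normal_invI)
    show "subgroup (\<Inter>?F) G"
      using ne by (intro subgroups_Inter) (auto dest: normal_imp_subgroup)
    fix g h assume "g \<in> carrier G" "h \<in> \<Inter>?F"
    then show "g \<otimes> h \<otimes> inv g \<in> \<Inter>?F" using normal_conj_closed by auto
  qed
qed

end

lemma word_function_eqI:
  fixes f g :: "word \<Rightarrow> word"
  assumes "f [] = g []" "\<And>v. f (0 # v) = g (0 # v)" "\<And>v. f (1 # v) = g (1 # v)"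
  shows "f = g"
proof
  fix w show "f w = g w"
  proof (cases w)
    case (Cons y v) then show ?thesis using assms by (cases y) auto
  qed (use assms in simp)
qed

lemma xx_eq: "xx = gen_a \<circ> gen_b \<circ> gen_a \<circ> gen_b"
  by (simp add: xx_def inv_GG)

lemma xx_GC [simp]: "xx \<in> GC"
  unfolding xx_eq by simp

lemma xx_pair: "xx = pair (gen_c \<circ> gen_a) (gen_a \<circ> gen_c)"
  unfolding xx_eq by (rule word_function_eqI) (simp_all add: comp_apply)

definition xinv :: "word \<Rightarrow> word" where "xinv = gen_b \<circ> gen_a \<circ> gen_b \<circ> gen_a"

definition zz :: "word \<Rightarrow> word" where "zz = gen_a \<circ> gen_d \<circ> gen_a \<circ> gen_d"

lemma xinv_GC [simp]: "xinv \<in> GC" and zz_GC [simp]: "zz \<in> GC"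
  by (auto simp: xinv_def zz_def)

lemma zz_pair: "zz = pair gen_b gen_b"
  unfolding zz_def by (rule word_function_eqI) (simp_all add: comp_apply)

lemma ad_ad: "gen_a (gen_d (gen_a (gen_d w))) = pair gen_b gen_b w"
    "gen_d (gen_a (gen_d (gen_a w))) = pair gen_b gen_b w"
proof (induction w)
  case (Cons y w)
  { case 1 show ?case by (cases y) simp_all }
  { case 2 show ?case by (cases y) simp_all }
qed simp_all

lemma xx_xinv [simp]: "xx \<circ> xinv = id" "xinv \<circ> xx = id"
  by (auto simp: fun_eq_iff comp_apply xx_eq xinv_def id_apply)

lemma inv_xx: "finv xx = xinv"
  by (rule inv_unique_comp) auto

lemma inv_pair: "g \<in> tree_aut \<Longrightarrow> h \<in> tree_aut \<Longrightarrow> finv (pair g h) = pair (finv g) (finv h)"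
  by (rule inv_unique_comp) (auto simp: pair_comp inv_comp_left inv_comp_right)

lemma inv_comp: "g \<in> tree_aut \<Longrightarrow> h \<in> tree_aut \<Longrightarrow> finv (g \<circ> h) = finv h \<circ> finv g"
  by (simp add: o_inv_distrib tree_aut_bij)

lemma conj_GG: "g \<in> GC \<Longrightarrow> h \<in> GC \<Longrightarrow> g \<otimes>\<^bsub>GG\<^esub> h \<otimes>\<^bsub>GG\<^esub> inv\<^bsub>GG\<^esub> g = g \<circ> h \<circ> finv g"
  by (simp add: inv_GG)

lemma normal_GG_conj: "N \<lhd> GG \<Longrightarrow> g \<in> GC \<Longrightarrow> k \<in> N \<Longrightarrow> g \<circ> k \<circ> finv g \<in> N"
  using GG.normal_conj_closed[of N g k] conj_GG[of g k] normal_imp_subgroup[of N GG] subgroup.mem_carrier by metis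

lemma normal_GGI:
  assumes "N \<subseteq> GC" "id \<in> N" "\<And>g h. g \<in> N \<Longrightarrow> h \<in> N \<Longrightarrow> g \<circ> h \<in> N" "\<And>g. g \<in> N \<Longrightarrow> finv g \<in> N"
    "\<And>g k. g \<in> GC \<Longrightarrow> k \<in> N \<Longrightarrow> g \<circ> k \<circ> finv g \<in> N"
  shows "N \<lhd> GG"
proof (rule GG.normal_invI)
  show "subgroup N GG"
    by (rule GG.subgroupI) (use assms in \<open>auto simp: inv_GG subset_iff\<close>)
qed (use assms in \<open>auto simp: inv_GG subset_iff\<close>)

lemma normal_GG_comp: "N \<lhd> GG \<Longrightarrow> g \<in> N \<Longrightarrow> h \<in> N \<Longrightarrow> g \<circ> h \<in> N"
  using subgroup.m_closed[OF normal_imp_subgroup] by force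

lemma normal_GG_mem: "N \<lhd> GG \<Longrightarrow> g \<in> N \<Longrightarrow> g \<in> GC"
  using subgroup.mem_carrier[OF normal_imp_subgroup] by force

lemma normal_GG_inv: "N \<lhd> GG \<Longrightarrow> g \<in> N \<Longrightarrow> finv g \<in> N"
  using subgroup.m_inv_closed[OF normal_imp_subgroup] inv_GG normal_GG_mem by metis

lemma normal_GG_id: "N \<lhd> GG \<Longrightarrow> id \<in> N"
  using subgroup.one_closed[OF normal_imp_subgroup] by force

text \<open>c = b d, and the generators are involutions; by
  \<open>subgroup_centralizer_modulo\<close> three short computations then settle each step of the
  chain below.\<close>

lemma cmt_gens_imp:
  assumes N: "N \<lhd> GG" and w: "w \<in> GC"
    and gens: "gen_a \<circ> w \<circ> gen_a \<circ> finv w \<in> N" "gen_b \<circ> w \<circ> gen_b \<circ> finv w \<in> N"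
      "gen_d \<circ> w \<circ> gen_d \<circ> finv w \<in> N" and g: "g \<in> GC"
  shows "GG.cmt g w \<in> N"
proof -
  let ?C = "{g \<in> GC. \<forall>h\<in>{w}. GG.cmt g h \<in> N}"
  have C: "subgroup ?C GG" by (rule GG.subgroup_centralizer_modulo[OF N]) (use w in auto)
  have abd: "gen_a \<in> ?C" "gen_b \<in> ?C" "gen_d \<in> ?C" using gens w by (simp_all add: inv_GG)
  have "gen_b \<circ> gen_d = gen_c" by (auto simp: fun_eq_iff comp_apply)
  then have c: "gen_c \<in> ?C" using subgroup.m_closed[OF C abd(2,3)] by simp
  from g have "g \<in> ?C"
  proof (induction g rule: GC_induct)
    case id then show ?case using subgroup.one_closed[OF C] by simp
  next
    case (comp x g) then show ?case using subgroup.m_closed[OF C, of x g] abd c by auto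
  qed
  then show ?thesis by simp
qed

subsection \<open>The subgroup K\<close>

lemma KK_normal: "KK \<lhd> GG"
  unfolding KK_def by (rule GG.normal_normal_closure) simp

lemma xx_KK: "xx \<in> KK"
  unfolding KK_def using GG.normal_closure_incl by blast

lemma TT_normal: "TT \<lhd> GG"
  unfolding TT_def by (rule GG.normal_normal_closure) simp

lemma xx2_TT: "xx \<circ> xx \<in> TT"
  unfolding TT_def using GG.normal_closure_incl by force

text \<open>The elements b, ada, aba, aca fix the first letter and equal (a,c), (b,1), (c,a), (d,a):
  the first sections of the stabilizer exhaust the group.\<close>

lemma pair_section_GC:
  assumes "g \<in> GC" shows "\<exists>h\<in>GC. pair g h \<in> GC"
  using assms
proof (induction g rule: GC_induct)
  case id then show ?case by (intro bexI[of _ id]) auto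
next
  case (comp x g)
  then obtain h where h: "h \<in> GC" "pair g h \<in> GC" by blast
  have "pair gen_a gen_c \<in> GC" "pair gen_b id \<in> GC" "pair gen_c gen_a \<in> GC" "pair gen_d gen_a \<in> GC"
  proof -
    have "pair gen_b id = gen_a \<circ> gen_d \<circ> gen_a" "pair gen_c gen_a = gen_a \<circ> gen_b \<circ> gen_a"
      "pair gen_d gen_a = gen_a \<circ> gen_c \<circ> gen_a"
      by (rule word_function_eqI; simp add: comp_apply id_apply)+
    then show "pair gen_a gen_c \<in> GC" "pair gen_b id \<in> GC" "pair gen_c gen_a \<in> GC" "pair gen_d gen_a \<in> GC"
      by (simp_all flip: gen_eq_pair)
  qed
  then have "\<exists>y\<in>GC. pair x y \<in> GC" using comp(1) by auto
  then obtain y where "y \<in> GC" "pair x y \<in> GC" by blast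
  then have "pair (x \<circ> g) (y \<circ> h) \<in> GC" using h comp_GC[of "pair x y" "pair g h"] by (simp add: pair_comp)
  then show ?case using h \<open>y \<in> GC\<close> by (intro bexI[of _ "y \<circ> h"]) auto
qed

lemma pair_swap: "gen_a \<circ> pair g h \<circ> gen_a = pair h g"
  by (rule word_function_eqI) (simp_all add: comp_apply)

lemma pair_id_conj:
  assumes "g \<in> GC" "h \<in> GC" "k \<in> tree_aut"
  shows "pair g h \<circ> pair k id \<circ> finv (pair g h) = pair (g \<circ> k \<circ> finv g) id"
  using assms by (simp add: inv_pair GC_tree_aut pair_comp inv_comp_right)

text \<open>Conjugation by (g, h) acts on (k, 1) as conjugation of k by g, and every g occurs by
  \<open>pair_section_GC\<close>; so the k with (k, 1) in \<open>N\<close> form a normal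
  subgroup.\<close>

lemma pair_id_normal:
  assumes N: "N \<lhd> GG" and w: "w \<in> GC" "pair w id \<in> N" shows "k \<in> normal_closure GG {w} \<Longrightarrow> pair k id \<in> N"
proof -
  let ?S = "{k \<in> GC. pair k id \<in> N}"
  have "?S \<lhd> GG"
  proof (rule normal_GGI)
    show "id \<in> ?S" using normal_GG_id[OF N] by simp
  next
    fix g h assume "g \<in> ?S" "h \<in> ?S"
    then show "g \<circ> h \<in> ?S" using normal_GG_comp[OF N, of "pair g id" "pair h id"] by (simp add: pair_comp)
  next
    fix g assume "g \<in> ?S"
    then show "finv g \<in> ?S" using normal_GG_inv[OF N, of "pair g id"]
      by (simp add: inv_pair GC_tree_aut inv_unique_comp[of id id])
  next
    fix g k assume g: "g \<in> GC" and k: "k \<in> ?S"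
    obtain h where h: "h \<in> GC" "pair g h \<in> GC" using pair_section_GC[OF g] by blast
    have "pair g h \<circ> pair k id \<circ> finv (pair g h) \<in> N" using normal_GG_conj[OF N h(2)] k by simp
    then show "g \<circ> k \<circ> finv g \<in> ?S" using g h k by (simp add: pair_id_conj GC_tree_aut)
  qed auto
  then have "normal_closure GG {w} \<subseteq> ?S" using GG.normal_closure_minimal w by blast
  then show "k \<in> normal_closure GG {w} \<Longrightarrow> pair k id \<in> N" by auto
qed

text \<open>As a x a = x^-1 and a d a = (b, 1), conjugating x = (ca, ac) by (b, 1) and multiplying
  by x^-1 leaves (acbcab, 1), which is (abab, 1) since b and c commute.\<close>

lemma pair_xx_KK: "pair xx id \<in> KK"
proof -
  have "gen_a \<circ> xx \<circ> finv gen_a \<in> KK"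
    "(gen_a \<circ> gen_d \<circ> gen_a) \<circ> xx \<circ> finv (gen_a \<circ> gen_d \<circ> gen_a) \<in> KK"
    by (rule normal_GG_conj[OF KK_normal _ xx_KK]; simp)+
  then have "(gen_a \<circ> xx \<circ> gen_a) \<circ> ((gen_a \<circ> gen_d \<circ> gen_a) \<circ> xx \<circ> (gen_a \<circ> gen_d \<circ> gen_a)) \<in> KK"
    by (intro normal_GG_comp[OF KK_normal, of "gen_a \<circ> xx \<circ> gen_a"]) (simp_all add: inv_comp comp_assoc)
  also have "(gen_a \<circ> xx \<circ> gen_a) \<circ> ((gen_a \<circ> gen_d \<circ> gen_a) \<circ> xx \<circ> (gen_a \<circ> gen_d \<circ> gen_a)) = pair xx id"
    by (rule word_function_eqI) (simp_all add: comp_apply xx_eq id_apply)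
  finally show ?thesis .
qed

lemma pair_KK: assumes "g \<in> KK" "h \<in> KK" shows "pair g h \<in> KK"
proof -
  have 1: "pair k id \<in> KK" if "k \<in> KK" for k
    using pair_id_normal[OF KK_normal xx_GC pair_xx_KK] that by (simp add: KK_def)
  have "gen_a \<circ> pair h id \<circ> finv gen_a \<in> KK" using normal_GG_conj[OF KK_normal gens_GC(1) 1[OF assms(2)]] by simp
  then have "pair id h \<in> KK" by (simp add: pair_swap)
  then have "pair g id \<circ> pair id h \<in> KK" using 1[OF assms(1)] normal_GG_comp[OF KK_normal] by blast
  then show ?thesis by (simp add: pair_comp)
qed

definition K1 :: "(word \<Rightarrow> word) set" where "K1 = {pair g h | g h. g \<in> KK \<and> h \<in> KK}"

lemma conj_pair:
  assumes "g \<in> GC" "k0 \<in> tree_aut" "k1 \<in> tree_aut"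
  shows "g \<circ> pair k0 k1 \<circ> finv g =
    (if rt g = 0 then pair (sec1 g 0 \<circ> k0 \<circ> finv (sec1 g 0)) (sec1 g 1 \<circ> k1 \<circ> finv (sec1 g 1))
     else pair (sec1 g 1 \<circ> k1 \<circ> finv (sec1 g 1)) (sec1 g 0 \<circ> k0 \<circ> finv (sec1 g 0)))"
proof -
  note [simp] = GC_tree_aut[OF assms(1)] assms(2,3)
  show ?thesis
  proof (cases "rt g = 0")
    case True
    then show ?thesis unfolding if_P[OF True] by (intro tree_aut_eqI[of "g \<circ> pair k0 k1 \<circ> finv g"]) (simp_all add: sec1_comp sec1_inv)
  next
    case False
    then have "rt g = 1" by simp
    then show ?thesis unfolding if_not_P[OF False] by (intro tree_aut_eqI[of "g \<circ> pair k0 k1 \<circ> finv g"]) (simp_all add: sec1_comp sec1_inv)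
  qed
qed

lemma normal_pairs:
  assumes N: "N \<lhd> GG" and sub: "\<And>g h. g \<in> N \<Longrightarrow> h \<in> N \<Longrightarrow> pair g h \<in> GC"
  shows "{pair g h | g h. g \<in> N \<and> h \<in> N} \<lhd> GG"
proof (rule normal_GGI)
  show "id \<in> {pair g h | g h. g \<in> N \<and> h \<in> N}" using normal_GG_id[OF N] pair_id by (metis (mono_tags, lifting) mem_Collect_eq)
next
  fix g h assume "g \<in> {pair g h | g h. g \<in> N \<and> h \<in> N}" "h \<in> {pair g h | g h. g \<in> N \<and> h \<in> N}"
  then show "g \<circ> h \<in> {pair g h | g h. g \<in> N \<and> h \<in> N}" using normal_GG_comp[OF N] by (auto simp: pair_comp) blast
next
  fix g assume "g \<in> {pair g h | g h. g \<in> N \<and> h \<in> N}"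
  then show "finv g \<in> {pair g h | g h. g \<in> N \<and> h \<in> N}"
    using normal_GG_inv[OF N] normal_GG_mem[OF N] GC_tree_aut inv_pair by (smt (verit) mem_Collect_eq)
next
  fix g k assume g: "g \<in> GC" and "k \<in> {pair g h | g h. g \<in> N \<and> h \<in> N}"
  then obtain k0 k1 where k: "k = pair k0 k1" "k0 \<in> N" "k1 \<in> N" by auto
  then have t: "k0 \<in> tree_aut" "k1 \<in> tree_aut" using normal_GG_mem[OF N] GC_tree_aut by auto
  have "sec1 g y \<circ> k0 \<circ> finv (sec1 g y) \<in> N" "sec1 g y \<circ> k1 \<circ> finv (sec1 g y) \<in> N" for y
    using k g by (auto intro!: normal_GG_conj[OF N])
  then show "g \<circ> k \<circ> finv g \<in> {pair g h | g h. g \<in> N \<and> h \<in> N}"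
    unfolding k conj_pair[OF g t] by (cases "rt g = 0") auto
qed (use sub in auto)

lemma K1_normal: "K1 \<lhd> GG"
  unfolding K1_def using pair_KK normal_GG_mem[OF KK_normal] by (intro normal_pairs[OF KK_normal]) blast

lemma K1_KK: "K1 \<subseteq> KK" using pair_KK by (auto simp: K1_def)

subsection \<open>A chain of normal subgroups from \<open>K \<times> K\<close> to the group\<close>

lemma inv_KK_xinv: "xinv \<in> KK" using normal_GG_inv[OF KK_normal xx_KK] by (simp add: inv_xx)

text \<open>This is \<open>(ac)\<^sup>4\<close>.\<close>

definition ac4 :: "word \<Rightarrow> word" where "ac4 = pair (pair gen_b gen_b) (pair gen_b gen_b)"

text \<open>As x = (ca, ac), the fourth power of x has (ac)^4 in both coordinates; this is what puts
  it into K x K.\<close>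

lemma ac4_KK: "ac4 \<in> KK"
proof -
  \<comment> \<open>From (ca)^2 = (ad, da), the first coordinate needed to correct x^2 is (ca)^-2
    (b, b) = (dab, ac), which equals (dxd, 1) x and is thereby seen to lie in K. The second
    coordinate is its conjugate by a.\<close>
  define k where "k = pair (gen_d \<circ> xx \<circ> gen_d) id \<circ> xx"
  have "gen_d \<circ> xx \<circ> finv gen_d \<in> KK" by (rule normal_GG_conj[OF KK_normal _ xx_KK]) simp
  then have "k \<in> KK" unfolding k_def
    using pair_KK normal_GG_id[OF KK_normal] xx_KK by (intro normal_GG_comp[OF KK_normal]) auto
  moreover from this have "gen_a \<circ> k \<circ> finv gen_a \<in> KK" by (intro normal_GG_conj[OF KK_normal]) auto
  ultimately have "xx \<circ> xx \<circ> pair k (gen_a \<circ> k \<circ> gen_a) \<in> KK"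
    using pair_KK xx_KK by (intro normal_GG_comp[OF KK_normal]) auto
  also have "xx \<circ> xx \<circ> pair k (gen_a \<circ> k \<circ> gen_a) = ac4"
    unfolding ac4_def k_def xx_eq
    by (rule word_function_eqI; (simp add: comp_apply id_apply)?;
        rule fun_cong[of _ _ "_ :: word"], rule word_function_eqI; simp add: comp_apply id_apply)
  finally show ?thesis .
qed

abbreviation xx2 :: "word \<Rightarrow> word" where "xx2 \<equiv> xx \<circ> xx"

text \<open>Each term adds one element whose square and commutators lie in the previous term. The
  chain passes through N_1 (\<open>LL_eq\<close>) and the second term of the series
  (\<open>E2_eq\<close>) up to the whole group, so that conditions on parities can be matched with
  explicit generators.\<close>

definition E0 where "E0 = GG.adj K1 xx2"
definition E1 where "E1 = GG.adj E0 xx"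
definition E2 where "E2 = GG.adj E1 zz"
definition E3 where "E3 = GG.adj E2 gen_a"
definition E4 where "E4 = GG.adj E3 gen_b"
definition E5 where "E5 = GG.adj E4 gen_d"

lemma xinv_pointwise [simp]: "xx (xinv w) = w" "xinv (xx w) = w"
  using xx_xinv by (metis comp_apply id_apply)+

lemma finv_xx2: "finv xx2 = xinv \<circ> xinv"
  by (simp add: inv_comp GC_tree_aut inv_xx)

lemma cmt_d_xx: "gen_d \<circ> xx \<circ> gen_d \<circ> xinv = pair id xinv"
  unfolding xinv_def xx_eq by (rule word_function_eqI) (simp_all add: comp_apply id_apply)

lemma pair_id_xinv_K1: "pair id xinv \<in> K1"
  using inv_KK_xinv normal_GG_id[OF KK_normal] by (auto simp: K1_def)

lemma xx4_K1: "xx2 \<circ> xx2 \<in> K1"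
proof -
  have "xx2 \<circ> xx2 = pair ac4 ac4"
    unfolding ac4_def xx_eq
    by (rule word_function_eqI; (simp add: comp_apply id_apply)?;
        rule fun_cong[of _ _ "_ :: word"], rule word_function_eqI; simp add: comp_apply id_apply ad_ad)
  then show ?thesis using ac4_KK by (auto simp: K1_def)
qed

text \<open>Both a and b invert x, so their commutators with x^2 are x^-4; d contributes (1, x^-1)
  and a conjugate of it.\<close>

lemma E0_normal: "E0 \<lhd> GG"
  unfolding E0_def
proof (rule GG.normal_adj[OF K1_normal])
  fix g assume "g \<in> GC"
  have 1: "xinv \<circ> xinv \<circ> xinv \<circ> xinv \<in> K1"
    using normal_GG_inv[OF K1_normal xx4_K1] by (simp add: inv_comp GC_tree_aut inv_xx comp_assoc)
  have "gen_a \<circ> xx2 \<circ> gen_a \<circ> finv xx2 = xinv \<circ> xinv \<circ> xinv \<circ> xinv"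
    "gen_b \<circ> xx2 \<circ> gen_b \<circ> finv xx2 = xinv \<circ> xinv \<circ> xinv \<circ> xinv"
    unfolding finv_xx2 unfolding xinv_def xx_eq by (simp_all add: fun_eq_iff comp_apply)
  moreover have "gen_d \<circ> xx2 \<circ> gen_d \<circ> finv xx2 = pair id xinv \<circ> (xx \<circ> pair id xinv \<circ> finv xx)"
    unfolding finv_xx2 inv_xx unfolding cmt_d_xx[symmetric] by (simp add: fun_eq_iff comp_apply)
  moreover have "pair id xinv \<circ> (xx \<circ> pair id xinv \<circ> finv xx) \<in> K1"
    using normal_GG_conj[OF K1_normal xx_GC pair_id_xinv_K1] normal_GG_comp[OF K1_normal pair_id_xinv_K1] by blast
  ultimately show "GG.cmt g xx2 \<in> K1"
    using 1 by (intro cmt_gens_imp[OF K1_normal _ _ _ _ \<open>g \<in> GC\<close>]) simp_all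
qed (use xx4_K1 in auto)

lemma K1_E0: "K1 \<subseteq> E0" and E0_E1: "E0 \<subseteq> E1" and E1_E2: "E1 \<subseteq> E2" and E2_E3: "E2 \<subseteq> E3"
  and E3_E4: "E3 \<subseteq> E4" and E4_E5: "E4 \<subseteq> E5"
  unfolding E0_def E1_def E2_def E3_def E4_def E5_def by (rule GG.subset_adj)+

lemma xx2_E0: "xx2 \<in> E0"
  unfolding E0_def using normal_GG_id[OF K1_normal] by (intro GG.adj_self) auto

lemma E1_normal: "E1 \<lhd> GG"
  unfolding E1_def
proof (rule GG.normal_adj[OF E0_normal])
  fix g assume "g \<in> GC"
  have "xinv \<circ> xinv \<in> E0" using normal_GG_inv[OF E0_normal xx2_E0] by (simp add: finv_xx2)
  moreover have "gen_a \<circ> xx \<circ> gen_a \<circ> finv xx = xinv \<circ> xinv" "gen_b \<circ> xx \<circ> gen_b \<circ> finv xx = xinv \<circ> xinv"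
    unfolding inv_xx unfolding xinv_def xx_eq by (simp_all add: fun_eq_iff comp_apply)
  moreover have "gen_d \<circ> xx \<circ> gen_d \<circ> finv xx \<in> E0"
    using cmt_d_xx pair_id_xinv_K1 K1_E0 by (auto simp: inv_xx)
  ultimately show "GG.cmt g xx \<in> E0"
    by (intro cmt_gens_imp[OF E0_normal _ _ _ _ \<open>g \<in> GC\<close>]) simp_all
qed (use xx2_E0 in auto)

lemma xx_E1: "xx \<in> E1"
  unfolding E1_def using normal_GG_id[OF E0_normal] by (intro GG.adj_self) auto

lemma zz_square [simp]: "zz \<circ> zz = id"
  by (simp add: zz_pair pair_comp)

lemma finv_zz [simp]: "finv zz = zz"
  by (rule inv_unique_comp) auto

lemma E2_normal: "E2 \<lhd> GG"
  unfolding E2_def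
proof (rule GG.normal_adj[OF E1_normal])
  fix g assume "g \<in> GC"
  have id: "id \<in> E1" by (rule normal_GG_id[OF E1_normal])
  have "gen_a \<circ> zz \<circ> gen_a \<circ> zz = id" "gen_d \<circ> zz \<circ> gen_d \<circ> zz = id" "gen_b \<circ> zz \<circ> gen_b \<circ> zz = pair xx id"
    unfolding zz_pair xx_eq by (rule word_function_eqI; simp add: comp_apply id_apply)+
  moreover have "pair xx id \<in> E1"
    using xx_KK normal_GG_id[OF KK_normal] K1_E0 E0_E1 by (auto simp: K1_def)
  ultimately show "GG.cmt g zz \<in> E1"
    using id by (intro cmt_gens_imp[OF E1_normal _ _ _ _ \<open>g \<in> GC\<close>]) simp_all
qed (use normal_GG_id[OF E1_normal] in auto)

lemma zz_E2: "zz \<in> E2"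
  unfolding E2_def using normal_GG_id[OF E1_normal] by (intro GG.adj_self) auto

lemma E3_normal: "E3 \<lhd> GG"
  unfolding E3_def
proof (rule GG.normal_adj[OF E2_normal])
  fix g assume "g \<in> GC"
  have id: "id \<in> E2" by (rule normal_GG_id[OF E2_normal])
  have "gen_b \<circ> gen_a \<circ> gen_b \<circ> gen_a = finv xx" unfolding inv_xx xinv_def ..
  moreover have "finv xx \<in> E2" using normal_GG_inv[OF E2_normal] xx_E1 E1_E2 by blast
  moreover have "gen_d \<circ> gen_a \<circ> gen_d \<circ> gen_a = zz"
    unfolding zz_pair by (rule word_function_eqI; simp add: comp_apply id_apply)
  ultimately show "GG.cmt g gen_a \<in> E2"
    using id zz_E2 by (intro cmt_gens_imp[OF E2_normal _ _ _ _ \<open>g \<in> GC\<close>]) simp_all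
qed (use normal_GG_id[OF E2_normal] in auto)

lemma gen_bd_commute: "gen_b \<circ> gen_d = gen_c" "gen_d \<circ> gen_b = gen_c" "gen_c \<circ> gen_b = gen_d" "gen_c \<circ> gen_d = gen_b"
  by (auto simp: fun_eq_iff comp_apply)

lemma E4_normal: "E4 \<lhd> GG"
  unfolding E4_def
proof (rule GG.normal_adj[OF E3_normal])
  fix g assume "g \<in> GC"
  have id: "id \<in> E3" by (rule normal_GG_id[OF E3_normal])
  have "xx \<in> E3" using xx_E1 E1_E2 E2_E3 by blast
  then show "GG.cmt g gen_b \<in> E3"
    using id by (intro cmt_gens_imp[OF E3_normal _ _ _ _ \<open>g \<in> GC\<close>]) (simp_all add: gen_bd_commute flip: xx_eq)
qed (use normal_GG_id[OF E3_normal] in auto)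

lemma E5_normal: "E5 \<lhd> GG"
  unfolding E5_def
proof (rule GG.normal_adj[OF E4_normal])
  fix g assume "g \<in> GC"
  have id: "id \<in> E4" by (rule normal_GG_id[OF E4_normal])
  have "zz \<in> E4" using zz_E2 E2_E3 E3_E4 by blast
  then show "GG.cmt g gen_d \<in> E4"
    using id by (intro cmt_gens_imp[OF E4_normal _ _ _ _ \<open>g \<in> GC\<close>]) (simp_all add: gen_bd_commute flip: zz_def)
qed (use normal_GG_id[OF E4_normal] in auto)

lemma E5_eq: "GC \<subseteq> E5"
proof
  have a: "gen_a \<in> E5" using GG.adj_self[of E2 gen_a] normal_GG_id[OF E2_normal] E3_E4 E4_E5 by (auto simp: E3_def[symmetric])
  have b: "gen_b \<in> E5" using GG.adj_self[of E3 gen_b] normal_GG_id[OF E3_normal] E4_E5 by (auto simp: E4_def[symmetric])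
  have d: "gen_d \<in> E5" using GG.adj_self[of E4 gen_d] normal_GG_id[OF E4_normal] by (auto simp: E5_def[symmetric])
  have c: "gen_c \<in> E5" using normal_GG_comp[OF E5_normal b d] by (simp add: gen_bd_commute)
  fix g assume "g \<in> GC"
  then show "g \<in> E5"
  proof (induction g rule: GC_induct)
    case (comp x g) then show ?case using normal_GG_comp[OF E5_normal, of x g] a b c d by auto
  qed (rule normal_GG_id[OF E5_normal])
qed

subsection \<open>The second and third terms of the series\<close>

declare par.simps [simp del]

definition M2 :: "(word \<Rightarrow> word) set" where "M2 = {g \<in> GC. par 0 g = 0 \<and> par 1 g = 0 \<and> par 2 g = 0}"

text \<open>On \<open>M2\<close> both sections on the first level have the same parities
  (\<open>M2_sec1\<close>), so the choice of the section at 0 does not matter.\<close>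

definition kap :: "(word \<Rightarrow> word) \<Rightarrow> bit" where "kap g = par 1 (sec1 g 0)"

definition mu :: "(word \<Rightarrow> word) \<Rightarrow> bit" where "mu g = par 2 (sec1 g 0)"

definition LL :: "(word \<Rightarrow> word) set" where "LL = {g \<in> M2. kap g = 0 \<and> mu g = 0}"

lemma M2_GC: "g \<in> M2 \<Longrightarrow> g \<in> GC" and M2_tree_aut: "g \<in> M2 \<Longrightarrow> g \<in> tree_aut" and M2_rt: "g \<in> M2 \<Longrightarrow> rt g = 0"
  by (auto simp: M2_def GC_tree_aut par.simps)

text \<open>The sums over the two sections are \<open>par 2 g\<close> and \<open>par 3 g\<close>,
  both zero on \<open>M2\<close>; the remaining parity follows from \<open>par_sec1\<close>.\<close>

lemma M2_sec1:
  assumes g: "g \<in> M2"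
  shows "par 1 (sec1 g y) = kap g" "par 2 (sec1 g y) = mu g" "par 0 (sec1 g y) = kap g + mu g"
proof -
  have g': "g \<in> GC" "par 1 g = 0" "par 2 g = 0" using g by (auto simp: M2_def)
  have "par 1 (sec1 g 0) + par 1 (sec1 g 1) = 0" using g' par_numeral(2)[of g] by simp
  then show 1: "par 1 (sec1 g y) = kap g" by (cases y) (auto simp: kap_def)
  have "par 2 (sec1 g 0) + par 2 (sec1 g 1) = 0" using g' par_numeral(3)[of g] par_3[of g] by simp
  then show 2: "par 2 (sec1 g y) = mu g" by (cases y) (auto simp: mu_def)
  have "par 0 (sec1 g y) + (kap g + mu g) = 0"
    using par_sec1[OF g'(1), of y] g'(2) 1 2 by (simp only: add.assoc)
  then show "par 0 (sec1 g y) = kap g + mu g" by (simp only: bit_add_eq_zero_iff)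
qed

lemma kap_comp: "g \<in> M2 \<Longrightarrow> h \<in> M2 \<Longrightarrow> kap (g \<circ> h) = kap g + kap h"
  and mu_comp: "g \<in> M2 \<Longrightarrow> h \<in> M2 \<Longrightarrow> mu (g \<circ> h) = mu g + mu h"
  using M2_tree_aut M2_rt by (simp_all only: kap_def mu_def sec1_comp_stab sec1_tree_aut par_comp)

lemma M2_normal: "M2 \<lhd> GG"
  by (rule normal_GGI) (auto simp: M2_def GC_tree_aut)

lemma kap_id [simp]: "kap id = 0" and mu_id [simp]: "mu id = 0"
  by (simp_all only: kap_def mu_def sec1_id par_id)

lemma kap_inv: "g \<in> M2 \<Longrightarrow> kap (finv g) = kap g" and mu_inv: "g \<in> M2 \<Longrightarrow> mu (finv g) = mu g"
  using M2_tree_aut M2_rt by (simp_all only: kap_def mu_def sec1_inv sec1_tree_aut par_inv add_0_left)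

text \<open>Conjugation conjugates the two sections and possibly exchanges them; parities do not see
  the former, and on \<open>M2\<close> not the latter.\<close>

lemma kap_conj: "g \<in> GC \<Longrightarrow> h \<in> M2 \<Longrightarrow> kap (g \<circ> h \<circ> finv g) = kap h"
  and mu_conj: "g \<in> GC \<Longrightarrow> h \<in> M2 \<Longrightarrow> mu (g \<circ> h \<circ> finv g) = mu h"
proof -
  assume g: "g \<in> GC" and h: "h \<in> M2"
  have h_eq: "h = pair (sec1 h 0) (sec1 h 1)" using pair_sec1 M2_tree_aut[OF h] M2_rt[OF h] by metis
  have t: "g \<in> tree_aut" "h \<in> tree_aut" using g h GC_tree_aut M2_tree_aut by auto
  have "par j (sec1 (g \<circ> h \<circ> finv g) 0) = par j (sec1 h (rt g))" for j
    unfolding conj_pair[OF g sec1_tree_aut[OF t(2)] sec1_tree_aut[OF t(2)], of 0 1, folded h_eq]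
    using t by (cases "rt g = 0") simp_all
  then show "kap (g \<circ> h \<circ> finv g) = kap h" "mu (g \<circ> h \<circ> finv g) = mu h"
    using M2_sec1(1,2)[OF h] by (simp_all only: kap_def mu_def)
qed

lemma M2_conj: "g \<in> GC \<Longrightarrow> h \<in> M2 \<Longrightarrow> g \<circ> h \<circ> finv g \<in> M2"
  using normal_GG_conj[OF M2_normal] .

lemma LL_normal: "LL \<lhd> GG"
  by (rule normal_GGI)
    (auto simp: LL_def kap_comp mu_comp kap_inv mu_inv kap_conj mu_conj M2_GC M2_conj
      normal_GG_id[OF M2_normal] normal_GG_comp[OF M2_normal] normal_GG_inv[OF M2_normal])

lemma LL_M2: "LL \<subseteq> M2" by (auto simp: LL_def)

lemma xx_M2: "xx \<in> M2" and zz_M2: "zz \<in> M2"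
  unfolding M2_def by (simp_all add: xx_eq zz_def add_ac)

lemma kap_xx [simp]: "kap xx = 1" and mu_xx [simp]: "mu xx = 0" and kap_zz [simp]: "kap zz = 1" and mu_zz [simp]: "mu zz = 1"
  by (simp_all add: kap_def mu_def xx_pair zz_pair numeral_2_eq_2)

lemma xx2_LL: "xx2 \<in> LL"
  using xx_M2 normal_GG_comp[OF M2_normal] by (simp add: LL_def kap_comp mu_comp)

lemma KK_M2: "KK \<subseteq> {g \<in> M2. mu g = 0}"
  unfolding KK_def
proof (rule GG.normal_closure_minimal)
  show "{g \<in> M2. mu g = 0} \<lhd> GG"
    by (rule normal_GGI)
      (auto simp: mu_comp mu_inv mu_conj M2_GC M2_conj
        normal_GG_id[OF M2_normal] normal_GG_comp[OF M2_normal] normal_GG_inv[OF M2_normal])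
qed (use xx_M2 in auto)

lemma K1_LL: "K1 \<subseteq> LL"
proof
  fix g assume g: "g \<in> K1"
  then obtain k0 k1 where k: "g = pair k0 k1" "k0 \<in> KK" "k1 \<in> KK" by (auto simp: K1_def)
  have "g \<in> M2" using g K1_KK KK_M2 by auto
  moreover have "k0 \<in> M2" using k KK_M2 by auto
  ultimately show "g \<in> LL" using k(1) unfolding LL_def kap_def mu_def M2_def by simp
qed

lemma E0_LL: "E0 \<subseteq> LL"
  unfolding E0_def GG.adj_def using K1_LL xx2_LL normal_GG_comp[OF LL_normal] by auto

lemma E2_M2: "E2 \<subseteq> M2"
  unfolding E2_def E1_def GG.adj_def using E0_LL LL_M2 xx_M2 zz_M2 normal_GG_comp[OF M2_normal] by auto

text \<open>The parities of a, b, d form a triangular matrix: each vanishing parity removes one of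
  the three upper factors of the chain.\<close>

lemma M2_E2: "M2 \<subseteq> E2"
proof
  fix g assume g: "g \<in> M2"
  have t: "k \<in> tree_aut" "k \<in> GC" if "k \<in> E4" for k
    using that normal_GG_mem[OF E4_normal] GC_tree_aut by auto
  have p: "par 0 k = 0" "par 1 k = 0" "par 2 k = 0" if "k \<in> E2" for k using that E2_M2 by (auto simp: M2_def)
  have gens: "par 1 gen_a = 0" "par 2 gen_a = 0" "par 1 gen_b = 1" "par 2 gen_b = 1" "par 1 gen_d = 0" "par 2 gen_d = 1"
    by (simp_all add: numeral_2_eq_2)
  have 0: "par 0 g = 0" "par 1 g = 0" "par 2 g = 0" using g by (auto simp: M2_def)
  have "g \<in> E5" using E5_eq g M2_GC by auto
  then obtain g' i where g': "g' \<in> E4" "g = g' \<or> g = g' \<circ> gen_d" by (auto simp: E5_def GG.adj_def)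
  then obtain g'' where g'': "g'' \<in> E3" "g' = g'' \<or> g' = g'' \<circ> gen_b" by (auto simp: E4_def GG.adj_def)
  then obtain k where k: "k \<in> E2" "g'' = k \<or> g'' = k \<circ> gen_a" by (auto simp: E3_def GG.adj_def)
  have kt: "k \<in> tree_aut" using k E2_M2 M2_tree_aut by auto
  have "g'' = k" using 0(1) g'(2) g''(2) k(2) kt p[OF k(1)] by auto
  moreover have "g' = g''" using 0(2) g'(2) g''(2) k(2) kt p[OF k(1)] gens calculation by (auto)
  moreover have "g = g'" using 0(3) g'(2) kt p[OF k(1)] gens calculation by (auto)
  ultimately show "g \<in> E2" using k by simp
qed

lemma E2_eq: "E2 = M2" using E2_M2 M2_E2 by blast

text \<open>x and z = [a, d] have the values (1, 0) and (1, 1) under \<open>kap\<close> and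
  \<open>mu\<close>, so neither survives in the common kernel. What remains gives generators of N_1:
  K x K and x^2.\<close>

lemma LL_eq: "LL = E0"
proof
  show "LL \<subseteq> E0"
  proof
    fix g assume g: "g \<in> LL"
    then have "g \<in> E2" using M2_E2 LL_M2 by blast
    then obtain g' where g': "g' \<in> E1" "g = g' \<or> g = g' \<circ> zz" by (auto simp: E2_def GG.adj_def)
    then obtain k where k: "k \<in> E0" "g' = k \<or> g' = k \<circ> xx" by (auto simp: E1_def GG.adj_def)
    have kM: "k \<in> M2" "kap k = 0" "mu k = 0" "k \<circ> xx \<in> M2"
      using k E0_LL normal_GG_comp[OF M2_normal _ xx_M2] by (auto simp: LL_def)
    have 0: "kap g = 0" "mu g = 0" using g by (auto simp: LL_def)
    have "g = g'" using 0(2) g'(2) k(2) kM by (auto simp: mu_comp zz_M2 xx_M2)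
    then have "g = k" using 0(1) k(2) kM by (auto simp: kap_comp xx_M2)
    then show "g \<in> E0" using k by simp
  qed
qed (rule E0_LL)

lemma LL_cases:
  assumes "g \<in> LL" obtains k where "k \<in> K1" "g = k \<or> g = k \<circ> xx2"
  using assms unfolding LL_eq E0_def GG.adj_def by auto

lemma M2_cases:
  assumes "g \<in> M2" obtains k where "k \<in> LL" "g = k \<or> g = k \<circ> xx \<or> g = k \<circ> zz \<or> g = k \<circ> xx \<circ> zz"
  using assms unfolding E2_eq[symmetric] LL_eq E1_def E2_def GG.adj_def by auto

lemma LL_KK: "LL \<subseteq> KK"
  using K1_KK xx_KK normal_GG_comp[OF KK_normal] by (auto elim!: LL_cases)

lemma pair_LL: "g \<in> LL \<Longrightarrow> h \<in> LL \<Longrightarrow> pair g h \<in> LL"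
  using K1_LL LL_KK by (auto simp: K1_def)

lemma LL_sec1_M2: "g \<in> LL \<Longrightarrow> sec1 g y \<in> M2"
  using M2_sec1[of g y] M2_GC[of g] by (auto simp: LL_def M2_def)

lemma sec1_xx2: "mu (sec1 xx2 y) = 1" "kap (sec1 xx2 y) = 0"
  by (cases y; simp add: xx_pair pair_comp mu_def kap_def numeral_2_eq_2 sec1_comp)+

text \<open>Elements of K have \<open>mu\<close> zero, and x^2 has \<open>mu\<close> one at both
  sections. This is why the second summand is indexed by words one letter shorter.\<close>

lemma LL_mu_sec1:
  assumes "g \<in> LL" shows "mu (sec1 g 1) = mu (sec1 g 0)"
proof -
  obtain k where k: "k \<in> K1" "g = k \<or> g = k \<circ> xx2" using LL_cases[OF assms] .
  obtain k0 k1 where k01: "k = pair k0 k1" "k0 \<in> KK" "k1 \<in> KK" using k by (auto simp: K1_def)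
  then have m: "k0 \<in> M2" "k1 \<in> M2" "mu k0 = 0" "mu k1 = 0" using KK_M2 by auto
  have s: "sec1 xx2 y \<in> M2" for y using LL_sec1_M2[OF xx2_LL] .
  have "sec1 (k \<circ> xx2) 0 = k0 \<circ> sec1 xx2 0" "sec1 (k \<circ> xx2) 1 = k1 \<circ> sec1 xx2 1"
    using k01 m M2_tree_aut xx2_LL LL_M2 M2_rt by (auto simp: sec1_comp)
  with k(2) m k01 s show ?thesis by (auto simp: mu_comp sec1_xx2)
qed

lemma bit_mult_self [simp]: "(x::bit) * x = x" by (cases x) auto

text \<open>If \<open>q\<close> swaps the two subtrees, the section of q^2 at 0 is the product of
  both sections of \<open>q\<close>, whose parities add up to the parity of \<open>q\<close> one
  level further down the tree; otherwise it is a square and has parity 0.\<close>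

lemma kap_square: "q \<in> tree_aut \<Longrightarrow> kap (q \<circ> q) = par 0 q * par 2 q"
  and mu_square: "q \<in> tree_aut \<Longrightarrow> mu (q \<circ> q) = par 0 q * par 3 q"
  unfolding kap_def mu_def par_numeral(2,3)[of q] par.simps(1)
  by (cases "rt q = 0"; simp add: sec1_comp add_ac)+

lemma M2_square_LL: "h \<in> M2 \<Longrightarrow> h \<circ> h \<in> LL"
  using normal_GG_comp[OF M2_normal] by (simp add: LL_def kap_comp mu_comp)

text \<open>A section of \<open>h\<close> has the parities \<open>kap h + mu h\<close>,
  \<open>mu h\<close>, \<open>kap h + mu h\<close> on levels 0, 2, 3 by \<open>M2_sec1\<close> and
  \<open>par_3\<close>; \<open>kap_square\<close> and \<open>mu_square\<close> multiply
  them.\<close>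

lemma M2_square_sec1:
  assumes h: "h \<in> M2"
  shows "kap (sec1 (h \<circ> h) y) = mu h * (1 + kap h)" "mu (sec1 (h \<circ> h) y) = kap h + mu h"
proof -
  have q: "sec1 h y \<in> GC" "sec1 (h \<circ> h) y = sec1 h y \<circ> sec1 h y"
    using h M2_GC M2_tree_aut M2_rt by (simp_all add: sec1_comp)
  note M2_sec1[OF h, of y]
  then show "kap (sec1 (h \<circ> h) y) = mu h * (1 + kap h)"
    using kap_square[OF GC_tree_aut[OF q(1)]] q(2)
    by (cases "kap h"; cases "mu h") simp_all
  show "mu (sec1 (h \<circ> h) y) = kap h + mu h"
    using mu_square[OF GC_tree_aut[OF q(1)]] q(2) par_3[OF q(1)] M2_sec1[OF h, of y]
    by simp
qed

subsection \<open>Weighted degree of functions on words\<close>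

text \<open>A function on the words of length \<open>m\<close> over \<open>\<F>\<^sub>2\<close> is a polynomial in the letters that has degree
  at most one in each of them. Give the letter at position \<open>i\<close> (counted from 0) the weight \<open>2 ^ i\<close>; then
  every natural number below \<open>2 ^ m\<close> is the weight of exactly one monomial. The function \<open>coef m j\<close> reads
  off the coefficient of the monomial of weight \<open>j\<close>, and \<open>deg_lt m e\<close> says that only monomials of
  weight less than \<open>e\<close> occur. The submodule \<open>V\<^sub>m\<^sup>r\<close> corresponds to \<open>deg_lt m (2 ^ m - r)\<close>.\<close>

primrec deg_lt :: "nat \<Rightarrow> nat \<Rightarrow> (word \<Rightarrow> bit) \<Rightarrow> bool" where
  "deg_lt 0 e f \<longleftrightarrow> 0 < e \<or> f [] = 0"
| "deg_lt (Suc m) e f \<longleftrightarrow> deg_lt m ((e + 1) div 2) (\<lambda>s. f (0 # s)) \<and> deg_lt m (e div 2) (\<lambda>s. f (0 # s) + f (1 # s))"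

primrec coef :: "nat \<Rightarrow> nat \<Rightarrow> (word \<Rightarrow> bit) \<Rightarrow> bit" where
  "coef 0 j f = f []"
| "coef (Suc m) j f = coef m (j div 2) (if even j then (\<lambda>s. f (0 # s)) else (\<lambda>s. f (0 # s) + f (1 # s)))"

lemma deg_lt_cong: "(\<And>s. length s = m \<Longrightarrow> f s = f' s) \<Longrightarrow> deg_lt m e f \<longleftrightarrow> deg_lt m e f'"
proof (induction m arbitrary: e f f')
  case (Suc m)
  have "deg_lt m e (\<lambda>s. f (0 # s)) \<longleftrightarrow> deg_lt m e (\<lambda>s. f' (0 # s))"
    "deg_lt m e (\<lambda>s. f (0 # s) + f (1 # s)) \<longleftrightarrow> deg_lt m e (\<lambda>s. f' (0 # s) + f' (1 # s))" for e
    using Suc.prems by (intro Suc.IH; simp)+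
  then show ?case by simp
qed simp

lemma coef_cong: "(\<And>s. length s = m \<Longrightarrow> f s = f' s) \<Longrightarrow> coef m j f = coef m j f'"
proof (induction m arbitrary: j f f')
  case (Suc m)
  have "coef m j (\<lambda>s. f (0 # s)) = coef m j (\<lambda>s. f' (0 # s))"
    "coef m j (\<lambda>s. f (0 # s) + f (1 # s)) = coef m j (\<lambda>s. f' (0 # s) + f' (1 # s))" for j
    using Suc.prems by (intro Suc.IH; simp)+
  then show ?case by simp
qed simp

lemma deg_lt_mono: "deg_lt m e f \<Longrightarrow> e \<le> e' \<Longrightarrow> deg_lt m e' f"
proof (induction m arbitrary: e e' f)
  case (Suc m)
  have "(e + 1) div 2 \<le> (e' + 1) div 2" "e div 2 \<le> e' div 2" using Suc.prems by (auto intro: div_le_mono)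
  then show ?case using Suc.IH Suc.prems by (meson deg_lt.simps(2))
qed auto

lemma deg_lt_zero_iff: "deg_lt m 0 f \<longleftrightarrow> (\<forall>s. length s = m \<longrightarrow> f s = 0)"
proof (induction m arbitrary: f)
  case (Suc m)
  have "deg_lt (Suc m) 0 f \<longleftrightarrow> (\<forall>s. length s = m \<longrightarrow> f (0 # s) = 0) \<and> (\<forall>s. length s = m \<longrightarrow> f (1 # s) = 0)"
    by (auto simp: Suc.IH)
  also have "\<dots> \<longleftrightarrow> (\<forall>s. length s = Suc m \<longrightarrow> f s = 0)"
    by (auto simp: length_Suc_conv) (metis bit_not_one_iff)
  finally show ?case .
qed auto

lemma deg_lt_zero_fun [simp]: "deg_lt m e (\<lambda>_. 0)"
  by (rule deg_lt_mono[of m 0]) (auto simp: deg_lt_zero_iff)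

lemma deg_lt_top: "2 ^ m \<le> e \<Longrightarrow> deg_lt m e f"
proof (induction m arbitrary: e f)
  case (Suc m)
  then have "2 ^ m \<le> e div 2" "2 ^ m \<le> (e + 1) div 2" by auto
  then show ?case using Suc.IH by simp
qed simp

lemma deg_lt_add: "deg_lt m e f \<Longrightarrow> deg_lt m e f' \<Longrightarrow> deg_lt m e (\<lambda>s. f s + f' s)"
proof (induction m arbitrary: e f f')
  case (Suc m)
  then have "deg_lt m ((e + 1) div 2) (\<lambda>s. f (0 # s) + f' (0 # s))"
    "deg_lt m (e div 2) (\<lambda>s. (f (0 # s) + f (1 # s)) + (f' (0 # s) + f' (1 # s)))" by auto
  then show ?case by (simp add: add_ac)
qed auto

lemma coef_add: "coef m j (\<lambda>s. f s + f' s) = coef m j f + coef m j f'"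
proof (induction m arbitrary: j f f')
  case (Suc m)
  have "coef m j (\<lambda>s. f (0 # s) + f' (0 # s)) = coef m j (\<lambda>s. f (0 # s)) + coef m j (\<lambda>s. f' (0 # s))"
    "coef m j (\<lambda>s. (f (0 # s) + f (1 # s)) + (f' (0 # s) + f' (1 # s))) =
      coef m j (\<lambda>s. f (0 # s) + f (1 # s)) + coef m j (\<lambda>s. f' (0 # s) + f' (1 # s))" for j
    by (rule Suc.IH)+
  then show ?case by (simp add: add_ac)
qed simp

lemma coef_zero [simp]: "coef m j (\<lambda>_. 0) = 0"
  by (induction m arbitrary: j) auto

lemma deg_lt_Suc: "e < 2 ^ m \<Longrightarrow> deg_lt m e f \<longleftrightarrow> deg_lt m (Suc e) f \<and> coef m e f = 0"
proof (induction m arbitrary: e f)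
  case (Suc m)
  have lt: "e div 2 < 2 ^ m" using Suc.prems by auto
  show ?case
  proof (cases "even e")
    case True
    then obtain q where "e = 2 * q" by auto
    then show ?thesis using Suc.IH[of q] lt by auto
  next
    case False
    then obtain q where "e = 2 * q + 1" using oddE by blast
    then show ?thesis using Suc.IH[of q] lt by auto
  qed
qed simp

lemma deg_lt_coef: "deg_lt m e f \<Longrightarrow> e < 2 ^ m \<Longrightarrow> coef m e f = 0"
  using deg_lt_Suc by blast

lemma deg_lt_const: "deg_lt m (Suc 0) (\<lambda>_. c)"
  by (induction m) auto

text \<open>Write f = p + y s in the first letter y. Since y^2 = y, the y-coefficient of a product
  is p s' + s p' + s s', and this reduction only lowers weights. The bounds are strict, whence the
  subtraction of 1.\<close>

lemma deg_lt_mult: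
  "deg_lt m e f \<Longrightarrow> deg_lt m e' f' \<Longrightarrow> deg_lt m (e + e' - 1) (\<lambda>s. f s * f' s)"
proof (induction m arbitrary: e e' f f')
  case (Suc m)
  let ?f0 = "\<lambda>s. f (0 # s)" and ?f0' = "\<lambda>s. f' (0 # s)"
  let ?s = "\<lambda>s. f (0 # s) + f (1 # s)" and ?s' = "\<lambda>s. f' (0 # s) + f' (1 # s)"
  have d: "deg_lt m ((e + 1) div 2) ?f0" "deg_lt m ((e' + 1) div 2) ?f0'"
    "deg_lt m (e div 2) ?s" "deg_lt m (e' div 2) ?s'" using Suc.prems by auto
  have 1: "deg_lt m ((e + e' - 1 + 1) div 2) (\<lambda>s. ?f0 s * ?f0' s)"
    by (rule deg_lt_mono[OF Suc.IH[OF d(1,2)]]) linarith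
  have zero: "deg_lt m k (\<lambda>s. g s * h s)" if "deg_lt m 0 g \<or> deg_lt m 0 h" for k g h
    by (rule deg_lt_mono[of _ 0]) (use that in \<open>auto simp: deg_lt_zero_iff\<close>)
  have 2: "deg_lt m ((e + e' - 1) div 2) (\<lambda>s. ?f0 s * ?s' s)"
  proof (cases "e' div 2 = 0")
    case False
    show ?thesis by (rule deg_lt_mono[OF Suc.IH[OF d(1,4)]]) (use False in linarith)
  qed (use d zero in auto)
  have 3: "deg_lt m ((e + e' - 1) div 2) (\<lambda>s. ?s s * ?f0' s)"
  proof (cases "e div 2 = 0")
    case False
    show ?thesis by (rule deg_lt_mono[OF Suc.IH[OF d(3,2)]]) (use False in linarith)
  qed (use d zero in auto)
  have 4: "deg_lt m ((e + e' - 1) div 2) (\<lambda>s. ?s s * ?s' s)"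
    by (rule deg_lt_mono[OF Suc.IH[OF d(3,4)]]) linarith
  have "f (0 # s) * f' (0 # s) + f (1 # s) * f' (1 # s) = ?f0 s * ?s' s + (?s s * ?f0' s + ?s s * ?s' s)" for s
    by (cases "f (0 # s)"; cases "f (1 # s)"; cases "f' (0 # s)"; cases "f' (1 # s)") simp_all
  then have "deg_lt m ((e + e' - 1) div 2) (\<lambda>s. f (0 # s) * f' (0 # s) + f (1 # s) * f' (1 # s))"
    using deg_lt_add[OF 2 deg_lt_add[OF 3 4]] by simp
  then show ?case using 1 by simp
qed auto

text \<open>The new letter comes last and leaves the weights of the others unchanged.\<close>

lemma deg_lt_lift: "deg_lt m e f \<Longrightarrow> deg_lt (Suc m) e (\<lambda>s. f (butlast s))"
proof (induction m arbitrary: e f)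
  case (Suc m)
  have "deg_lt (Suc m) k (\<lambda>s. f (y # butlast s)) \<longleftrightarrow> deg_lt (Suc m) k (\<lambda>s. f (butlast (y # s)))" for k y
    by (rule deg_lt_cong) auto
  moreover have "deg_lt (Suc m) k (\<lambda>s. f (0 # butlast s) + f (1 # butlast s))
      \<longleftrightarrow> deg_lt (Suc m) k (\<lambda>s. f (butlast (0 # s)) + f (butlast (1 # s)))" for k
    by (rule deg_lt_cong) auto
  moreover have "deg_lt (Suc m) ((e + 1) div 2) (\<lambda>s. f (0 # butlast s))"
    "deg_lt (Suc m) (e div 2) (\<lambda>s. f (0 # butlast s) + f (1 # butlast s))"
    using Suc.IH[of "(e + 1) div 2" "\<lambda>s. f (0 # s)"] Suc.IH[of "e div 2" "\<lambda>s. f (0 # s) + f (1 # s)"] Suc.prems by auto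
  ultimately show ?case unfolding deg_lt.simps(2)[of "Suc m"] by blast
qed auto

subsection \<open>The action of tree automorphisms on functions\<close>

definition wdiff :: "(word \<Rightarrow> word) \<Rightarrow> (word \<Rightarrow> bit) \<Rightarrow> word \<Rightarrow> bit" where
  "wdiff h f s = f (h s) + f s"

lemma wdiff_Cons:
  assumes "h \<in> tree_aut"
  shows "wdiff h f (0 # s) = (if rt h = 0 then wdiff (sec1 h 0) (\<lambda>s. f (0 # s)) s
      else wdiff (sec1 h 0) (\<lambda>s. f (0 # s)) s + (f (0 # sec1 h 0 s) + f (1 # sec1 h 0 s)))"
    and "wdiff h f (0 # s) + wdiff h f (1 # s) =
      wdiff (sec1 h 0) (\<lambda>s. f (0 # s)) s + (wdiff (sec1 h 1) (\<lambda>s. f (0 # s)) s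
       + wdiff (if rt h = 0 then sec1 h 1 else sec1 h 0) (\<lambda>s. f (0 # s) + f (1 # s)) s)"
  using tree_aut_Cons[OF assms]
  by (cases "rt h = 0"; simp add: wdiff_def add_ac)+

text \<open>The weights 2^i are made for this: a tree automorphism adds to the letter at position i
  a function of the earlier letters, whose weights total only 2^i - 1. So every monomial changes by
  strictly lighter ones.\<close>

lemma deg_lt_diff: "h \<in> tree_aut \<Longrightarrow> deg_lt m e f \<Longrightarrow> deg_lt m (e - 1) (wdiff h f)"
proof (induction m arbitrary: e f h)
  case (Suc m)
  let ?f0 = "\<lambda>s. f (0 # s)" and ?s = "\<lambda>s. f (0 # s) + f (1 # s)"
  have d: "deg_lt m ((e + 1) div 2) ?f0" "deg_lt m (e div 2) ?s" using Suc.prems by auto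
  have le: "(e + 1) div 2 - 1 \<le> (e - 1) div 2" "e div 2 - 1 \<le> (e - 1) div 2" "(e - 1) div 2 \<le> (e - 1 + 1) div 2" "e div 2 - 1 \<le> e div 2"
    "e div 2 \<le> (e - 1 + 1) div 2"
    by linarith+
  have D0: "deg_lt m ((e - 1) div 2) (wdiff k ?f0)" if "k \<in> tree_aut" for k
    using deg_lt_mono[OF Suc.IH[OF that d(1)] le(1)] .
  have Ds: "deg_lt m ((e - 1) div 2) (wdiff k ?s)" "deg_lt m (e div 2) (\<lambda>s. ?s (k s))" if k: "k \<in> tree_aut" for k
  proof -
    show "deg_lt m ((e - 1) div 2) (wdiff k ?s)" using deg_lt_mono[OF Suc.IH[OF k d(2)] le(2)] .
    have "deg_lt m (e div 2) (\<lambda>s. wdiff k ?s s + ?s s)"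
      using deg_lt_mono[OF Suc.IH[OF k d(2)] le(4)] d(2) by (rule deg_lt_add)
    then show "deg_lt m (e div 2) (\<lambda>s. ?s (k s))" by (simp add: wdiff_def)
  qed
  have 0: "deg_lt m ((e - 1 + 1) div 2) (\<lambda>s. wdiff h f (0 # s))"
  proof (cases "rt h = 0")
    case True
    then show ?thesis using deg_lt_mono[OF D0[of "sec1 h 0"] le(3)] Suc.prems(1) by (simp add: wdiff_Cons)
  next
    case False
    then show ?thesis using deg_lt_add[OF deg_lt_mono[OF D0[of "sec1 h 0"] le(3)] deg_lt_mono[OF Ds(2)[of "sec1 h 0"] le(5)]] Suc.prems(1)
      by (simp add: wdiff_Cons)
  qed
  have 1: "deg_lt m ((e - 1) div 2) (\<lambda>s. wdiff h f (0 # s) + wdiff h f (1 # s))"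
    unfolding wdiff_Cons(2)[OF Suc.prems(1)] using Suc.prems(1) by (intro deg_lt_add D0 Ds(1)) auto
  show ?case using 0 1 by simp
qed (auto simp: wdiff_def)

lemma coef_diff_a_odd:
  assumes "odd e" shows "coef (Suc m) (e - 1) (wdiff gen_a f) = coef (Suc m) e f"
proof -
  from assms obtain q where q: "e = 2 * q + 1" using oddE by blast
  show ?thesis unfolding q by (simp add: wdiff_def add.commute)
qed

text \<open>The derivative along a does not depend on the first letter, which every monomial of odd
  weight contains.\<close>

lemma coef_diff_a_even:
  assumes "even e" "0 < e" "0 < m" shows "coef m (e - 1) (wdiff gen_a f) = 0"
proof -
  from assms obtain q where q: "e = 2 * q" "0 < q" by auto
  then obtain q' where q': "q = Suc q'" by (cases q) auto
  from assms obtain m' where m: "m = Suc m'" by (cases m) auto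
  have "wdiff gen_a f (0 # s) + wdiff gen_a f (1 # s) = 0" for s by (simp add: wdiff_def add_ac)
  then show ?thesis unfolding q(1) q' m by simp
qed

text \<open>A monomial of even weight is free of the first letter, so only the restriction of
  \<open>f\<close> to words starting with 0 counts, and a section lowers its degree.\<close>

lemma coef_diff_stab_odd:
  assumes h: "h \<in> tree_aut" "rt h = 0" and e: "odd e" "e < 2 ^ m" and f: "deg_lt m (Suc e) f"
  shows "coef m (e - 1) (wdiff h f) = 0"
proof -
  from e obtain q where q: "e = 2 * q + 1" using oddE by blast
  from q e obtain m' where m: "m = Suc m'" by (cases m) auto
  have "deg_lt m' (Suc q) (\<lambda>s. f (0 # s))" using f q m by simp
  then have "deg_lt m' q (wdiff (sec1 h 0) (\<lambda>s. f (0 # s)))" using deg_lt_diff[of "sec1 h 0" m' "Suc q"] h by simp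
  moreover have "q < 2 ^ m'" using q m e by simp
  ultimately have "coef m' q (wdiff (sec1 h 0) (\<lambda>s. f (0 # s))) = 0" by (rule deg_lt_coef)
  then show ?thesis using q m h by (simp add: wdiff_Cons(1))
qed

text \<open>The odd weight 2q - 1 contains the first letter y. The y-coefficient of the derivative
  collects the actions of both sections on the y-free part of \<open>f\<close>; the y-coefficient of
  \<open>f\<close> itself has degree below q, so its derivative cannot reach weight q - 1.\<close>

lemma coef_diff_stab_even:
  assumes h: "h \<in> tree_aut" "rt h = 0" and q: "0 < q" "q < 2 ^ m" and f: "deg_lt (Suc m) (Suc (2 * q)) f"
  shows "coef (Suc m) (2 * q - 1) (wdiff h f) =
     coef m (q - 1) (wdiff (sec1 h 0) (\<lambda>s. f (0 # s))) + coef m (q - 1) (wdiff (sec1 h 1) (\<lambda>s. f (0 # s)))"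
proof -
  let ?s = "\<lambda>s. f (0 # s) + f (1 # s)"
  have "deg_lt m q ?s" using f by simp
  then have "deg_lt m (q - 1) (wdiff (sec1 h 1) ?s)" using deg_lt_diff h by simp
  then have 0: "coef m (q - 1) (wdiff (sec1 h 1) ?s) = 0" by (rule deg_lt_coef) (use q in simp)
  obtain q' where "q = Suc q'" using q by (cases q) auto
  then have "odd (2 * q - 1)" "(2 * q - 1) div 2 = q - 1" by auto
  then have "coef (Suc m) (2 * q - 1) (wdiff h f) = coef m (q - 1) (\<lambda>s. wdiff h f (0 # s) + wdiff h f (1 # s))" by simp
  also have "\<dots> = coef m (q - 1) (wdiff (sec1 h 0) (\<lambda>s. f (0 # s)))
      + (coef m (q - 1) (wdiff (sec1 h 1) (\<lambda>s. f (0 # s))) + coef m (q - 1) (wdiff (sec1 h 1) ?s))"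
    unfolding wdiff_Cons(2)[OF h(1)] coef_add using h(2) by simp
  finally show ?thesis using 0 by simp
qed

text \<open>For e = 2q with q odd, b = (a, c) works: a lowers the degree q of the part free of the
  first letter by exactly one, c contributes nothing. For q even a contributes nothing, and a
  generator is needed whose section at 1 is the one found for q; the cycle b -> c -> d -> b of these
  sections always supplies it.\<close>

lemma coef_diff_bcd_even:
  assumes "even e" "0 < e" "e < 2 ^ m"
  shows "\<exists>h\<in>{gen_b, gen_c, gen_d}. \<forall>f. deg_lt m (Suc e) f \<longrightarrow> coef m (e - 1) (wdiff h f) = coef m e f"
  using assms
proof (induction m arbitrary: e)
  case (Suc m)
  from Suc.prems obtain q where q: "e = 2 * q" "0 < q" "q < 2 ^ m" by auto
  then have m: "0 < m" by (cases m) auto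
  have f0: "deg_lt m (Suc q) (\<lambda>s. f (0 # s))" if "deg_lt (Suc m) (Suc e) f" for f using that q by simp
  have ce: "coef (Suc m) e f = coef m q (\<lambda>s. f (0 # s))" for f using q by simp
  have id0: "coef m j (wdiff id f) = 0" for j f
  proof -
    have "wdiff id f = (\<lambda>_. 0)" by (simp add: fun_eq_iff wdiff_def id_apply)
    then show ?thesis by simp
  qed
  show ?case
  proof (cases "even q")
    case False
    from m obtain m' where m': "m = Suc m'" by (cases m) auto
    have "coef (Suc m) (e - 1) (wdiff gen_b f) = coef (Suc m) e f" if f: "deg_lt (Suc m) (Suc e) f" for f
    proof -
      have "coef m (q - 1) (wdiff gen_c (\<lambda>s. f (0 # s))) = 0"
        by (rule coef_diff_stab_odd) (use False q f0[OF f] in auto)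
      moreover have "coef m (q - 1) (wdiff gen_a (\<lambda>s. f (0 # s))) = coef m q (\<lambda>s. f (0 # s))"
        unfolding m' by (rule coef_diff_a_odd[OF False])
      ultimately show ?thesis using coef_diff_stab_even[of gen_b q m f] q f ce by simp
    qed
    then show ?thesis by blast
  next
    case True
    then obtain h where h: "h \<in> {gen_b, gen_c, gen_d}"
      "\<And>f. deg_lt m (Suc q) f \<Longrightarrow> coef m (q - 1) (wdiff h f) = coef m q f" using Suc.IH q by blast
    have a: "coef m (q - 1) (wdiff gen_a f) = 0" for f using coef_diff_a_even[OF True q(2) m] .
    have *: "\<exists>k\<in>{gen_b, gen_c, gen_d}. (sec1 k 0 = id \<or> sec1 k 0 = gen_a) \<and> sec1 k 1 = h"
      using h(1) by auto
    then obtain k where k: "k \<in> {gen_b, gen_c, gen_d}" "sec1 k 0 = id \<or> sec1 k 0 = gen_a" "sec1 k 1 = h" by blast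
    have "coef (Suc m) (e - 1) (wdiff k f) = coef (Suc m) e f" if f: "deg_lt (Suc m) (Suc e) f" for f
      using coef_diff_stab_even[of k q m f] q f ce k h(2)[OF f0[OF f]] a id0 by auto
    then show ?thesis using k(1) by blast
  qed
qed simp

lemma coef_diff_generator:
  assumes "0 < e" "e < 2 ^ m"
  obtains h where "h \<in> {gen_a, gen_b, gen_c, gen_d}"
    "\<And>f. deg_lt m (Suc e) f \<Longrightarrow> coef m (e - 1) (wdiff h f) = coef m e f"
proof (cases "even e")
  case True
  then show ?thesis using coef_diff_bcd_even[OF True assms] that by blast
next
  case False
  obtain m' where "m = Suc m'" using assms by (cases m) auto
  then show ?thesis using coef_diff_a_odd[OF False, of m'] that by blast
qed

text \<open>The function on words that corresponds to \<open>v\<^sub>m\<^sup>r\<close>.\<close>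

primrec vfun :: "nat \<Rightarrow> nat \<Rightarrow> word \<Rightarrow> bit" where
  "vfun 0 r s = 1"
| "vfun (Suc m) r s = (if odd r \<or> hd s = 0 then vfun m (r div 2) (tl s) else 0)"

text \<open>As a function on words, a factor 1 - X_i is constant in its letter, and a missing factor
  is the indicator of the letter 0, that is, 1 plus the letter. The leading monomial thus consists
  of the zero digits of \<open>r\<close>.\<close>

lemma deg_lt_vfun: "r < 2 ^ m \<Longrightarrow> deg_lt m (2 ^ m - r) (vfun m r) \<and> coef m (2 ^ m - 1 - r) (vfun m r) = 1"
proof (induction m arbitrary: r)
  case (Suc m)
  have lt: "r div 2 < 2 ^ m" using Suc.prems by auto
  note IH = Suc.IH[OF lt]
  show ?case
  proof (cases "even r")
    case True
    then obtain q where q: "r = 2 * q" by auto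
    obtain k where k: "2 ^ m = Suc (q + k)" using lt q less_iff_Suc_add by auto
    have "(2 ^ Suc m - r + 1) div 2 = 2 ^ m - q" "(2 ^ Suc m - r) div 2 = 2 ^ m - q"
      "(2 ^ Suc m - 1 - r) div 2 = 2 ^ m - 1 - q" "odd (2 ^ Suc m - 1 - r)"
      using q k by simp_all
    then show ?thesis using IH q True by simp
  next
    case False
    then obtain q where q: "r = 2 * q + 1" using oddE by blast
    obtain k where k: "2 ^ m = Suc (q + k)" using lt q less_iff_Suc_add by auto
    have "(2 ^ Suc m - r + 1) div 2 = 2 ^ m - q" "(2 ^ Suc m - 1 - r) div 2 = 2 ^ m - 1 - q" "even (2 ^ Suc m - 1 - r)"
      using q k by simp_all
    then show ?thesis using IH q False by simp
  qed
qed simp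

subsection \<open>Level powers\<close>

text \<open>A recursive form of \<open>level_power\<close> that suits induction on the first
  letter.\<close>

primrec pairs_pow :: "(word \<Rightarrow> word) set \<Rightarrow> nat \<Rightarrow> (word \<Rightarrow> word) set" where
  "pairs_pow Q 0 = Q"
| "pairs_pow Q (Suc m) = {pair g h | g h. g \<in> pairs_pow Q m \<and> h \<in> pairs_pow Q m}"

lemma pairs_pow_sec:
  assumes "Q \<subseteq> tree_aut"
  shows "g \<in> pairs_pow Q m \<Longrightarrow> length \<sigma> = m \<Longrightarrow> g \<sigma> = \<sigma> \<and> sec g \<sigma> \<in> Q"
proof (induction m arbitrary: g \<sigma>)
  case 0 then show ?case using assms by auto
next
  case (Suc m)
  then obtain g0 g1 where g: "g = pair g0 g1" "g0 \<in> pairs_pow Q m" "g1 \<in> pairs_pow Q m" by auto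
  obtain y \<tau> where \<sigma>: "\<sigma> = y # \<tau>" "length \<tau> = m" using Suc.prems by (auto simp: length_Suc_conv)
  from Suc.IH[OF g(2) \<sigma>(2)] Suc.IH[OF g(3) \<sigma>(2)] \<sigma>(1) g(1) show ?case by (cases y) auto
qed

lemma level_power_eq_pairs_pow:
  assumes Q: "Q \<subseteq> tree_aut" shows "level_power Q m = pairs_pow Q m"
proof (induction m)
  case 0
  have "g \<in> level_power Q 0 \<longleftrightarrow> g \<in> Q" for g
  proof
    assume "g \<in> level_power Q 0"
    then obtain h where "h \<in> Q" "\<forall>\<tau>. g \<tau> = h \<tau>" by (auto simp: level_power_def)
    then have "g = h" by (simp add: fun_eq_iff)
    with \<open>h \<in> Q\<close> show "g \<in> Q" by simp
  qed (use Q in \<open>auto simp: level_power_def\<close>)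
  then show ?case by auto
next
  case (Suc m)
  show ?case
  proof (intro equalityI subsetI)
    fix g assume g: "g \<in> level_power Q (Suc m)"
    then have t: "g \<in> tree_aut" by (simp add: level_power_def)
    have h: "\<exists>h\<in>Q. \<forall>\<tau>. (y + rt g) # sec1 g y (\<sigma> @ \<tau>) = y # \<sigma> @ h \<tau>" if "length \<sigma> = m" for y \<sigma>
    proof -
      have "\<forall>\<sigma>. length \<sigma> = Suc m \<longrightarrow> (\<exists>h\<in>Q. \<forall>\<tau>. g (\<sigma> @ \<tau>) = \<sigma> @ h \<tau>)"
        using g by (simp add: level_power_def)
      from this[rule_format, of "y # \<sigma>"] have "\<exists>h\<in>Q. \<forall>\<tau>. g ((y # \<sigma>) @ \<tau>) = (y # \<sigma>) @ h \<tau>"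
        using that by simp
      then show ?thesis by (simp add: tree_aut_Cons[OF t])
    qed
    from h[of "replicate m 0" 0] have "rt g = 0" by auto
    then have "sec1 g y \<in> level_power Q m" for y
      using h[of _ y] t unfolding level_power_def by simp
    then have "pair (sec1 g 0) (sec1 g 1) \<in> pairs_pow Q (Suc m)" using Suc.IH by auto
    then show "g \<in> pairs_pow Q (Suc m)" using pair_sec1[OF t \<open>rt g = 0\<close>] by simp
  next
    fix g assume "g \<in> pairs_pow Q (Suc m)"
    then obtain g0 g1 where g: "g = pair g0 g1" "g0 \<in> level_power Q m" "g1 \<in> level_power Q m" using Suc.IH by auto
    have "\<exists>h\<in>Q. \<forall>\<tau>. g (\<sigma> @ \<tau>) = \<sigma> @ h \<tau>" if \<sigma>: "length \<sigma> = Suc m" for \<sigma>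
    proof -
      obtain y \<rho> where "\<sigma> = y # \<rho>" "length \<rho> = m" using \<sigma> by (auto simp: length_Suc_conv)
      with g show ?thesis unfolding level_power_def by (cases y) auto
    qed
    then show "g \<in> level_power Q (Suc m)" using g by (auto simp: level_power_def)
  qed
qed

lemma normal_tree_aut: "N \<lhd> GG \<Longrightarrow> N \<subseteq> tree_aut"
  using normal_GG_mem GC_tree_aut by blast

text \<open>Index shift: \<open>NK k\<close> is \<open>N\<^sub>k\<^sub>+\<^sub>1\<close>, since \<open>LL\<close> is \<open>N\<^sub>1\<close>.\<close>

abbreviation NK :: "nat \<Rightarrow> (word \<Rightarrow> word) set" where "NK \<equiv> pairs_pow LL"

lemma NK_normal: "NK k \<lhd> GG" and NK_LL: "NK k \<subseteq> LL"
proof -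
  have "NK k \<lhd> GG \<and> NK k \<subseteq> LL"
  proof (induction k)
    case (Suc k)
    then have *: "pair g h \<in> LL" if "g \<in> NK k" "h \<in> NK k" for g h using that pair_LL by blast
    have "{pair g h |g h. g \<in> NK k \<and> h \<in> NK k} \<lhd> GG"
      using Suc * normal_GG_mem[OF LL_normal] by (intro normal_pairs) auto
    then show ?case using * by auto
  qed (simp add: LL_normal)
  then show "NK k \<lhd> GG" "NK k \<subseteq> LL" by auto
qed

lemma NK_Suc: "NK (Suc k) \<subseteq> NK k"
proof (induction k)
  case (Suc k)
  show ?case
  proof
    fix g assume "g \<in> NK (Suc (Suc k))"
    then obtain g0 g1 where g: "g = pair g0 g1" "g0 \<in> NK (Suc k)" "g1 \<in> NK (Suc k)"
      unfolding pairs_pow.simps(2)[of LL "Suc k"] by blast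
    then have "g0 \<in> NK k" "g1 \<in> NK k" using Suc by blast+
    then show "g \<in> NK (Suc k)" using g by auto
  qed
qed (auto intro: pair_LL)

lemma LL_kap: "g \<in> LL \<Longrightarrow> kap g = 0" and LL_mu: "g \<in> LL \<Longrightarrow> mu g = 0"
  by (auto simp: LL_def)

lemma NK_M2: "g \<in> NK k \<Longrightarrow> g \<in> M2" and NK_GC: "g \<in> NK k \<Longrightarrow> g \<in> GC" and NK_tree_aut: "g \<in> NK k \<Longrightarrow> g \<in> tree_aut"
  using NK_LL LL_M2 M2_GC M2_tree_aut by blast+

lemma NK_sec: "g \<in> NK k \<Longrightarrow> length \<sigma> = k \<Longrightarrow> g \<sigma> = \<sigma>" "g \<in> NK k \<Longrightarrow> length \<sigma> = k \<Longrightarrow> sec g \<sigma> \<in> LL"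
  using pairs_pow_sec[of LL g k \<sigma>] normal_tree_aut[OF LL_normal] by auto

lemma NK_sec_Suc:
  assumes "g \<in> NK k" "length \<sigma> = Suc k" shows "g \<sigma> = \<sigma>" "sec g \<sigma> \<in> M2"
proof -
  obtain \<rho> y where \<sigma>: "\<sigma> = \<rho> @ [y]" "length \<rho> = k" using assms(2) by (auto simp: length_Suc_conv_rev)
  have s: "sec g \<rho> \<in> LL" using NK_sec assms(1) \<sigma>(2) by blast
  then have "rt (sec g \<rho>) = 0" using LL_M2 M2_rt by blast
  then show "g \<sigma> = \<sigma>"
    using \<sigma> NK_sec(1)[OF assms(1) \<sigma>(2)] NK_tree_aut[OF assms(1)] by (simp add: tree_aut_sec tree_aut_singleton)
  show "sec g \<sigma> \<in> M2" using LL_sec1_M2[OF s] \<sigma> by (simp add: sec_append)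
qed

section \<open>The functions A and B on words\<close>

definition Af :: "(word \<Rightarrow> word) \<Rightarrow> word \<Rightarrow> bit" where "Af g \<sigma> = kap (sec g \<sigma>)"

text \<open>By \<open>LL_mu_sec1\<close> the child 1 gives the same value
  (\<open>mu_sec_NK\<close>).\<close>

definition Bf :: "(word \<Rightarrow> word) \<Rightarrow> word \<Rightarrow> bit" where "Bf g \<sigma> = mu (sec g (\<sigma> @ [0]))"

lemma mu_sec_NK:
  assumes "g \<in> NK k" "length \<sigma> = Suc k" shows "mu (sec g \<sigma>) = Bf g (butlast \<sigma>)"
proof -
  obtain \<rho> y where \<sigma>: "\<sigma> = \<rho> @ [y]" "length \<rho> = k" using assms(2) by (auto simp: length_Suc_conv_rev)
  have "sec g \<rho> \<in> LL" using NK_sec assms(1) \<sigma>(2) by blast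
  from LL_mu_sec1[OF this] \<sigma> show ?thesis by (cases y) (simp_all add: Bf_def sec_append)
qed

lemma Af_comp: "g \<in> NK k \<Longrightarrow> h \<in> NK k \<Longrightarrow> length \<sigma> = Suc k \<Longrightarrow> Af (g \<circ> h) \<sigma> = Af g \<sigma> + Af h \<sigma>"
  and Bf_comp: "g \<in> NK k \<Longrightarrow> h \<in> NK k \<Longrightarrow> length \<rho> = k \<Longrightarrow> Bf (g \<circ> h) \<rho> = Bf g \<rho> + Bf h \<rho>"
  by (simp_all add: Af_def Bf_def sec_comp NK_tree_aut NK_sec_Suc kap_comp mu_comp)

lemma Af_inv: "g \<in> NK k \<Longrightarrow> length \<sigma> = Suc k \<Longrightarrow> Af (finv g) \<sigma> = Af g \<sigma>"
  and Bf_inv: "g \<in> NK k \<Longrightarrow> length \<rho> = k \<Longrightarrow> Bf (finv g) \<rho> = Bf g \<rho>"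
proof -
  have *: "finv g \<sigma> = \<sigma>" if "g \<in> NK k" "length \<sigma> = Suc k" for g \<sigma>
    using NK_sec_Suc(1)[OF normal_GG_inv[OF NK_normal that(1)] that(2)] .
  show "g \<in> NK k \<Longrightarrow> length \<sigma> = Suc k \<Longrightarrow> Af (finv g) \<sigma> = Af g \<sigma>"
    by (simp add: Af_def sec_inv NK_tree_aut * kap_inv NK_sec_Suc)
  show "g \<in> NK k \<Longrightarrow> length \<rho> = k \<Longrightarrow> Bf (finv g) \<rho> = Bf g \<rho>"
    by (simp add: Bf_def sec_inv NK_tree_aut * mu_inv NK_sec_Suc)
qed

lemma sec_conj:
  assumes g: "g \<in> GC" and h: "h \<in> NK k" and \<sigma>: "length \<sigma> = Suc k"
  defines "\<tau> \<equiv> finv g \<sigma>"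
  shows "sec (g \<circ> h \<circ> finv g) \<sigma> = sec g \<tau> \<circ> sec h \<tau> \<circ> finv (sec g \<tau>)" and "length \<tau> = Suc k"
proof -
  show l: "length \<tau> = Suc k" using g \<sigma> by (simp add: \<tau>_def GC_tree_aut)
  have "h \<tau> = \<tau>" using NK_sec_Suc(1)[OF h l] .
  then show "sec (g \<circ> h \<circ> finv g) \<sigma> = sec g \<tau> \<circ> sec h \<tau> \<circ> finv (sec g \<tau>)"
    using GC_tree_aut[OF g] NK_tree_aut[OF h] by (simp add: sec_comp sec_inv \<tau>_def[symmetric])
qed

text \<open>\<open>kap\<close> is invariant under conjugation, so conjugating only moves the
  vertices. Commutators thereby become differences in \<open>Af_cmt\<close>.\<close>

lemma Af_conj:
  assumes g: "g \<in> GC" and h: "h \<in> NK k" and \<sigma>: "length \<sigma> = Suc k"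
  shows "Af (g \<circ> h \<circ> finv g) \<sigma> = Af h (finv g \<sigma>)"
  unfolding Af_def sec_conj(1)[OF assms]
  using kap_conj[OF sec_GC[OF g] NK_sec_Suc(2)[OF h sec_conj(2)[OF assms]]] .

lemma Bf_conj:
  assumes g: "g \<in> GC" and h: "h \<in> NK k" and \<rho>: "length \<rho> = k"
  shows "Bf (g \<circ> h \<circ> finv g) \<rho> = Bf h (finv g \<rho>)"
proof -
  have l: "length (\<rho> @ [0]) = Suc k" using \<rho> by simp
  have "Bf (g \<circ> h \<circ> finv g) \<rho> = mu (sec h (finv g (\<rho> @ [0])))"
    unfolding Bf_def sec_conj(1)[OF g h l]
    using mu_conj[OF sec_GC[OF g] NK_sec_Suc(2)[OF h sec_conj(2)[OF g h l]]] .
  also have "\<dots> = Bf h (butlast (finv g (\<rho> @ [0])))"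
    using mu_sec_NK[OF h sec_conj(2)[OF g h l]] .
  also obtain y where "finv g (\<rho> @ [0]) = finv g \<rho> @ [y]" using tree_aut_step[of "finv g"] GC_tree_aut[OF g] by auto
  then have "butlast (finv g (\<rho> @ [0])) = finv g \<rho>" by simp
  finally show ?thesis .
qed

lemma Af_cmt:
  assumes g: "g \<in> GC" and h: "h \<in> NK k" and \<sigma>: "length \<sigma> = Suc k"
  shows "Af (GG.cmt g h) \<sigma> = wdiff (finv g) (Af h) \<sigma>"
proof -
  have "GG.cmt g h = (g \<circ> h \<circ> finv g) \<circ> finv h" using g NK_GC[OF h] by (simp add: inv_GG)
  then show ?thesis
    using Af_comp[OF normal_GG_conj[OF NK_normal g h] normal_GG_inv[OF NK_normal h] \<sigma>] Af_conj[OF assms] Af_inv[OF h \<sigma>]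
    by (simp add: wdiff_def)
qed

lemma Bf_cmt:
  assumes g: "g \<in> GC" and h: "h \<in> NK k" and \<sigma>: "length \<sigma> = k"
  shows "Bf (GG.cmt g h) \<sigma> = wdiff (finv g) (Bf h) \<sigma>"
proof -
  have "GG.cmt g h = (g \<circ> h \<circ> finv g) \<circ> finv h" using g NK_GC[OF h] by (simp add: inv_GG)
  then show ?thesis
    using Bf_comp[OF normal_GG_conj[OF NK_normal g h] normal_GG_inv[OF NK_normal h] \<sigma>] Bf_conj[OF assms] Bf_inv[OF h \<sigma>]
    by (simp add: wdiff_def)
qed

lemma NK_square:
  assumes "g \<in> NK k" shows "g \<circ> g \<in> NK (Suc k)"
proof -
  have "\<forall>g\<in>NK k. g \<circ> g \<in> NK (Suc k)"
  proof (induction k)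
    case 0
    have "g \<circ> g \<in> NK 1" if g: "g \<in> LL" for g
    proof -
      have t: "g \<in> tree_aut" "rt g = 0" using g LL_M2 M2_tree_aut M2_rt by auto
      have "g \<circ> g = pair (sec1 g 0 \<circ> sec1 g 0) (sec1 g 1 \<circ> sec1 g 1)"
        using pair_comp[of "sec1 g 0" "sec1 g 1" "sec1 g 0" "sec1 g 1"] pair_sec1[OF t] by simp
      then show ?thesis using M2_square_LL LL_sec1_M2[OF g] by auto
    qed
    then show ?case by simp
  next
    case (Suc k)
    show ?case
    proof
      fix g assume "g \<in> NK (Suc k)"
      then obtain g0 g1 where "g = pair g0 g1" "g0 \<in> NK k" "g1 \<in> NK k" by auto
      moreover from this have "g0 \<circ> g0 \<in> NK (Suc k)" "g1 \<circ> g1 \<in> NK (Suc k)" using Suc by blast+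
      ultimately show "g \<circ> g \<in> NK (Suc (Suc k))"
        unfolding pairs_pow.simps(2)[of LL "Suc k"] by (auto simp: pair_comp)
    qed
  qed
  then show ?thesis using assms by blast
qed

lemma sec_square:
  assumes g: "g \<in> NK k" and \<sigma>: "length \<sigma> = Suc k"
  shows "sec (g \<circ> g) (\<sigma> @ [y]) = sec1 (sec g \<sigma> \<circ> sec g \<sigma>) y"
  using NK_sec_Suc(1)[OF g \<sigma>] NK_tree_aut[OF g] by (simp add: sec_append sec_comp)

lemma Af_square:
  assumes g: "g \<in> NK k" and \<sigma>: "length \<sigma> = Suc (Suc k)"
  shows "Af (g \<circ> g) \<sigma> = Bf g (butlast (butlast \<sigma>)) * (1 + Af g (butlast \<sigma>))"
proof -
  obtain \<rho> y where \<sigma>': "\<sigma> = \<rho> @ [y]" "length \<rho> = Suc k" using \<sigma> by (auto simp: length_Suc_conv_rev)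
  show ?thesis unfolding Af_def \<sigma>'(1) sec_square[OF g \<sigma>'(2)]
    using M2_square_sec1(1)[OF NK_sec_Suc(2)[OF g \<sigma>'(2)]] mu_sec_NK[OF g \<sigma>'(2)] by simp
qed

lemma Bf_square:
  assumes g: "g \<in> NK k" and \<sigma>: "length \<sigma> = Suc k"
  shows "Bf (g \<circ> g) \<sigma> = Af g \<sigma> + Bf g (butlast \<sigma>)"
  unfolding Bf_def[of "g \<circ> g"] sec_square[OF assms] M2_square_sec1(2)[OF NK_sec_Suc(2)[OF assms]]
  by (simp add: Af_def mu_sec_NK[OF assms])

subsection \<open>The filtration\<close>

text \<open>The candidate for the dimension subgroup of index \<open>2 ^ Suc k + 1 + r\<close>.\<close>

definition MM :: "nat \<Rightarrow> nat \<Rightarrow> (word \<Rightarrow> word) set" where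
  "MM k r = {g \<in> NK k. deg_lt (Suc k) (2 ^ Suc k - r) (Af g) \<and> deg_lt k (2 ^ k - r div 2) (Bf g)}"

lemma MM_NK: "g \<in> MM k r \<Longrightarrow> g \<in> NK k" by (simp add: MM_def)

lemma MM_GC: "g \<in> MM k r \<Longrightarrow> g \<in> GC" using MM_NK NK_GC by blast

lemma MM_0: "MM k 0 = NK k"
  unfolding MM_def by (auto intro: deg_lt_top simp del: power_Suc deg_lt.simps)

text \<open>Both bounds are 0 here, so \<open>kap\<close> and \<open>mu\<close> vanish at all
  vertices of level k + 1 and the sections there lie in \<open>LL\<close>. The blocks of the series
  fit together at this point.\<close>

lemma MM_top: "MM k (2 ^ Suc k) = NK (Suc k)"
proof -
  have sub: "g \<in> NK (Suc k)" if "g \<in> NK k" "\<forall>\<sigma>. length \<sigma> = Suc k \<longrightarrow> Af g \<sigma> = 0" "\<forall>\<sigma>. length \<sigma> = k \<longrightarrow> Bf g \<sigma> = 0" for g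
    using that
  proof (induction k arbitrary: g)
    case 0
    then have g: "g \<in> LL" by simp
    have t: "g \<in> tree_aut" "rt g = 0" using g LL_M2 M2_tree_aut M2_rt by auto
    have "kap (sec1 g y) = 0" for y using 0(2)[rule_format, of "[y]"] by (simp add: Af_def)
    moreover have "mu (sec1 g 0) = 0" using 0(3)[rule_format, of "[]"] by (simp add: Bf_def)
    moreover from this have "mu (sec1 g 1) = 0" using LL_mu_sec1[OF g] by simp
    ultimately have "sec1 g 0 \<in> LL" "sec1 g 1 \<in> LL" using LL_sec1_M2[OF g] by (auto simp: LL_def)
    then show ?case using pair_sec1[OF t] by (simp del: One_nat_def) metis
  next
    case (Suc k)
    then obtain g0 g1 where g: "g = pair g0 g1" "g0 \<in> NK k" "g1 \<in> NK k" by auto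
    have "Af g0 \<sigma> = 0 \<and> Af g1 \<sigma> = 0" if "length \<sigma> = Suc k" for \<sigma>
      using Suc.prems(2)[rule_format, of "0 # \<sigma>"] Suc.prems(2)[rule_format, of "1 # \<sigma>"] that by (simp add: Af_def g(1))
    moreover have "Bf g0 \<sigma> = 0 \<and> Bf g1 \<sigma> = 0" if "length \<sigma> = k" for \<sigma>
      using Suc.prems(3)[rule_format, of "0 # \<sigma>"] Suc.prems(3)[rule_format, of "1 # \<sigma>"] that by (simp add: Bf_def g(1))
    ultimately have "g0 \<in> NK (Suc k)" "g1 \<in> NK (Suc k)" using Suc.IH g by blast+
    then show ?case unfolding g(1) pairs_pow.simps(2)[of LL "Suc k"] by blast
  qed
  have iff: "g \<in> MM k (2 ^ Suc k) \<longleftrightarrow> g \<in> NK k \<and> (\<forall>\<sigma>. length \<sigma> = Suc k \<longrightarrow> Af g \<sigma> = 0) \<and> (\<forall>\<sigma>. length \<sigma> = k \<longrightarrow> Bf g \<sigma> = 0)" for g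
  proof -
    have e: "(2::nat) ^ Suc k - 2 ^ Suc k = 0" "(2::nat) ^ k - 2 ^ Suc k div 2 = 0" by simp_all
    show ?thesis unfolding MM_def e deg_lt_zero_iff by blast
  qed
  show ?thesis
  proof (intro equalityI subsetI)
    fix g assume "g \<in> MM k (2 ^ Suc k)" then show "g \<in> NK (Suc k)" using sub iff by blast
  next
    fix g assume g: "g \<in> NK (Suc k)"
    have "Af g \<sigma> = 0" if "length \<sigma> = Suc k" for \<sigma>
      using LL_kap[OF NK_sec(2)[OF g that]] by (simp add: Af_def)
    moreover have "Bf g \<sigma> = 0" if "length \<sigma> = k" for \<sigma>
      using LL_mu[OF NK_sec(2)[OF g, of "\<sigma> @ [0]"]] that by (simp add: Bf_def)
    ultimately show "g \<in> MM k (2 ^ Suc k)" unfolding iff using g NK_Suc by blast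
  qed
qed

lemma MM_Suc: "MM k (Suc r) \<subseteq> MM k r"
  unfolding MM_def by (auto elim!: deg_lt_mono simp del: deg_lt.simps power_Suc)

lemma MM_comp:
  assumes "g \<in> MM k r" "h \<in> MM k r" shows "g \<circ> h \<in> MM k r"
proof -
  have g: "g \<in> NK k" "h \<in> NK k" using assms MM_NK by auto
  have "deg_lt (Suc k) e (Af (g \<circ> h)) \<longleftrightarrow> deg_lt (Suc k) e (\<lambda>s. Af g s + Af h s)" for e
    using Af_comp[OF g] by (rule deg_lt_cong)
  moreover have "deg_lt k e (Bf (g \<circ> h)) \<longleftrightarrow> deg_lt k e (\<lambda>s. Bf g s + Bf h s)" for e
    using Bf_comp[OF g] by (rule deg_lt_cong)
  ultimately show ?thesis
    using assms deg_lt_add normal_GG_comp[OF NK_normal g] unfolding MM_def by (auto simp del: deg_lt.simps power_Suc)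
qed

lemma MM_inv:
  assumes "g \<in> MM k r" shows "finv g \<in> MM k r"
proof -
  have g: "g \<in> NK k" using assms MM_NK by auto
  have "deg_lt (Suc k) e (Af (finv g)) \<longleftrightarrow> deg_lt (Suc k) e (Af g)" for e
    using Af_inv[OF g] by (rule deg_lt_cong)
  moreover have "deg_lt k e (Bf (finv g)) \<longleftrightarrow> deg_lt k e (Bf g)" for e
    using Bf_inv[OF g] by (rule deg_lt_cong)
  ultimately show ?thesis
    using assms normal_GG_inv[OF NK_normal g] unfolding MM_def by (auto simp del: deg_lt.simps power_Suc)
qed

lemma cmt_NK: "g \<in> GC \<Longrightarrow> h \<in> NK k \<Longrightarrow> GG.cmt g h \<in> NK k"
  using normal_GG_comp[OF NK_normal normal_GG_conj[OF NK_normal] normal_GG_inv[OF NK_normal], of g h k h] NK_GC[of h k]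
  by (simp add: inv_GG)

lemma MM_cmt:
  assumes g: "g \<in> GC" and h: "h \<in> MM k r" shows "GG.cmt g h \<in> MM k (Suc r)"
proof -
  have h': "h \<in> NK k" "deg_lt (Suc k) (2 ^ Suc k - r) (Af h)" "deg_lt k (2 ^ k - r div 2) (Bf h)"
    using h by (auto simp: MM_def simp del: deg_lt.simps power_Suc)
  have t: "finv g \<in> tree_aut" using GC_tree_aut g by simp
  have "deg_lt (Suc k) (2 ^ Suc k - r - 1) (wdiff (finv g) (Af h))" using deg_lt_diff[OF t h'(2)] .
  then have "deg_lt (Suc k) (2 ^ Suc k - Suc r) (Af (GG.cmt g h))"
    using deg_lt_cong[of "Suc k" "Af (GG.cmt g h)" "wdiff (finv g) (Af h)"] Af_cmt[OF g h'(1)] by (simp del: deg_lt.simps power_Suc)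
  moreover have "deg_lt k (2 ^ k - r div 2 - 1) (wdiff (finv g) (Bf h))" using deg_lt_diff[OF t h'(3)] .
  then have "deg_lt k (2 ^ k - r div 2 - 1) (Bf (GG.cmt g h))"
    using deg_lt_cong[of k "Bf (GG.cmt g h)" "wdiff (finv g) (Bf h)"] Bf_cmt[OF g h'(1)] by simp
  then have "deg_lt k (2 ^ k - Suc r div 2) (Bf (GG.cmt g h))" by (rule deg_lt_mono) linarith
  ultimately show ?thesis using cmt_NK[OF g h'(1)] by (simp add: MM_def del: deg_lt.simps power_Suc)
qed

lemma MM_normal: "MM k r \<lhd> GG"
proof (rule normal_GGI)
  show "id \<in> MM k r"
    using normal_GG_id[OF NK_normal] by (simp add: MM_def Af_def[abs_def] Bf_def[abs_def] del: deg_lt.simps power_Suc)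
next
  fix g h assume g: "g \<in> GC" and h: "h \<in> MM k r"
  have "GG.cmt g h \<circ> h \<in> MM k r" using MM_cmt[OF g h] MM_Suc MM_comp h by blast
  moreover have "GG.cmt g h \<circ> h = g \<circ> h \<circ> finv g"
    using g NK_GC[OF MM_NK[OF h]] by (simp add: inv_GG comp_assoc inv_comp_left GC_tree_aut)
  ultimately show "g \<circ> h \<circ> finv g \<in> MM k r" by simp
qed (use MM_GC MM_comp MM_inv in blast)+

text \<open>By \<open>Bf_square\<close> the new B obeys the bound of the old A, and
  \<open>(2 * r + 1) div 2\<close> is \<open>r\<close>. By \<open>Af_square\<close> the new A
  contains a product, whose strict bounds add up to
  \<open>(2 ^ k - r div 2) + (2 ^ Suc k - r) - 1\<close>; for \<open>r < 2 ^ Suc k\<close> this is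
  small enough. The remainder \<open>2 * r + 1\<close> is that of the doubled index.\<close>

lemma MM_square:
  assumes g: "g \<in> MM k r" and r: "r < 2 ^ Suc k" shows "g \<circ> g \<in> MM (Suc k) (2 * r + 1)"
proof -
  let ?m = "Suc k"
  have g': "g \<in> NK k" "deg_lt ?m (2 ^ ?m - r) (Af g)" "deg_lt k (2 ^ k - r div 2) (Bf g)"
    using g by (auto simp: MM_def simp del: deg_lt.simps power_Suc)
  let ?B = "\<lambda>s. Bf g (butlast s)"
  have B: "deg_lt ?m (2 ^ k - r div 2) ?B" using deg_lt_lift[OF g'(3)] .
  have "N - r div 2 \<le> 2 * N - r \<and> N - r div 2 + (2 * N - r) - 1 \<le> 2 * (2 * N) - (2 * r + 1)
      \<and> N - r div 2 \<le> 2 * (2 * N) - (2 * r + 1)" if "r < 2 * N" for N :: nat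
  proof (cases "even r")
    case True
    then obtain s where s: "r = 2 * s" by auto
    then have "s < N" using that by simp
    then obtain t where "N = s + Suc t" using less_iff_Suc_add by auto
    then show ?thesis using s by simp
  next
    case False
    then obtain s where s: "r = 2 * s + 1" using oddE by blast
    then have "s < N" using that by simp
    then obtain t where "N = s + Suc t" using less_iff_Suc_add by auto
    then show ?thesis using s by simp
  qed
  from this[of "2 ^ k"] r
  have le: "2 ^ k - r div 2 \<le> 2 ^ ?m - r" "2 ^ k - r div 2 + (2 ^ ?m - r) - 1 \<le> 2 ^ Suc ?m - (2 * r + 1)"
      "2 ^ k - r div 2 \<le> 2 ^ Suc ?m - (2 * r + 1)"
    by simp_all
  have "deg_lt ?m (2 ^ ?m - r) (\<lambda>s. Af g s + ?B s)"
    using g'(2) by (rule deg_lt_add) (rule deg_lt_mono[OF B le(1)])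
  then have 1: "deg_lt ?m (2 ^ ?m - (2 * r + 1) div 2) (Bf (g \<circ> g))"
    using deg_lt_cong[of ?m "Bf (g \<circ> g)" "\<lambda>s. Af g s + ?B s"] Bf_square[OF g'(1)] by (simp del: deg_lt.simps power_Suc)
  have "deg_lt ?m (2 ^ k - r div 2 + (2 ^ ?m - r) - 1) (\<lambda>s. ?B s * Af g s)" using deg_lt_mult[OF B g'(2)] .
  then have "deg_lt ?m (2 ^ Suc ?m - (2 * r + 1)) (\<lambda>s. ?B s * Af g s)"
    using le(2) by (rule deg_lt_mono)
  moreover have "deg_lt ?m (2 ^ Suc ?m - (2 * r + 1)) ?B"
    by (rule deg_lt_mono[OF B le(3)])
  ultimately have "deg_lt ?m (2 ^ Suc ?m - (2 * r + 1)) (\<lambda>s. ?B s + ?B s * Af g s)" by (intro deg_lt_add)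
  from deg_lt_lift[OF this]
  have "deg_lt (Suc ?m) (2 ^ Suc ?m - (2 * r + 1)) (\<lambda>s. ?B (butlast s) * (1 + Af g (butlast s)))"
    by (simp only: distrib_left mult_1_right)
  then have "deg_lt (Suc ?m) (2 ^ Suc ?m - (2 * r + 1)) (Af (g \<circ> g))"
    using deg_lt_cong[of "Suc ?m" "Af (g \<circ> g)" "\<lambda>s. ?B (butlast s) * (1 + Af g (butlast s))"] Af_square[OF g'(1)]
    by (simp del: deg_lt.simps power_Suc)
  then show ?thesis using 1 NK_square[OF g'(1)] by (simp add: MM_def del: deg_lt.simps power_Suc pairs_pow.simps)
qed

text \<open>\<open>MM 0 1\<close> asks that \<open>Af\<close> not depend on its single letter; by
  \<open>M2_square_sec1\<close> the square has the same \<open>kap\<close> at both sections.\<close>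

lemma M2_square_MM: "g \<in> M2 \<Longrightarrow> g \<circ> g \<in> MM 0 1"
  using M2_square_LL[of g] M2_square_sec1(1)[of g] by (simp add: MM_def Af_def)

subsection \<open>Leading coefficients\<close>

definition leadA :: "nat \<Rightarrow> nat \<Rightarrow> (word \<Rightarrow> word) \<Rightarrow> bit" where
  "leadA k r g = coef (Suc k) (2 ^ Suc k - 1 - r) (Af g)"

definition leadB :: "nat \<Rightarrow> nat \<Rightarrow> (word \<Rightarrow> word) \<Rightarrow> bit" where
  "leadB k r g = coef k (2 ^ k - 1 - r div 2) (Bf g)"

text \<open>The bound on \<open>Bf\<close> changes only in the step from an odd \<open>r\<close> to
  the next.\<close>

lemma MM_Suc_iff:
  assumes r: "r < 2 ^ Suc k"
  shows "g \<in> MM k (Suc r) \<longleftrightarrow> g \<in> MM k r \<and> leadA k r g = 0 \<and> (odd r \<longrightarrow> leadB k r g = 0)"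
proof -
  have A: "deg_lt (Suc k) (2 ^ Suc k - Suc r) f \<longleftrightarrow> deg_lt (Suc k) (2 ^ Suc k - r) f \<and> coef (Suc k) (2 ^ Suc k - 1 - r) f = 0" for f
  proof -
    have "2 ^ Suc k - Suc r < 2 ^ Suc k" "Suc (2 ^ Suc k - Suc r) = 2 ^ Suc k - r" "2 ^ Suc k - Suc r = 2 ^ Suc k - 1 - r"
      using r by simp_all
    then show ?thesis using deg_lt_Suc by metis
  qed
  show ?thesis
  proof (cases "even r")
    case True
    then have "Suc r div 2 = r div 2" by simp
    with True show ?thesis unfolding MM_def leadA_def mem_Collect_eq A by auto
  next
    case False
    then have s: "Suc r div 2 = Suc (r div 2)" by simp
    have "r div 2 < 2 ^ k" using r by simp
    then have "2 ^ k - Suc (r div 2) < 2 ^ k" "Suc (2 ^ k - Suc (r div 2)) = 2 ^ k - r div 2"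
      "2 ^ k - Suc (r div 2) = 2 ^ k - 1 - r div 2" by simp_all
    then have "deg_lt k (2 ^ k - Suc (r div 2)) f \<longleftrightarrow> deg_lt k (2 ^ k - r div 2) f \<and> coef k (2 ^ k - 1 - r div 2) f = 0" for f
      using deg_lt_Suc by metis
    with False s show ?thesis unfolding MM_def leadA_def leadB_def mem_Collect_eq A by auto
  qed
qed

lemma leadA_comp: "g \<in> NK k \<Longrightarrow> h \<in> NK k \<Longrightarrow> leadA k r (g \<circ> h) = leadA k r g + leadA k r h"
  unfolding leadA_def by (subst coef_add[symmetric]) (rule coef_cong, rule Af_comp)

lemma leadB_comp: "g \<in> NK k \<Longrightarrow> h \<in> NK k \<Longrightarrow> leadB k r (g \<circ> h) = leadB k r g + leadB k r h"
  unfolding leadB_def by (subst coef_add[symmetric]) (rule coef_cong, rule Bf_comp)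

lemma leadA_inv: "g \<in> NK k \<Longrightarrow> leadA k r (finv g) = leadA k r g"
  unfolding leadA_def by (rule coef_cong, rule Af_inv)

lemma leadB_inv: "g \<in> NK k \<Longrightarrow> leadB k r (finv g) = leadB k r g"
  unfolding leadB_def by (rule coef_cong, rule Bf_inv)

subsection \<open>The series\<close>

text \<open>Every n > 2 is \<open>2 ^ Suc k + 1 + r\<close> for exactly one pair with
  \<open>r < 2 ^ Suc k\<close>; quantifying over all such pairs avoids a logarithm.\<close>

definition series :: "nat \<Rightarrow> (word \<Rightarrow> word) set" where
  "series n = (if n \<le> 1 then GC else if n = 2 then M2
     else {g. \<forall>k r. r < 2 ^ Suc k \<longrightarrow> n = 2 ^ Suc k + 1 + r \<longrightarrow> g \<in> MM k r})"

lemma dyadic_unique: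
  assumes "2 ^ k + r = 2 ^ k' + (r' :: nat)" "r < 2 ^ k" "r' < 2 ^ k'" shows "k = k'" "r = r'"
proof -
  have "\<not> k < k'" if "2 ^ k + r = 2 ^ k' + (r' :: nat)" "r < 2 ^ k" for k k' r r'
  proof
    assume "k < k'"
    then have "(2::nat) ^ Suc k \<le> 2 ^ k'" by (intro power_increasing) auto
    with that show False by simp
  qed
  from this[OF assms(1,2)] this[OF assms(1)[symmetric] assms(3)] show "k = k'" by simp
  with assms show "r = r'" by simp
qed

text \<open>For \<open>r = 2 ^ Suc k\<close> the index starts the next block, and
  \<open>MM_top\<close> identifies the two descriptions.\<close>

lemma series_eq:
  assumes "r \<le> 2 ^ Suc k" shows "series (2 ^ Suc k + 1 + r) = MM k r"
proof -
  have 1: "series (2 ^ Suc k + 1 + r) = MM k r" if r: "r < 2 ^ Suc k" for k r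
  proof -
    have "k' = k \<and> r' = r" if "r' < 2 ^ Suc k'" "2 ^ Suc k + 1 + r = 2 ^ Suc k' + 1 + r'" for k' r'
      using dyadic_unique[of "Suc k" r "Suc k'" r'] r that by simp
    moreover have "(2::nat) \<le> 2 ^ Suc k" by simp
    then have "\<not> 2 ^ Suc k + 1 + r \<le> 1" "2 ^ Suc k + 1 + r \<noteq> 2" by linarith+
    ultimately show ?thesis unfolding series_def using r by auto
  qed
  show ?thesis
  proof (cases "r = 2 ^ Suc k")
    case True
    then have "2 ^ Suc k + 1 + r = 2 ^ Suc (Suc k) + 1 + 0" by simp
    then show ?thesis using 1[of 0 "Suc k"] MM_top[of k] True by (simp only: MM_0) simp
  qed (use 1 assms in simp)
qed

lemma series_small: "series 0 = GC" "series 1 = GC" "series (Suc 0) = GC" "series 2 = M2"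
  by (simp_all add: series_def)

lemma series_cases:
  fixes n :: nat
  obtains "n = 0" | "n = 1" | "n = 2" | k r where "n = 2 ^ Suc k + 1 + r" "r < 2 ^ Suc k"
proof (cases "n \<le> 2")
  case True
  then have "n = 0 \<or> n = 1 \<or> n = 2" by linarith
  then show ?thesis using that by blast
next
  case False
  then have "1 \<le> n - 1" by simp
  then obtain j where j: "2 ^ j \<le> n - 1" "n - 1 < 2 ^ (j + 1)" using ex_power_ivl1[OF order.refl] by blast
  have "j \<noteq> 0" using j False by (cases j) auto
  then obtain k where "j = Suc k" by (cases j) auto
  then show ?thesis using that(4)[where k = k and r = "n - 1 - 2 ^ j"] j False by simp
qed

lemma series_normal: "series n \<lhd> GG"
proof (cases n rule: series_cases)
  case (4 k r) then show ?thesis using MM_normal series_eq[of r k] by simp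
qed (simp_all add: series_def M2_normal GG.normal_carrier)

lemma series_Suc: "series (Suc n) \<subseteq> series n"
proof (cases n rule: series_cases)
  case 3
  have "series (Suc 2) = MM 0 0" using series_eq[of 0 0] by simp
  then show ?thesis using 3 LL_M2 by (simp add: series_small MM_0)
next
  case (4 k r)
  have "Suc n = 2 ^ Suc k + 1 + Suc r" using 4 by simp
  then show ?thesis using 4 series_eq[of r k] series_eq[of "Suc r" k] MM_Suc by simp
qed (auto simp: series_def M2_GC)

lemma series_cmt:
  assumes g: "g \<in> GC" and h: "h \<in> series n" shows "GG.cmt g h \<in> series (Suc n)"
proof (cases n rule: series_cases)
  case 1 then show ?thesis using g h by (simp add: series_small inv_GG)
next
  case 2
  then have h': "h \<in> GC" using h by (simp add: series_small)
  have "GG.cmt g h \<in> M2" using g h' by (simp add: M2_def GC_tree_aut inv_GG add_ac)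
  then show ?thesis using 2 by (simp add: series_def)
next
  case 3
  then have h': "h \<in> M2" using h by (simp add: series_small)
  have eq: "GG.cmt g h = (g \<circ> h \<circ> finv g) \<circ> finv h" using g M2_GC[OF h'] by (simp add: inv_GG)
  have "(g \<circ> h \<circ> finv g) \<circ> finv h \<in> LL"
    using M2_conj[OF g h'] normal_GG_inv[OF M2_normal h'] normal_GG_comp[OF M2_normal]
    by (simp add: LL_def kap_comp mu_comp kap_conj[OF g h'] mu_conj[OF g h'] kap_inv[OF h'] mu_inv[OF h'])
  moreover have "series (Suc 2) = LL" using series_eq[of 0 0] MM_0[of 0] by simp
  ultimately show ?thesis using 3 eq by simp
next
  case (4 k r)
  have "Suc n = 2 ^ Suc k + 1 + Suc r" using 4 by simp
  then show ?thesis using 4 series_eq[of r k] series_eq[of "Suc r" k] MM_cmt[OF g, of h k r] h by simp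
qed

lemma series_square:
  assumes g: "g \<in> series n" shows "g \<circ> g \<in> series (2 * n)"
proof (cases n rule: series_cases)
  case 1 then show ?thesis using g by (simp add: series_small)
next
  case 2
  then have "g \<in> GC" using g by (simp add: series_small)
  then have "g \<circ> g \<in> M2" by (simp add: M2_def GC_tree_aut)
  then show ?thesis using 2 by (simp add: series_def)
next
  case 3
  then have "g \<in> M2" using g by (simp add: series_small)
  moreover have "series 4 = MM 0 1" using series_eq[of 1 0] by simp
  ultimately show ?thesis using 3 M2_square_MM by simp
next
  case (4 k r)
  have eq: "2 * n = 2 ^ Suc (Suc k) + 1 + (2 * r + 1)" using 4 by simp
  have "2 * r + 1 \<le> 2 ^ Suc (Suc k)" using 4 by simp
  from series_eq[OF this] show ?thesis unfolding eq
    using 4 series_eq[of r k] MM_square[of g k r] g by simp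
qed

lemma series_antimono: "m \<le> n \<Longrightarrow> series n \<subseteq> series m"
  by (rule lift_Suc_antimono_le[of series, OF series_Suc])

subsection \<open>Generation\<close>

definition gens_of :: "nat \<Rightarrow> (word \<Rightarrow> word) set" where
  "gens_of n = {GG.cmt g h | g h. g \<in> GC \<and> h \<in> series (n - 1)} \<union> {h \<otimes>\<^bsub>GG\<^esub> h | h. h \<in> series ((n + 1) div 2)}"

definition PP :: "nat \<Rightarrow> (word \<Rightarrow> word) set" where "PP n = generate GG (gens_of n)"

lemma series_GC: "series n \<subseteq> GC"
  using normal_GG_mem[OF series_normal] by blast

lemma gens_of_subset:
  assumes "1 \<le> n" shows "gens_of n \<subseteq> series n"
proof -
  have "GG.cmt g h \<in> series n" if "g \<in> GC" "h \<in> series (n - 1)" for g h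
    using series_cmt[OF that] assms by simp
  moreover have "h \<circ> h \<in> series n" if "h \<in> series ((n + 1) div 2)" for h
  proof -
    have "n \<le> 2 * ((n + 1) div 2)" by linarith
    then show ?thesis using series_square[OF that] series_antimono by blast
  qed
  ultimately show ?thesis unfolding gens_of_def by auto
qed

lemma PP_subset: assumes "1 \<le> n" shows "PP n \<subseteq> series n"
  unfolding PP_def using gens_of_subset[OF assms] normal_imp_subgroup[OF series_normal]
  by (rule GG.generate_subgroup_incl)

lemma cmt_PP: "g \<in> GC \<Longrightarrow> h \<in> series (n - 1) \<Longrightarrow> GG.cmt g h \<in> PP n"
  unfolding PP_def gens_of_def by (rule generate.incl) blast

lemma square_PP: "h \<in> series ((n + 1) div 2) \<Longrightarrow> h \<circ> h \<in> PP n"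
  unfolding PP_def gens_of_def by (rule generate.incl) auto

text \<open>g h g^-1 = [g, h] h, and [g, h] is a generator because h also lies in
  \<open>series (n - 1)\<close>.\<close>

lemma PP_normal: assumes n: "1 \<le> n" shows "PP n \<lhd> GG"
proof (rule GG.normal_invI)
  have "gens_of n \<subseteq> GC" using gens_of_subset[OF n] series_GC by blast
  then show sub: "subgroup (PP n) GG" unfolding PP_def by (rule GG.generate_is_subgroup)
  fix g h assume g: "g \<in> carrier GG" and h: "h \<in> PP n"
  have h': "h \<in> GC" "h \<in> series (n - 1)"
    using h PP_subset[OF n] series_GC series_antimono[of "n - 1" n] by auto
  have "GG.cmt g h \<circ> h \<in> PP n" using subgroup.m_closed[OF sub cmt_PP[OF g h'(2)] h] by simp
  moreover have "GG.cmt g h \<circ> h = g \<circ> h \<circ> finv g"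
    using g h' by (simp add: inv_GG comp_assoc inv_comp_left GC_tree_aut)
  ultimately show "g \<otimes>\<^bsub>GG\<^esub> h \<otimes>\<^bsub>GG\<^esub> inv\<^bsub>GG\<^esub> g \<in> PP n" using g by (simp add: inv_GG)
qed

lemma PP_Suc: "PP (Suc n) \<subseteq> PP n"
proof -
  have "series (Suc n - 1) \<subseteq> series (n - 1)" "series ((Suc n + 1) div 2) \<subseteq> series ((n + 1) div 2)"
    by (rule series_antimono, simp)+
  then have "gens_of (Suc n) \<subseteq> gens_of n" unfolding gens_of_def by blast
  then show ?thesis unfolding PP_def by (rule GG.mono_generate)
qed

text \<open>The tuple with x at the vertices where \<open>f\<close> is 1. It realizes any prescribed
  \<open>Af\<close> with \<open>Bf\<close> zero, and its square any prescribed \<open>Bf\<close>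
  with \<open>Af\<close> zero.\<close>

primrec xtuple :: "nat \<Rightarrow> (word \<Rightarrow> bit) \<Rightarrow> word \<Rightarrow> word" where
  "xtuple 0 f = (if f [] = 1 then xx else id)"
| "xtuple (Suc m) f = pair (xtuple m (\<lambda>s. f (0 # s))) (xtuple m (\<lambda>s. f (1 # s)))"

lemma xtuple_KK: "xtuple m f \<in> KK"
  by (induction m arbitrary: f) (auto simp: xx_KK normal_GG_id[OF KK_normal] pair_KK)

lemma sec_xtuple: "length \<sigma> = m \<Longrightarrow> sec (xtuple m f) \<sigma> = (if f \<sigma> = 1 then xx else id)"
proof (induction m arbitrary: f \<sigma>)
  case (Suc m)
  then obtain y \<tau> where "\<sigma> = y # \<tau>" "length \<tau> = m" by (auto simp: length_Suc_conv)
  then show ?case using Suc.IH by (cases y) auto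
qed simp

lemma xtuple_NK: "xtuple (Suc k) f \<in> NK k"
proof (induction k arbitrary: f)
  case 0
  have "xtuple (Suc 0) f \<in> K1" unfolding xtuple.simps(2) K1_def using xtuple_KK by blast
  then show ?case using K1_LL by auto
next
  case (Suc k)
  then show ?case unfolding xtuple.simps(2)[of "Suc k"] pairs_pow.simps(2) by blast
qed

lemma Af_xtuple: "length \<sigma> = Suc k \<Longrightarrow> Af (xtuple (Suc k) f) \<sigma> = f \<sigma>"
  unfolding Af_def by (subst sec_xtuple) simp_all

lemma Bf_xtuple: "length \<sigma> = k \<Longrightarrow> Bf (xtuple (Suc k) f) \<sigma> = 0"
  unfolding Bf_def by (subst sec_xtuple) simp_all

lemma xtuple_MM:
  assumes "deg_lt (Suc k) (2 ^ Suc k - r) f" shows "xtuple (Suc k) f \<in> MM k r"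
proof -
  have "deg_lt k (2 ^ k - r div 2) (Bf (xtuple (Suc k) f)) \<longleftrightarrow> deg_lt k (2 ^ k - r div 2) (\<lambda>_. 0)"
    by (rule deg_lt_cong) (rule Bf_xtuple)
  moreover have "deg_lt (Suc k) e (Af (xtuple (Suc k) f)) \<longleftrightarrow> deg_lt (Suc k) e f" for e
    by (rule deg_lt_cong) (rule Af_xtuple)
  ultimately show ?thesis using assms xtuple_NK by (simp add: MM_def del: deg_lt.simps xtuple.simps power_Suc)
qed

lemma xtuple_series:
  assumes "deg_lt k (2 ^ k - s) f" "s < 2 ^ k" shows "xtuple k f \<in> series (2 ^ k + 1 + s)"
proof (cases k)
  case 0
  then show ?thesis using assms xx_M2 normal_GG_id[OF M2_normal] by (simp add: series_def)
next
  case (Suc k')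
  then show ?thesis using assms xtuple_MM[of k' s f] series_eq[of s k'] by simp
qed

lemma xtuple_square:
  fixes k f
  defines "h \<equiv> xtuple k f"
  shows "h \<circ> h \<in> NK k" "length \<sigma> = Suc k \<Longrightarrow> Af (h \<circ> h) \<sigma> = 0" "length \<rho> = k \<Longrightarrow> Bf (h \<circ> h) \<rho> = f \<rho>"
proof -
  have "h \<circ> h \<in> NK k \<and> (\<forall>\<sigma>. length \<sigma> = Suc k \<longrightarrow> Af (h \<circ> h) \<sigma> = 0) \<and> (\<forall>\<rho>. length \<rho> = k \<longrightarrow> Bf (h \<circ> h) \<rho> = f \<rho>)"
  proof (cases k)
    case 0
    have h: "h \<in> M2" "mu h = 0" "kap h = f []"
      using xx_M2 normal_GG_id[OF M2_normal] by (auto simp: h_def 0)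
    then show ?thesis using M2_square_LL[OF h(1)] M2_square_sec1[OF h(1)]
      by (auto simp: 0 Af_def Bf_def length_Suc_conv)
  next
    case (Suc k')
    have h: "h \<in> NK k'" unfolding h_def Suc by (rule xtuple_NK)
    show ?thesis unfolding Suc
    proof (intro conjI allI impI NK_square[OF h])
      fix \<sigma> :: word assume l: "length \<sigma> = Suc (Suc k')"
      have "Bf h (butlast (butlast \<sigma>)) = 0" unfolding h_def Suc by (rule Bf_xtuple) (use l in simp)
      then show "Af (h \<circ> h) \<sigma> = 0" using Af_square[OF h l] by simp
    next
      fix \<rho> :: word assume l: "length \<rho> = Suc k'"
      have "Bf h (butlast \<rho>) = 0" unfolding h_def Suc by (rule Bf_xtuple) (use l in simp)
      moreover have "Af h \<rho> = f \<rho>" unfolding h_def Suc by (rule Af_xtuple) (use l in simp)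
      ultimately show "Bf (h \<circ> h) \<rho> = f \<rho>" using Bf_square[OF h l] by simp
    qed
  qed
  then show "h \<circ> h \<in> NK k" "length \<sigma> = Suc k \<Longrightarrow> Af (h \<circ> h) \<sigma> = 0" "length \<rho> = k \<Longrightarrow> Bf (h \<circ> h) \<rho> = f \<rho>"
    by auto
qed

lemma xtuple_square_MM:
  assumes f: "deg_lt k (2 ^ k - r div 2) f"
  shows "xtuple k f \<circ> xtuple k f \<in> MM k r" "leadA k j (xtuple k f \<circ> xtuple k f) = 0"
    "leadB k j (xtuple k f \<circ> xtuple k f) = coef k (2 ^ k - 1 - j div 2) f"
proof -
  note sq = xtuple_square[where k = k and f = f]
  have "deg_lt (Suc k) e (Af (xtuple k f \<circ> xtuple k f)) \<longleftrightarrow> deg_lt (Suc k) e (\<lambda>_. 0)" for e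
    by (rule deg_lt_cong) (rule sq(2))
  moreover have "deg_lt k e (Bf (xtuple k f \<circ> xtuple k f)) \<longleftrightarrow> deg_lt k e f" for e
    by (rule deg_lt_cong) (rule sq(3))
  ultimately show "xtuple k f \<circ> xtuple k f \<in> MM k r"
    using f sq(1) by (simp add: MM_def del: deg_lt.simps power_Suc)
  show "leadA k j (xtuple k f \<circ> xtuple k f) = 0"
    unfolding leadA_def by (subst coef_cong[where f' = "\<lambda>_. 0"]) (use sq(2) in \<open>simp_all del: coef.simps\<close>)
  show "leadB k j (xtuple k f \<circ> xtuple k f) = coef k (2 ^ k - 1 - j div 2) f"
    unfolding leadB_def by (rule coef_cong) (rule sq(3))
qed

text \<open>The tuple of \<open>vfun\<close> at r - 1 has degree exactly
  \<open>2 ^ Suc k - r\<close>, which lies strictly between 0 and \<open>2 ^ Suc k\<close>, so some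
  generator lowers it by exactly one. Its B part is zero and stays so.\<close>

lemma exists_leadA:
  assumes r: "1 \<le> r" "r < 2 ^ Suc k"
  shows "\<exists>p\<in>PP (2 ^ Suc k + 1 + r). p \<in> MM k r \<and> leadA k r p = 1 \<and> leadB k j p = 0"
proof -
  let ?m = "Suc k" and ?e = "2 ^ Suc k - r"
  have e: "0 < ?e" "?e < 2 ^ ?m" using r by auto
  obtain h where h: "h \<in> {gen_a, gen_b, gen_c, gen_d}"
    "\<And>f. deg_lt ?m (Suc ?e) f \<Longrightarrow> coef ?m (?e - 1) (wdiff h f) = coef ?m ?e f"
    using coef_diff_generator[OF e] by blast
  have h': "h \<in> GC" "finv h = h" using h(1) by auto
  define f where "f = vfun ?m (r - 1)"
  have f: "deg_lt ?m (2 ^ ?m - (r - 1)) f" "coef ?m (2 ^ ?m - 1 - (r - 1)) f = 1"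
    unfolding f_def using deg_lt_vfun[of "r - 1" ?m] r by auto
  define y where "y = xtuple ?m f"
  have y: "y \<in> MM k (r - 1)" unfolding y_def by (rule xtuple_MM) (rule f)
  have eqs: "2 ^ ?m - (r - 1) = Suc ?e" "2 ^ ?m - 1 - (r - 1) = ?e" "?e - 1 = 2 ^ ?m - 1 - r" using r by auto
  let ?p = "GG.cmt h y"
  have "?p \<in> MM k (Suc (r - 1))" using MM_cmt[OF h'(1) y] .
  then have "?p \<in> MM k r" using r by simp
  moreover have "y \<in> series (2 ^ Suc k + 1 + r - 1)"
    using y series_eq[of "r - 1" k] r by simp
  then have "?p \<in> PP (2 ^ Suc k + 1 + r)" using h'(1) cmt_PP by blast
  moreover have "leadA k r ?p = coef ?m (?e - 1) (wdiff h f)"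
    unfolding leadA_def eqs(3)
  proof (rule coef_cong)
    fix s :: word assume s: "length s = Suc k"
    have l: "length (h s) = Suc k" using s GC_tree_aut[OF h'(1)] by simp
    show "Af ?p s = wdiff h f s"
      unfolding Af_cmt[OF h'(1) MM_NK[OF y] s] unfolding h'(2) wdiff_def y_def Af_xtuple[OF s] Af_xtuple[OF l] ..
  qed
  then have "leadA k r ?p = 1" using h(2)[of f] f unfolding eqs(1,2) by simp
  moreover have "leadB k j ?p = coef k (2 ^ k - 1 - j div 2) (\<lambda>_. 0)" for j
    unfolding leadB_def
  proof (rule coef_cong)
    fix s :: word assume s: "length s = k"
    have l: "length (h s) = k" using s GC_tree_aut[OF h'(1)] by simp
    show "Bf ?p s = 0"
      unfolding Bf_cmt[OF h'(1) MM_NK[OF y] s] unfolding h'(2) wdiff_def y_def Bf_xtuple[OF s] Bf_xtuple[OF l] by simp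
  qed
  ultimately show ?thesis by (intro bexI[of _ ?p]) simp_all
qed

text \<open>An odd remainder is \<open>2 * s + 1\<close>, and half the index is
  \<open>2 ^ k + 1 + s\<close>, which belongs to the previous level of the tree; the square of a
  tuple there has the wanted leading B coefficient and no A part.\<close>

lemma exists_leadB:
  assumes r: "odd r" "r < 2 ^ Suc k"
  shows "\<exists>p\<in>PP (2 ^ Suc k + 1 + r). p \<in> MM k r \<and> leadA k r p = 0 \<and> leadB k r p = 1"
proof -
  obtain s where s: "r = 2 * s + 1" using r(1) oddE by blast
  have lt: "s < 2 ^ k" using r s by simp
  define f where "f = vfun k s"
  have f: "deg_lt k (2 ^ k - s) f" "coef k (2 ^ k - 1 - s) f = 1" unfolding f_def using deg_lt_vfun[OF lt] by auto
  have "xtuple k f \<in> series (2 ^ k + 1 + s)" using xtuple_series[OF f(1) lt] .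
  moreover have "(2 ^ Suc k + 1 + r + 1) div 2 = 2 ^ k + 1 + s" using s by simp
  ultimately have "xtuple k f \<circ> xtuple k f \<in> PP (2 ^ Suc k + 1 + r)" using square_PP by metis
  then show ?thesis using xtuple_square_MM[of k r f] f s by (intro bexI) auto
qed

text \<open>The leading A coefficient is removed first; the correction of the B coefficient has
  \<open>leadA\<close> zero and does not bring it back.\<close>

lemma MM_step:
  assumes r: "1 \<le> r" "r < 2 ^ Suc k" and g: "g \<in> MM k r"
  shows "\<exists>p\<in>PP (2 ^ Suc k + 1 + r). p \<circ> g \<in> MM k (Suc r)"
proof -
  let ?P = "PP (2 ^ Suc k + 1 + r)"
  have P: "?P \<lhd> GG" by (rule PP_normal) simp
  have red: "\<exists>p\<in>?P. p \<circ> g \<in> MM k r \<and> leadA k r (p \<circ> g) = 0" if "g \<in> MM k r" for g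
  proof (cases "leadA k r g = 0")
    case True then show ?thesis using that normal_GG_id[OF P] by (intro bexI[of _ id]) auto
  next
    case False
    obtain p where p: "p \<in> ?P" "p \<in> MM k r" "leadA k r p = 1" using exists_leadA[OF r] by blast
    then show ?thesis using False that MM_comp[OF p(2) that] leadA_comp[OF MM_NK MM_NK] by (intro bexI[of _ p]) auto
  qed
  obtain p where p: "p \<in> ?P" "p \<circ> g \<in> MM k r" "leadA k r (p \<circ> g) = 0" using red[OF g] by blast
  show ?thesis
  proof (cases "odd r \<longrightarrow> leadB k r (p \<circ> g) = 0")
    case True then show ?thesis using p MM_Suc_iff[OF r(2)] by blast
  next
    case False
    then obtain q where q: "q \<in> ?P" "q \<in> MM k r" "leadA k r q = 0" "leadB k r q = 1" using exists_leadB[of r k] r by blast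
    note n = MM_NK[OF q(2)] MM_NK[OF p(2)]
    have "q \<circ> (p \<circ> g) \<in> MM k (Suc r)"
      unfolding MM_Suc_iff[OF r(2)] using MM_comp[OF q(2) p(2)] leadA_comp[OF n] leadB_comp[OF n] q p False by simp
    then show ?thesis using normal_GG_comp[OF P q(1) p(1)] by (intro bexI[of _ "q \<circ> p"]) (simp_all add: comp_assoc)
  qed
qed

subsection \<open>Normal generation of the level powers\<close>

primrec single :: "word \<Rightarrow> (word \<Rightarrow> word) \<Rightarrow> word \<Rightarrow> word" where
  "single [] h = h"
| "single (y # v) h = (if y = 0 then pair (single v h) id else pair id (single v h))"

lemma single_comp: "single v g \<circ> single v h = single v (g \<circ> h)"
  by (induction v) (auto simp: pair_comp)

lemma single_id [simp]: "single v id = id"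
  by (induction v) auto

lemma single_append: "single (v @ w) h = single v (single w h)"
  by (induction v) auto

lemma single_KK: "h \<in> KK \<Longrightarrow> single v h \<in> KK"
  using normal_GG_id[OF KK_normal] by (induction v) (auto intro: pair_KK)

lemma single_NK: "h \<in> KK \<Longrightarrow> length v = Suc k \<Longrightarrow> single v h \<in> NK k"
proof (induction k arbitrary: v)
  case 0
  then obtain y where v: "v = [y]" by (auto simp: length_Suc_conv)
  have "single v h \<in> K1" using 0 normal_GG_id[OF KK_normal] by (auto simp: v K1_def)
  then show ?case using K1_LL by auto
next
  case (Suc k)
  then obtain y u where v: "v = y # u" "length u = Suc k" by (auto simp: length_Suc_conv)
  then show ?case using Suc.IH[OF Suc.prems(1) v(2)] normal_GG_id[OF NK_normal] by auto
qed

lemma single_series: "h \<in> KK \<Longrightarrow> length v = k \<Longrightarrow> single v h \<in> series (2 ^ k + 1)"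
proof (cases k)
  case 0
  assume "h \<in> KK" "length v = k"
  then show ?thesis using 0 KK_M2 by (auto simp: series_def)
next
  case (Suc k')
  assume "h \<in> KK" "length v = k"
  then show ?thesis using Suc single_NK[of h v k'] series_eq[of 0 k'] by (simp add: MM_0)
qed

lemma pair_id_preimage_normal:
  assumes N: "N \<lhd> GG" shows "{k \<in> GC. pair k id \<in> N} \<lhd> GG"
proof (rule normal_GGI)
  show "id \<in> {k \<in> GC. pair k id \<in> N}" using normal_GG_id[OF N] by simp
next
  fix g h assume "g \<in> {k \<in> GC. pair k id \<in> N}" "h \<in> {k \<in> GC. pair k id \<in> N}"
  then show "g \<circ> h \<in> {k \<in> GC. pair k id \<in> N}" using normal_GG_comp[OF N, of "pair g id" "pair h id"] by (simp add: pair_comp)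
next
  fix g assume "g \<in> {k \<in> GC. pair k id \<in> N}"
  then show "finv g \<in> {k \<in> GC. pair k id \<in> N}" using normal_GG_inv[OF N, of "pair g id"]
    by (simp add: inv_pair GC_tree_aut inv_unique_comp[of id id])
next
  fix g k assume g: "g \<in> GC" and k: "k \<in> {k \<in> GC. pair k id \<in> N}"
  obtain h where h: "h \<in> GC" "pair g h \<in> GC" using pair_section_GC[OF g] by blast
  have "pair g h \<circ> pair k id \<circ> finv (pair g h) \<in> N" using normal_GG_conj[OF N h(2)] k by simp
  then show "g \<circ> k \<circ> finv g \<in> {k \<in> GC. pair k id \<in> N}" using g h k by (simp add: pair_id_conj GC_tree_aut)
qed auto

lemma pair_id_swap: assumes N: "N \<lhd> GG" shows "pair k id \<in> N \<longleftrightarrow> pair id k \<in> N"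
  using normal_GG_conj[OF N gens_GC(1), of "pair k id"] normal_GG_conj[OF N gens_GC(1), of "pair id k"]
  by (auto simp: pair_swap)

text \<open>Normality passes to the preimage of \<open>N\<close> under k \<mapsto> (k, 1), and
  conjugation by a exchanges the coordinates. So one entry at one vertex produces all of
  them.\<close>

lemma pairs_pow_normal_closure:
  assumes "N \<lhd> GG" "w \<in> KK" "single (replicate m 1) w \<in> N"
  shows "pairs_pow (normal_closure GG {w}) m \<subseteq> N"
  using assms
proof (induction m arbitrary: N)
  case 0
  then show ?case using GG.normal_closure_minimal by simp
next
  case (Suc m)
  let ?N = "{k \<in> GC. pair k id \<in> N}"
  have "single (replicate m 1) w \<in> KK" using single_KK[OF Suc.prems(2)] .
  then have "single (replicate m 1) w \<in> ?N"
    using Suc.prems(3) pair_id_swap[OF Suc.prems(1)] normal_GG_mem[OF KK_normal] by simp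
  then have IH: "pairs_pow (normal_closure GG {w}) m \<subseteq> ?N"
    using Suc.IH[OF pair_id_preimage_normal[OF Suc.prems(1)] Suc.prems(2)] by blast
  show ?case
  proof
    fix g assume "g \<in> pairs_pow (normal_closure GG {w}) (Suc m)"
    then obtain g0 g1 where g: "g = pair g0 g1" "g0 \<in> ?N" "g1 \<in> ?N" using IH by auto
    then have "pair g0 id \<circ> pair id g1 \<in> N" using normal_GG_comp[OF Suc.prems(1)] pair_id_swap[OF Suc.prems(1)] by simp
    then show "g \<in> N" using g by (simp add: pair_comp)
  qed
qed

lemma NK_decomp: "g \<in> NK k \<Longrightarrow> \<exists>u\<in>pairs_pow KK (Suc k). \<exists>t\<in>pairs_pow TT k. g = u \<circ> t"
proof (induction k arbitrary: g)
  case 0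
  then have "g \<in> LL" by simp
  then obtain k where k: "k \<in> K1" "g = k \<or> g = k \<circ> xx2" by (rule LL_cases)
  have "k \<in> pairs_pow KK (Suc 0)" using k(1) by (auto simp: K1_def)
  moreover have "id \<in> TT" "xx2 \<in> TT" using normal_GG_id[OF TT_normal] xx2_TT by auto
  ultimately show ?case using k(2) unfolding pairs_pow.simps(1) by (metis comp_id)
next
  case (Suc k)
  then obtain g0 g1 where g: "g = pair g0 g1" "g0 \<in> NK k" "g1 \<in> NK k" by auto
  obtain u0 t0 u1 t1 where ut: "u0 \<in> pairs_pow KK (Suc k)" "t0 \<in> pairs_pow TT k" "g0 = u0 \<circ> t0"
    "u1 \<in> pairs_pow KK (Suc k)" "t1 \<in> pairs_pow TT k" "g1 = u1 \<circ> t1" using Suc.IH g by blast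
  then have "g = pair u0 u1 \<circ> pair t0 t1" using g by (simp add: pair_comp)
  moreover have "pair u0 u1 \<in> pairs_pow KK (Suc (Suc k))" using ut unfolding pairs_pow.simps(2)[of KK "Suc k"] by blast
  moreover have "pair t0 t1 \<in> pairs_pow TT (Suc k)" using ut by auto
  ultimately show ?case by blast
qed

text \<open>The generator \<open>g\<close> is the one whose section at \<open>1\<^sup>k\<close> is \<open>d\<close>; the factor with \<open>w\<close> is a square.\<close>

lemma cmt_const_tuple:
  defines "y \<equiv> \<lambda>k. xtuple k (\<lambda>_. 1)"
  shows "\<exists>g\<in>{gen_b, gen_c, gen_d}. \<exists>w\<in>{id, xinv \<circ> xinv}.
    g \<circ> y (Suc k) \<circ> g \<circ> finv (y (Suc k)) = single (replicate k 1 @ [0]) w \<circ> single (replicate (Suc k) 1) (pair id xinv)"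
proof (induction k)
  case 0
  have y: "y (Suc 0) = pair xx xx" by (simp add: y_def)
  have "gen_c \<circ> pair xx xx \<circ> gen_c \<circ> finv (pair xx xx) = pair (gen_a \<circ> xx \<circ> gen_a \<circ> xinv) (gen_d \<circ> xx \<circ> gen_d \<circ> xinv)"
    unfolding gen_eq_pair(2) by (simp add: inv_pair GC_tree_aut pair_comp inv_xx)
  also have "gen_a \<circ> xx \<circ> gen_a \<circ> xinv = xinv \<circ> xinv"
    unfolding xinv_def xx_eq by (simp add: fun_eq_iff comp_apply)
  also have "gen_d \<circ> xx \<circ> gen_d \<circ> xinv = pair id xinv" by (rule cmt_d_xx)
  also have "pair (xinv \<circ> xinv) (pair id xinv) = single (replicate 0 1 @ [0]) (xinv \<circ> xinv) \<circ> single (replicate (Suc 0) 1) (pair id xinv)"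
    by (simp add: pair_comp)
  finally show ?case unfolding y by blast
next
  case (Suc k)
  then obtain g w where gw: "g \<in> {gen_b, gen_c, gen_d}" "w \<in> {id, xinv \<circ> xinv}"
    "g \<circ> y (Suc k) \<circ> g \<circ> finv (y (Suc k)) = single (replicate k 1 @ [0]) w \<circ> single (replicate (Suc k) 1) (pair id xinv)" by blast
  have yt: "y j \<in> tree_aut" for j unfolding y_def using xtuple_KK normal_tree_aut[OF KK_normal] by blast
  have y: "y (Suc j) = pair (y j) (y j)" for j by (simp add: y_def)
  have a: "gen_a \<circ> y (Suc k) \<circ> gen_a \<circ> finv (y (Suc k)) = id"
    unfolding y[of k] pair_swap by (rule inv_comp_right) (simp add: yt)
  obtain h s where h: "h \<in> {gen_b, gen_c, gen_d}" "h = pair s g" "s = id \<or> s = gen_a"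
  proof -
    consider "g = gen_b" | "g = gen_c" | "g = gen_d" using gw(1) by blast
    then show ?thesis
      by cases (use that[of gen_d id] that[of gen_b gen_a] that[of gen_c gen_a] gen_eq_pair in simp_all)
  qed
  have "s \<circ> y (Suc k) \<circ> s \<circ> finv (y (Suc k)) = id" using h(3) a inv_comp_right[OF yt] by auto
  then have "h \<circ> y (Suc (Suc k)) \<circ> h \<circ> finv (y (Suc (Suc k))) = pair id (single (replicate k 1 @ [0]) w \<circ> single (replicate (Suc k) 1) (pair id xinv))"
    unfolding y[of "Suc k"] h(2) inv_pair[OF yt yt] pair_comp gw(3) by simp
  also have "\<dots> = single (replicate (Suc k) 1 @ [0]) w \<circ> single (replicate (Suc (Suc k)) 1) (pair id xinv)"
    by (simp add: pair_comp)
  finally show ?case using h(1) gw(2) by blast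
qed

text \<open>The tuple with x at all vertices of level k comes from a constant function, so it lies
  in the term of index \<open>2 ^ Suc k\<close>, the last one before this index. Its commutator in
  \<open>cmt_const_tuple\<close> is x^-1 at the vertex 1^(k+1), up to a square that lies in the
  subgroup as well.\<close>

lemma single_xx_PP: "single (replicate (Suc k) 1) xx \<in> PP (2 ^ Suc k + 1)"
proof -
  let ?n = "2 ^ Suc k + 1 :: nat"
  have P: "PP ?n \<lhd> GG" by (rule PP_normal) simp
  have y: "xtuple k (\<lambda>_. 1) \<in> series (?n - 1)"
  proof -
    obtain t where "(2::nat) ^ k = Suc t" by (cases "(2::nat) ^ k") auto
    then have "2 ^ k - (2 ^ k - 1) = Suc 0" "2 ^ k + 1 + (2 ^ k - 1) = ?n - 1" by simp_all
    then show ?thesis using xtuple_series[of k "2 ^ k - 1" "\<lambda>_. 1"] deg_lt_const[of k 1] by (simp add: mult_2)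
  qed
  have yGC: "xtuple k (\<lambda>_. 1) \<in> GC" using y series_GC by blast
  have cmt: "g \<circ> xtuple k (\<lambda>_. 1) \<circ> g \<circ> finv (xtuple k (\<lambda>_. 1)) \<in> PP ?n" if "g \<in> {gen_b, gen_c, gen_d}" for g
    using cmt_PP[OF _ y, of g] that yGC by (auto simp: inv_GG)
  have half: "(?n + 1) div 2 = 2 ^ k + 1" by simp
  have sq: "single v (xinv \<circ> xinv) \<in> PP ?n" if "length v = k" for v
    using square_PP[of "single v xinv" ?n] single_series[OF inv_KK_xinv that] half by (simp add: single_comp)
  have "single (replicate k 1) (pair id xinv) \<in> PP ?n"
  proof (cases k)
    case 0
    then show ?thesis using cmt[of gen_d] cmt_d_xx by (simp add: inv_xx)
  next
    case (Suc k')
    obtain g w where gw: "g \<in> {gen_b, gen_c, gen_d}" "w \<in> {id, xinv \<circ> xinv}"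
      "g \<circ> xtuple k (\<lambda>_. 1) \<circ> g \<circ> finv (xtuple k (\<lambda>_. 1)) = single (replicate k' 1 @ [0]) w \<circ> single (replicate k 1) (pair id xinv)"
      using cmt_const_tuple[of k'] unfolding Suc by blast
    let ?s = "single (replicate k' 1 @ [0])" and ?t = "single (replicate k 1) (pair id xinv)"
    have s: "?s w \<in> PP ?n" using gw(2) sq[of "replicate k' 1 @ [0]"] Suc normal_GG_id[OF P] by auto
    have t: "?s w \<in> tree_aut" using s normal_tree_aut[OF P] by blast
    have "finv (?s w) \<circ> (?s w \<circ> ?t) \<in> PP ?n"
      using normal_GG_comp[OF P normal_GG_inv[OF P s]] cmt[OF gw(1)] gw(3) by simp
    then show ?thesis using inv_comp_left[OF t] by (simp flip: comp_assoc)
  qed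
  moreover have "single (replicate k 1) (pair id xinv) = single (replicate (Suc k) 1) xinv"
    using single_append[of "replicate k 1" "[1]" xinv] by (simp add: replicate_append_same)
  ultimately have "finv (single (replicate (Suc k) 1) xinv) \<in> PP ?n" using normal_GG_inv[OF P] by simp
  moreover have "finv (single (replicate (Suc k) 1) xinv) = single (replicate (Suc k) 1) xx"
    by (rule inv_unique_comp) (simp_all only: single_comp xx_xinv single_id)
  ultimately show ?thesis by simp
qed

lemma single_xx2_PP: "single (replicate k 1) xx2 \<in> PP (2 ^ Suc k + 1)"
proof -
  have "(2 ^ Suc k + 1 + 1) div 2 = (2::nat) ^ k + 1" by simp
  then show ?thesis using square_PP[of "single (replicate k 1) xx" "2 ^ Suc k + 1"] single_series[OF xx_KK, of "replicate k 1" k]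
    by (simp add: single_comp)
qed

lemma NK_PP: "NK k \<subseteq> PP (2 ^ Suc k + 1)"
proof
  let ?n = "2 ^ Suc k + 1 :: nat"
  have P: "PP ?n \<lhd> GG" by (rule PP_normal) simp
  have "pairs_pow KK (Suc k) \<subseteq> PP ?n"
    unfolding KK_def by (rule pairs_pow_normal_closure[OF P xx_KK single_xx_PP])
  moreover have "pairs_pow TT k \<subseteq> PP ?n"
    unfolding TT_def GG_simps using xx_KK normal_GG_comp[OF KK_normal]
    by (intro pairs_pow_normal_closure[OF P _ single_xx2_PP]) auto
  moreover fix g assume "g \<in> NK k"
  ultimately show "g \<in> PP ?n" using NK_decomp normal_GG_comp[OF P] by blast
qed

text \<open>Induction from the end of the block down, starting with \<open>NK_PP\<close> for the
  next level; \<open>MM_step\<close> moves an element into the next term modulo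
  \<open>PP\<close>.\<close>

lemma MM_PP: "1 \<le> r \<Longrightarrow> r \<le> 2 ^ Suc k \<Longrightarrow> MM k r \<subseteq> PP (2 ^ Suc k + 1 + r)"
proof (induction "2 ^ Suc k - r" arbitrary: r)
  case 0
  then have "r = 2 ^ Suc k" by simp
  moreover from this have "2 ^ Suc k + 1 + r = 2 ^ Suc (Suc k) + 1" by simp
  ultimately show ?case using MM_top[of k] NK_PP[of "Suc k"] by simp
next
  case (Suc d)
  let ?n = "2 ^ Suc k + 1 + r"
  have P: "PP ?n \<lhd> GG" by (rule PP_normal) simp
  have r: "r < 2 ^ Suc k" using Suc(2) by simp
  have IH: "MM k (Suc r) \<subseteq> PP (2 ^ Suc k + 1 + Suc r)" using Suc(1)[of "Suc r"] Suc(2) r by simp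
  then have IH: "MM k (Suc r) \<subseteq> PP ?n" using PP_Suc[of ?n] by simp
  show ?case
  proof
    fix g assume g: "g \<in> MM k r"
    obtain p where p: "p \<in> PP ?n" "p \<circ> g \<in> MM k (Suc r)" using MM_step[OF Suc(3) r g] by blast
    have "finv p \<circ> (p \<circ> g) \<in> PP ?n" using normal_GG_comp[OF P normal_GG_inv[OF P p(1)]] p(2) IH by blast
    moreover have "p \<in> tree_aut" using p(1) normal_tree_aut[OF P] by blast
    ultimately show "g \<in> PP ?n" using inv_comp_left by (simp flip: comp_assoc)
  qed
qed

lemma series_PP: assumes "2 \<le> n" shows "series n \<subseteq> PP n"
proof (cases n rule: series_cases)
  case 3
  have P: "PP 2 \<lhd> GG" by (rule PP_normal) simp
  have "LL \<subseteq> PP 3" using NK_PP[of 0] by simp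
  then have LL: "LL \<subseteq> PP 2" using PP_Suc[of 2] by (simp add: numeral_3_eq_3 numeral_2_eq_2)
  \<comment> \<open>These commutators are x and z, which together with N_1 generate the second
    term.\<close>
  have "GG.cmt gen_a gen_b \<in> PP 2" "GG.cmt gen_a gen_d \<in> PP 2" by (rule cmt_PP; simp add: series_small)+
  then have "xx \<in> PP 2" "zz \<in> PP 2" by (simp_all add: inv_GG xx_eq zz_def)
  then have "M2 \<subseteq> PP 2" using LL normal_GG_comp[OF P] by (auto elim!: M2_cases)
  then show ?thesis using 3 by (simp add: series_small)
next
  case (4 k r)
  show ?thesis
  proof (cases "r = 0")
    case True then show ?thesis using 4 NK_PP[of k] series_eq[of 0 k] by (simp add: MM_0)
  next
    case False then show ?thesis using 4 MM_PP[of r k] series_eq[of r k] by simp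
  qed
qed (use assms in auto)

section \<open>Finiteness of the layers\<close>

lemma finite_bit: "finite (A :: bit set)"
  by (rule finite_subset[of _ "{0, 1}"]) (auto simp: bit_not_one_iff)

lemma finite_bit_pair: "finite (A :: (bit \<times> bit) set)" and finite_bit_triple: "finite (B :: (bit \<times> bit \<times> bit) set)"
  by (rule finite_subset[OF subset_UNIV], simp add: finite_bit flip: UNIV_Times_UNIV)+

text \<open>Representatives are taken for the finitely many values of \<phi>; equal values mean
  equal cosets of \<open>N\<close>.\<close>

lemma finite_generators:
  assumes N: "N \<lhd> GG" "M \<lhd> GG" and fin: "finite (\<phi> ` M)" and \<phi>: "\<And>g h. g \<in> M \<Longrightarrow> h \<in> M \<Longrightarrow> \<phi> g = \<phi> h \<Longrightarrow> g \<circ> finv h \<in> N"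
  shows "\<exists>T. finite T \<and> T \<subseteq> M \<and> M \<subseteq> generate GG (N \<union> T)"
proof -
  define rep where "rep v = (SOME g. g \<in> M \<and> \<phi> g = v)" for v
  have rep: "rep (\<phi> g) \<in> M \<and> \<phi> (rep (\<phi> g)) = \<phi> g" if "g \<in> M" for g
    unfolding rep_def by (rule someI[of _ g]) (use that in simp)
  let ?T = "rep ` (\<phi> ` M)"
  have "g \<in> generate GG (N \<union> ?T)" if g: "g \<in> M" for g
  proof -
    have r: "rep (\<phi> g) \<in> M" "rep (\<phi> g) \<in> ?T" using rep[OF g] g by auto
    have "g \<circ> finv (rep (\<phi> g)) \<in> N" using \<phi>[OF g r(1)] rep[OF g] by simp
    then have "(g \<circ> finv (rep (\<phi> g))) \<otimes>\<^bsub>GG\<^esub> rep (\<phi> g) \<in> generate GG (N \<union> ?T)"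
      using r(2) by (intro generate.eng) (auto intro: generate.incl)
    moreover have "rep (\<phi> g) \<in> tree_aut" using r(1) normal_tree_aut[OF N(2)] by blast
    ultimately show ?thesis by (simp add: comp_assoc inv_comp_left)
  qed
  moreover have "finite ?T" using fin by (rule finite_imageI)
  moreover have "?T \<subseteq> M" using rep by auto
  ultimately show ?thesis by (intro exI[of _ ?T]) blast
qed

lemma series_finite: "\<exists>T. finite T \<and> T \<subseteq> series n \<and> series n \<subseteq> generate GG (series (Suc n) \<union> T)"
proof (cases n rule: series_cases)
  case 1
  have "GC \<subseteq> generate GG (GC \<union> {})" by (auto intro: generate.incl)
  then show ?thesis using 1 by (intro exI[of _ "{}"]) (simp add: series_small)
next
  case 2
  have "\<exists>T. finite T \<and> T \<subseteq> GC \<and> GC \<subseteq> generate GG (M2 \<union> T)"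
    by (rule finite_generators[where \<phi> = "\<lambda>g. (par 0 g, par 1 g, par 2 g)", OF M2_normal GG.normal_carrier finite_bit_triple])
       (auto simp: M2_def GC_tree_aut)
  then show ?thesis using 2 by (simp add: series_def)
next
  case 3
  have "\<exists>T. finite T \<and> T \<subseteq> M2 \<and> M2 \<subseteq> generate GG (LL \<union> T)"
    by (rule finite_generators[where \<phi> = "\<lambda>g. (kap g, mu g)", OF LL_normal M2_normal finite_bit_pair])
       (auto simp: LL_def kap_comp mu_comp kap_inv mu_inv normal_GG_inv[OF M2_normal] normal_GG_comp[OF M2_normal])
  moreover have "series (Suc 2) = LL" using series_eq[of 0 0] MM_0[of 0] by simp
  ultimately show ?thesis using 3 by (simp add: series_small)
next
  case (4 k r)
  have "\<exists>T. finite T \<and> T \<subseteq> MM k r \<and> MM k r \<subseteq> generate GG (MM k (Suc r) \<union> T)"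
  proof (rule finite_generators[where \<phi> = "\<lambda>g. (leadA k r g, leadB k r g)", OF MM_normal MM_normal finite_bit_pair])
    fix g h assume gh: "g \<in> MM k r" "h \<in> MM k r" and eq: "(leadA k r g, leadB k r g) = (leadA k r h, leadB k r h)"
    have n: "g \<in> NK k" "finv h \<in> NK k" "h \<in> NK k" using gh MM_inv MM_NK by blast+
    show "g \<circ> finv h \<in> MM k (Suc r)"
      unfolding MM_Suc_iff[OF 4(2)] leadA_comp[OF n(1,2)] leadB_comp[OF n(1,2)] leadA_inv[OF n(3)] leadB_inv[OF n(3)]
      using MM_comp[OF gh(1) MM_inv[OF gh(2)]] eq by simp
  qed
  moreover have "series n = MM k r" "series (Suc n) = MM k (Suc r)"
    using series_eq[of r k] series_eq[of "Suc r" k] 4 by simp_all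
  ultimately show ?thesis by simp
qed

lemma restricted_series_GG: "restricted_series GG series"
proof (intro restricted_series.intro restricted_series_axioms.intro group_GG)
  show "series 1 = GC" by (rule series_small)
  show "series n \<subseteq> generate GG ({GG.cmt g h |g h. g \<in> GC \<and> h \<in> series (n - 1)} \<union> {h \<otimes>\<^bsub>GG\<^esub> h |h. h \<in> series ((n + 1) div 2)})" if "2 \<le> n" for n
    using series_PP[OF that] unfolding PP_def gens_of_def .
qed (use series_normal series_Suc series_cmt series_square series_finite in auto)

lemma dimension_subgroup_GG: "1 \<le> n \<Longrightarrow> dimension_subgroup GG n = series n"
  by (rule restricted_series.dimension_subgroup_eq[OF restricted_series_GG])

subsection \<open>Ranks of elementary abelian 2-groups\<close>

locale elementary_2_group = comm_group +
  assumes square: "x \<in> carrier G \<Longrightarrow> x \<otimes> x = \<one>"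

lemma elementary_2_group_iso:
  assumes "group G" "elementary_2_group H" "G \<cong> H"
  shows "elementary_2_group G"
proof -
  interpret G: group G by fact
  interpret H: elementary_2_group H by fact
  obtain f where f: "f \<in> iso G H" using assms(3) unfolding is_iso_def by blast
  then have hom: "f \<in> hom G H" and inj: "inj_on f (carrier G)" by (auto simp: iso_def bij_betw_def)
  interpret group_hom G H f by unfold_locales (rule hom)
  show ?thesis
  proof (intro elementary_2_group.intro elementary_2_group_axioms.intro G.group_comm_groupI)
    fix x y assume "x \<in> carrier G" "y \<in> carrier G"
    then show "x \<otimes>\<^bsub>G\<^esub> y = y \<otimes>\<^bsub>G\<^esub> x" using H.m_comm by (intro inj_onD[OF inj]) auto
  next
    fix x assume "x \<in> carrier G"
    then show "x \<otimes>\<^bsub>G\<^esub> x = \<one>\<^bsub>G\<^esub>" using H.square by (intro inj_onD[OF inj]) auto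
  qed
qed

lemma elementary_2_group_add_bit: "elementary_2_group (add_monoid F2)"
  by (intro elementary_2_group.intro elementary_2_group_axioms.intro abelian_group.a_comm_group ring.is_abelian_group ring_from_type_algebra)
     (simp add: ring_of_type_algebra_def)

lemma elementary_2_group_DirProd:
  assumes "elementary_2_group G" "elementary_2_group H" shows "elementary_2_group (G \<times>\<times> H)"
proof -
  interpret G: elementary_2_group G by fact
  interpret H: elementary_2_group H by fact
  interpret group "G \<times>\<times> H" by (intro DirProd_group G.group_axioms H.group_axioms)
  show ?thesis
    by (intro elementary_2_group.intro elementary_2_group_axioms.intro group_comm_groupI)
       (auto simp: G.m_comm H.m_comm G.square H.square)
qed

lemma (in elementary_2_group) vectorspace_F2_space: "vectorspace F2 (F2_space G)"
proof -
  have bit: "x \<noteq> 1 \<Longrightarrow> x = 0" for x :: bit by (simp add: bit_not_one_iff)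
  show ?thesis
  proof (rule vs_criteria)
    show "field F2" by (rule field_from_type_algebra)
    show "\<forall>a b v. a \<in> carrier F2 \<and> b \<in> carrier F2 \<and> v \<in> carrier (F2_space G) \<longrightarrow>
       (a \<oplus>\<^bsub>F2\<^esub> b) \<odot>\<^bsub>F2_space G\<^esub> v = a \<odot>\<^bsub>F2_space G\<^esub> v \<oplus>\<^bsub>F2_space G\<^esub> b \<odot>\<^bsub>F2_space G\<^esub> v"
      by (auto simp: F2_space_def ring_of_type_algebra_def square dest: bit)
  qed (auto simp: F2_space_def ring_of_type_algebra_def m_ac square)
qed

text \<open>Over two scalars the linear combinations of a basis correspond to its subsets, so the
  dimension can be read off from the cardinality.\<close>

lemma card_F2_vectorspace:
  assumes "vectorspace F2 V" "finite (carrier V)"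
  shows "card (carrier V) = 2 ^ vectorspace.dim F2 V"
proof -
  interpret vectorspace F2 V by fact
  have F2: "carrier F2 = (UNIV :: bit set)" "\<zero>\<^bsub>F2\<^esub> = 0" "x \<oplus>\<^bsub>F2\<^esub> y = x + y" for x y :: bit
    by (simp_all add: ring_of_type_algebra_def)
  have "carrier V \<subseteq> span (carrier V)" by (rule in_own_span) simp
  then have "fin_dim" unfolding fin_dim_def using assms(2) span_is_subset2[of "carrier V"] by blast
  then obtain B where B: "finite B" "lin_indpt B" "span B = carrier V" "B \<subseteq> carrier V"
    using finite_basis_exists basis_def by blast
  let ?F = "\<lambda>S. lincomb (\<lambda>v. if v \<in> S then 1 else 0) B"
  have "span B = ?F ` Pow B"
  proof -
    have "lincomb a B \<in> ?F ` Pow B" for a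
    proof
      show "lincomb a B = ?F {v \<in> B. a v = 1}"
        using B(4) by (intro lincomb_cong) (auto simp: F2 bit_not_one_iff)
    qed simp
    then show ?thesis unfolding finite_span[OF B(1,4)] F2 by auto
  qed
  moreover have "inj_on ?F (Pow B)"
  proof (rule inj_onI)
    fix S S' assume S: "S \<in> Pow B" "S' \<in> Pow B" and eq: "?F S = ?F S'"
    \<comment> \<open>Adding two equal combinations gives zero in characteristic 2, so independence
      forces the two indicator functions to agree.\<close>
    let ?a = "\<lambda>v. (if v \<in> S then 1 else 0) + (if v \<in> S' then 1 else 0) :: bit"
    let ?b = "\<lambda>v. (if v \<in> S then 1 else 0) + (if v \<in> S then 1 else 0) :: bit"
    have "lincomb ?a B = ?F S \<oplus>\<^bsub>V\<^esub> ?F S'"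
      using lincomb_sum[OF B(1,4), of "\<lambda>v. if v \<in> S then 1 else 0" "\<lambda>v. if v \<in> S' then 1 else 0"] by (simp add: F2)
    also have "\<dots> = ?F S \<oplus>\<^bsub>V\<^esub> ?F S" using eq by simp
    also have "\<dots> = lincomb ?b B"
      using lincomb_sum[OF B(1,4), of "\<lambda>v. if v \<in> S then 1 else 0" "\<lambda>v. if v \<in> S then 1 else 0"] by (simp add: F2)
    also have "?b = (\<lambda>_. 0)" by auto
    also have "lincomb (\<lambda>_. 0) B = \<zero>\<^bsub>V\<^esub>"
    proof -
      have "lincomb (\<lambda>_. 0) B = (\<Oplus>\<^bsub>V\<^esub>v\<in>B. \<zero>\<^bsub>V\<^esub>)"
        unfolding lincomb_def using B(4) smult_l_null by (intro finsum_cong2) (auto simp: F2 B(1))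
      then show ?thesis by simp
    qed
    finally have zero: "lincomb ?a B = \<zero>\<^bsub>V\<^esub>" .
    have "?a v = 0" if "v \<in> B" for v
    proof (rule ccontr)
      assume "?a v \<noteq> 0"
      then have "?a v \<noteq> \<zero>\<^bsub>F2\<^esub>" by (simp only: F2(2) not_False_eq_True)
      moreover have "?a \<in> B \<rightarrow> carrier F2" by (simp add: F2(1))
      ultimately show False using lin_dep_crit[OF B(1) order.refl _ that _ zero] B(2) by blast
    qed
    then have "v \<in> S \<longleftrightarrow> v \<in> S'" if "v \<in> B" for v using that by (cases "v \<in> S"; cases "v \<in> S'") (metis add_0_right add_0_left zero_neq_one)+
    then show "S = S'" using S by blast
  qed
  ultimately have "card (carrier V) = card (Pow B)" using card_image B(3) by metis
  moreover have "dim = card B" using dim_basis[OF B(1)] B by (simp add: basis_def)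
  ultimately show ?thesis using card_Pow[OF B(1)] by simp
qed

text \<open>The isomorphism sends x \<otimes> y to x if y = 1 and to the identity if y = 0. It is
  injective since every class modulo the relations contains some \<open>frag_of (m, 1)\<close>,
  whose image is \<open>m\<close>.\<close>

lemma (in elementary_2_group) tensor_F2_group: "group (tensor G (add_monoid F2))"
  and tensor_F2_iso: "tensor G (add_monoid F2) \<cong> G"
proof -
  define S where "S = carrier G \<times> carrier (add_monoid F2)"
  define F where "F = free_Abelian_group S"
  define R where "R = {frag_of (x \<otimes> x', y) - frag_of (x, y) - frag_of (x', y) | x x' y.
           x \<in> carrier G \<and> x' \<in> carrier G \<and> y \<in> carrier (add_monoid F2)} \<union>
        {frag_of (x, y \<otimes>\<^bsub>add_monoid F2\<^esub> y') - frag_of (x, y) - frag_of (x, y') | x y y'.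
           x \<in> carrier G \<and> y \<in> carrier (add_monoid F2) \<and> y' \<in> carrier (add_monoid F2)}"
  define N where "N = generate F R"
  have F2: "carrier (add_monoid F2) = (UNIV :: bit set)" "monoid.mult (add_monoid F2) = ((+) :: bit \<Rightarrow> bit \<Rightarrow> bit)"
    "carrier F2 = (UNIV :: bit set)" "add F2 = ((+) :: bit \<Rightarrow> bit \<Rightarrow> bit)"
    by (simp_all add: ring_of_type_algebra_def)
  have tensor: "tensor G (add_monoid F2) = F Mod N"
    unfolding tensor_def Let_def N_def R_def F_def S_def by (rule refl)
  interpret F: comm_group F unfolding F_def by (rule abelian_free_Abelian_group)
  have Fs: "x \<in> carrier F \<longleftrightarrow> Poly_Mapping.keys x \<subseteq> S" "x \<otimes>\<^bsub>F\<^esub> y = x + y" "\<one>\<^bsub>F\<^esub> = 0" for x y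
    by (simp_all add: F_def)
  have S: "(x, y) \<in> S \<longleftrightarrow> x \<in> carrier G" for x y by (simp add: S_def F2)
  have keys: "Poly_Mapping.keys (u - v) \<subseteq> S" if "Poly_Mapping.keys u \<subseteq> S" "Poly_Mapping.keys v \<subseteq> S" for u v :: "('a \<times> bit) \<Rightarrow>\<^sub>0 int"
    using that keys_diff[of u v] by blast
  have R_cases: "(\<exists>x x' y. p = frag_of (x \<otimes> x', y) - frag_of (x, y) - frag_of (x', y) \<and> x \<in> carrier G \<and> x' \<in> carrier G \<and> y \<in> UNIV) \<or>
      (\<exists>x y y'. p = frag_of (x, y + y') - frag_of (x, y) - frag_of (x, y') \<and> x \<in> carrier G \<and> y \<in> UNIV \<and> y' \<in> UNIV)" if "p \<in> R" for p
    using that unfolding R_def F2(1,2) Un_iff mem_Collect_eq .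
  have R: "R \<subseteq> carrier F"
  proof
    fix p assume "p \<in> R"
    from R_cases[OF this] show "p \<in> carrier F" by (elim disjE exE conjE) (simp_all add: Fs keys S)
  qed
  have N: "subgroup N F" unfolding N_def by (rule F.generate_is_subgroup[OF R])
  have Nd: "u - v \<in> N" if "u \<in> N" "v \<in> N" for u v
  proof -
    have k: "Poly_Mapping.keys v \<subseteq> S" using subgroup.mem_carrier[OF N that(2)] Fs by simp
    show ?thesis using subgroup.m_closed[OF N that(1) subgroup.m_inv_closed[OF N that(2)]] k by (simp add: F_def)
  qed
  have N0: "0 \<in> N" using subgroup.one_closed[OF N] by (simp add: Fs)
  have Na: "u + v \<in> N" if "u \<in> N" "v \<in> N" for u v
    using subgroup.m_closed[OF N that] by (simp add: Fs)
  have N1: "frag_of (x \<otimes> x', y) - frag_of (x, y) - frag_of (x', y) \<in> N" if "x \<in> carrier G" "x' \<in> carrier G" for x x' y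
    unfolding N_def R_def F2(1,2) by (rule generate.incl, rule UnI1, rule CollectI, intro exI conjI, rule refl) (simp_all add: that)
  have N2: "frag_of (x, y + y') - frag_of (x, y) - frag_of (x, y') \<in> N" if "x \<in> carrier G" for x y y'
    unfolding N_def R_def F2(1,2) by (rule generate.incl, rule UnI2, rule CollectI, intro exI conjI, rule refl) (simp_all add: that)
  have z: "frag_of (x, 0) \<in> N" if "x \<in> carrier G" for x
    using Nd[OF N0 N2[OF that, of 0 0]] by simp
  have one: "frag_of (\<one>, 1) \<in> N"
    using Nd[OF N0 N1[of \<one> \<one> 1]] by simp
  have "(\<lambda>(x, y). if y = 0 then \<one> else x) ` S \<subseteq> carrier G" by (auto simp: S)
  then obtain \<phi> where \<phi>: "\<phi> \<in> hom F G" "\<And>p. p \<in> S \<Longrightarrow> \<phi> (frag_of p) = (case p of (x, y) \<Rightarrow> if y = 0 then \<one> else x)"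
    unfolding F_def using free_Abelian_group_universal[of "\<lambda>(x, y). if y = 0 then \<one> else x" S] by blast
  interpret \<phi>: group_hom F G \<phi> by unfold_locales (rule \<phi>(1))
  have \<phi>d: "\<phi> (u - v) = \<phi> u \<otimes> \<phi> v" if "Poly_Mapping.keys u \<subseteq> S" "Poly_Mapping.keys v \<subseteq> S" for u v
  proof -
    have "u - v = u \<otimes>\<^bsub>F\<^esub> inv\<^bsub>F\<^esub> v" using that by (simp add: F_def)
    moreover have c: "u \<in> carrier F" "v \<in> carrier F" using that Fs by simp_all
    moreover have "inv (\<phi> v) = \<phi> v" using c square by (intro inv_equality) auto
    ultimately show ?thesis by (simp only: \<phi>.hom_mult \<phi>.hom_inv F.inv_closed)
  qed
  have \<phi>s: "\<phi> (frag_of (x, y)) = (if y = 0 then \<one> else x)" if "x \<in> carrier G" for x y using \<phi>(2)[of "(x, y)"] that S by simp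
  have "R \<subseteq> kernel F G \<phi>"
  proof
    fix p assume "p \<in> R"
    from R_cases[OF this] have "\<phi> p = \<one>"
    proof (elim disjE exE conjE)
      fix x x' y assume 1: "x \<in> carrier G" "x' \<in> carrier G" "p = frag_of (x \<otimes> x', y) - frag_of (x, y) - frag_of (x', y)"
      have "x \<otimes> x' \<otimes> x \<otimes> x' = \<one>" using 1 square[of "x \<otimes> x'"] by (simp add: m_assoc)
      then show ?thesis using 1 by (simp add: \<phi>d \<phi>s S keys)
    next
      fix x y y' assume 2: "x \<in> carrier G" "p = frag_of (x, y + y') - frag_of (x, y) - frag_of (x, y')"
      then have "\<phi> p = \<phi> (frag_of (x, y + y')) \<otimes> \<phi> (frag_of (x, y)) \<otimes> \<phi> (frag_of (x, y'))" by (simp add: \<phi>d S keys)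
      then show ?thesis
        using 2(1) by (cases y; cases y') (simp_all add: \<phi>s square)
    qed
    then show "p \<in> kernel F G \<phi>" using \<open>p \<in> R\<close> R by (auto simp: kernel_def)
  qed
  then have "N \<subseteq> kernel F G \<phi>"
    unfolding N_def by (rule F.generate_subgroup_incl) (rule \<phi>.subgroup_kernel)
  moreover have "kernel F G \<phi> \<subseteq> N"
  proof
    have rep: "\<exists>m\<in>carrier G. u - frag_of (m, 1) \<in> N" if "Poly_Mapping.keys u \<subseteq> S" for u
      using that
    proof (induction u rule: frag_induction)
      case zero
      show ?case using Nd[OF N0 one] by (intro bexI[of _ \<one>]) simp_all
    next
      case (one p)
      obtain x y where p: "p = (x, y)" "x \<in> carrier G" using one S by (cases p) auto
      show ?case
      proof (cases "y = 0")
        case True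
        then show ?thesis using p Nd[OF z[OF p(2)] \<open>frag_of (\<one>, 1) \<in> N\<close>] by (intro bexI[of _ \<one>]) simp_all
      next
        case False
        then show ?thesis using p N0 by (intro bexI[of _ x]) (simp_all add: bit_not_zero_iff)
      qed
    next
      case (diff a b)
      then obtain m m' where m: "m \<in> carrier G" "m' \<in> carrier G" "a - frag_of (m, 1) \<in> N" "b - frag_of (m', 1) \<in> N" by blast
      \<comment> \<open>The product stands for the difference of \<open>m\<close> and
        \<open>m'\<close>, as \<open>m'\<close> is its own inverse.\<close>
      let ?x = "m \<otimes> m'"
      have "?x \<otimes> m' = m" using m square[of m'] by (simp add: m_assoc)
      then have "frag_of (m, 1) - frag_of (?x, 1) - frag_of (m', 1) \<in> N" using N1[of ?x m' 1] m by simp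
      from Na[OF Nd[OF m(3,4)] this] have "a - b - frag_of (?x, 1) \<in> N" by (simp add: algebra_simps)
      then show ?case using m by blast
    qed
    fix u assume u: "u \<in> kernel F G \<phi>"
    then have k: "Poly_Mapping.keys u \<subseteq> S" "\<phi> u = \<one>" using Fs by (auto simp: kernel_def)
    obtain m where m: "m \<in> carrier G" "u - frag_of (m, 1) \<in> N" using rep[OF k(1)] by blast
    then have "\<phi> (u - frag_of (m, 1)) = \<one>" using \<open>N \<subseteq> kernel F G \<phi>\<close> by (auto simp: kernel_def)
    then have "m = \<one>" using m k by (simp add: \<phi>d \<phi>s S)
    then show "u \<in> N" using Na[OF m(2) one] by simp
  qed
  ultimately have "N = kernel F G \<phi>" by blast
  moreover have "\<phi> ` carrier F = carrier G"
  proof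
    show "carrier G \<subseteq> \<phi> ` carrier F"
    proof
      fix x assume "x \<in> carrier G"
      then show "x \<in> \<phi> ` carrier F" using \<phi>s[of x 1] by (intro image_eqI[of _ _ "frag_of (x, 1)"]) (auto simp: Fs S)
    qed
  qed auto
  ultimately show "group (tensor G (add_monoid F2))" "tensor G (add_monoid F2) \<cong> G"
    unfolding tensor using \<phi>.FactGroup_iso normal.factorgroup_is_group[OF \<phi>.normal_kernel] by simp_all
qed

lemma (in elementary_2_group) rank_F2_eq:
  assumes "card (carrier G) = 2 ^ k" shows "rank_F2 G = k"
proof -
  let ?T = "tensor G (add_monoid F2)"
  interpret T: elementary_2_group ?T using elementary_2_group_iso[OF tensor_F2_group elementary_2_group_axioms tensor_F2_iso] .
  have "finite (carrier G)" using assms by (metis card.infinite power_not_zero zero_neq_numeral)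
  then have fin: "finite (carrier (F2_space ?T))" using iso_finite[OF tensor_F2_iso] by (simp add: F2_space_def)
  have "card (carrier (F2_space ?T)) = 2 ^ k" using iso_same_card[OF tensor_F2_iso] assms by (simp add: F2_space_def)
  then have "(2::nat) ^ k = 2 ^ rank_F2 G"
    using card_F2_vectorspace[OF T.vectorspace_F2_space fin] by (simp add: rank_F2_def)
  then show ?thesis by simp
qed

lemma rank_F2_quotient:
  assumes "group G" "elementary_2_group H" "\<psi> \<in> hom G H" "\<psi> ` carrier G = carrier H"
    "N = {g \<in> carrier G. \<psi> g = \<one>\<^bsub>H\<^esub>}" "card (carrier H) = 2 ^ k"
  shows "rank_F2 (G Mod N) = k"
proof -
  interpret group G by fact
  interpret H: elementary_2_group H by fact
  interpret \<psi>: group_hom G H \<psi> by unfold_locales fact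
  have N: "N = kernel G H \<psi>" using assms(5) by (simp add: kernel_def)
  have iso: "G Mod N \<cong> H" unfolding N by (rule \<psi>.FactGroup_iso) fact
  moreover have "group (G Mod N)" unfolding N by (rule normal.factorgroup_is_group[OF \<psi>.normal_kernel])
  ultimately interpret Q: elementary_2_group "G Mod N" using elementary_2_group_iso assms(2) by blast
  show ?thesis by (rule Q.rank_F2_eq) (simp only: iso_same_card[OF iso] assms(6))
qed

subsection \<open>The factors of the series\<close>

lemma add_bit_simps: "carrier F2 = (UNIV :: bit set)" "\<zero>\<^bsub>F2\<^esub> = (0::bit)" "x \<oplus>\<^bsub>F2\<^esub> y = (x + y :: bit)"
  by (simp_all add: ring_of_type_algebra_def)

lemma carrier_add_bit: "carrier (add_monoid F2) = UNIV" "carrier (add_monoid F2 \<times>\<times> add_monoid F2) = UNIV"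
  "carrier (add_monoid F2 \<times>\<times> add_monoid F2 \<times>\<times> add_monoid F2) = UNIV"
  by (simp_all add: add_bit_simps)

lemma card_add_bit: "card (carrier (add_monoid F2)) = 2" "card (carrier (add_monoid F2 \<times>\<times> add_monoid F2)) = 2 ^ 2"
  "card (carrier (add_monoid F2 \<times>\<times> add_monoid F2 \<times>\<times> add_monoid F2)) = 2 ^ 3"
proof -
  have "(UNIV :: bit set) = {0, 1}" by (auto simp: bit_not_one_iff)
  from arg_cong[OF this, of card] have "card (UNIV :: bit set) = 2" by simp
  then show "card (carrier (add_monoid F2)) = 2" "card (carrier (add_monoid F2 \<times>\<times> add_monoid F2)) = 2 ^ 2"
    "card (carrier (add_monoid F2 \<times>\<times> add_monoid F2 \<times>\<times> add_monoid F2)) = 2 ^ 3"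
    by (simp_all add: add_bit_simps card_cartesian_product del: UNIV_Times_UNIV)
qed

lemma rank_F2_GG_quotient:
  assumes "M \<lhd> GG" "elementary_2_group H" "\<And>g h. g \<in> M \<Longrightarrow> h \<in> M \<Longrightarrow> \<psi> (g \<circ> h) = \<psi> g \<otimes>\<^bsub>H\<^esub> \<psi> h"
    "\<psi> ` M = carrier H" "\<And>g. g \<in> N \<longleftrightarrow> g \<in> M \<and> \<psi> g = \<one>\<^bsub>H\<^esub>" "card (carrier H) = 2 ^ k"
  shows "rank_F2 (GG\<lparr>carrier := M\<rparr> Mod N) = k"
  using GG.subgroup_imp_group[OF normal_imp_subgroup[OF assms(1)]] assms(2)
  by (rule rank_F2_quotient[where \<psi> = \<psi>]) (use assms(3-) in \<open>auto simp: hom_def\<close>)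

lemma rank_series_1: "rank_F2 (GG\<lparr>carrier := GC\<rparr> Mod M2) = 3"
proof (rule rank_F2_GG_quotient[where \<psi> = "\<lambda>g. (par 0 g, par 1 g, par 2 g)" and H = "add_monoid F2 \<times>\<times> add_monoid F2 \<times>\<times> add_monoid F2"])
  let ?\<psi> = "\<lambda>g. (par 0 g, par 1 g, par 2 g)"
  have "v \<in> ?\<psi> ` GC" for v
  proof -
    obtain x y z where v: "v = (x, y, z)" by (rule prod_cases3)
    \<comment> \<open>The parities of a, c and d on levels 0, 1, 2 are the three unit
      vectors.\<close>
    let ?g = "(if x = 0 then id else gen_a) \<circ> ((if y = 0 then id else gen_c) \<circ> (if z = 0 then id else gen_d))"
    have "?g \<in> GC" by simp
    moreover have "?\<psi> ?g = v" unfolding v by (cases x; cases y; cases z) (simp_all add: numeral_2_eq_2)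
    ultimately show ?thesis by (rule rev_image_eqI[where f = ?\<psi>, OF _ sym])
  qed
  then show "?\<psi> ` GC = carrier (add_monoid F2 \<times>\<times> add_monoid F2 \<times>\<times> add_monoid F2)"
    unfolding carrier_add_bit by blast
qed (simp_all only: GG.normal_carrier elementary_2_group_DirProd elementary_2_group_add_bit card_add_bit, auto simp: add_bit_simps GC_tree_aut M2_def)

lemma rank_series_2: "rank_F2 (GG\<lparr>carrier := M2\<rparr> Mod LL) = 2"
proof (rule rank_F2_GG_quotient[where \<psi> = "\<lambda>g. (kap g, mu g)" and H = "add_monoid F2 \<times>\<times> add_monoid F2"])
  let ?\<psi> = "\<lambda>g. (kap g, mu g)"
  have "v \<in> ?\<psi> ` M2" for v
  proof -
    obtain x y where v: "v = (x, y)" by (rule prod.exhaust)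
    \<comment> \<open>\<open>zz\<close> has both values 1, so the exponent of \<open>xx\<close> has
      to compensate for its \<open>kap\<close>.\<close>
    let ?g = "(if x + y = 0 then id else xx) \<circ> (if y = 0 then id else zz)"
    have c: "(if x + y = 0 then id else xx) \<in> M2" "(if y = 0 then id else zz) \<in> M2"
      using xx_M2 zz_M2 normal_GG_id[OF M2_normal] by simp_all
    have "?g \<in> M2" using c by (rule normal_GG_comp[OF M2_normal])
    moreover have "?\<psi> ?g = v" unfolding v using kap_comp[OF c] mu_comp[OF c] by (cases x; cases y) simp_all
    ultimately show ?thesis by (rule rev_image_eqI[where f = ?\<psi>, OF _ sym])
  qed
  then show "?\<psi> ` M2 = carrier (add_monoid F2 \<times>\<times> add_monoid F2)"
    unfolding carrier_add_bit by blast
qed (simp_all only: M2_normal elementary_2_group_DirProd elementary_2_group_add_bit card_add_bit, auto simp: add_bit_simps kap_comp mu_comp LL_def)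

lemma ex_leadA: "r < 2 ^ Suc k \<Longrightarrow> \<exists>p\<in>MM k r. leadA k r p = 1"
proof -
  assume r: "r < 2 ^ Suc k"
  have f: "deg_lt (Suc k) (2 ^ Suc k - r) (vfun (Suc k) r)" "coef (Suc k) (2 ^ Suc k - 1 - r) (vfun (Suc k) r) = 1"
    using deg_lt_vfun[OF r] by auto
  have "leadA k r (xtuple (Suc k) (vfun (Suc k) r)) = 1"
    unfolding leadA_def f(2)[symmetric] by (rule coef_cong) (rule Af_xtuple)
  then show ?thesis using xtuple_MM[OF f(1)] by blast
qed

lemma rank_series_even:
  assumes r: "even r" "r < 2 ^ Suc k" shows "rank_F2 (GG\<lparr>carrier := MM k r\<rparr> Mod MM k (Suc r)) = 1"
proof (rule rank_F2_GG_quotient[where \<psi> = "leadA k r" and H = "add_monoid F2"])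
  have "x \<in> leadA k r ` MM k r" for x
  proof (cases x)
    case zero
    have "leadA k r id = 0" using leadA_comp[of id k id r] normal_GG_id[OF NK_normal] by simp
    then show ?thesis using zero normal_GG_id[OF MM_normal] by (intro rev_image_eqI[of id]) simp_all
  next
    case one
    then show ?thesis using ex_leadA[OF r(2)] by force
  qed
  then show "leadA k r ` MM k r = carrier (add_monoid F2)" unfolding carrier_add_bit by blast
qed (simp_all only: MM_normal elementary_2_group_add_bit card_add_bit, auto simp: add_bit_simps leadA_comp[OF MM_NK MM_NK] MM_Suc_iff[OF r(2)] r)

lemma rank_series_odd:
  assumes r: "odd r" "r < 2 ^ Suc k" shows "rank_F2 (GG\<lparr>carrier := MM k r\<rparr> Mod MM k (Suc r)) = 2"
proof (rule rank_F2_GG_quotient[where \<psi> = "\<lambda>g. (leadA k r g, leadB k r g)" and H = "add_monoid F2 \<times>\<times> add_monoid F2"])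
  let ?\<psi> = "\<lambda>g. (leadA k r g, leadB k r g)"
  obtain p q where p: "p \<in> MM k r" "leadA k r p = 1" and q: "q \<in> MM k r" "leadA k r q = 0" "leadB k r q = 1"
    using ex_leadA[OF r(2)] exists_leadB[OF r] by blast
  have i: "?\<psi> id = (0, 0)"
    using leadA_comp[of id k id r] leadB_comp[of id k id r] normal_GG_id[OF NK_normal] by simp
  have "v \<in> ?\<psi> ` MM k r" for v
  proof -
    obtain x y where v: "v = (x, y)" by (rule prod.exhaust)
    \<comment> \<open>\<open>p\<close> may carry a B coefficient of its own; it is taken into
      account in deciding whether \<open>q\<close> is needed.\<close>
    let ?p = "if x = 0 then id else p" and ?q = "if y + (if x = 0 then 0 else leadB k r p) = 0 then id else q"
    have c: "?p \<in> MM k r" "?q \<in> MM k r" using p q normal_GG_id[OF MM_normal] by simp_all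
    have "?p \<circ> ?q \<in> MM k r" using MM_comp[OF c] .
    moreover have "?\<psi> (?p \<circ> ?q) = v"
      unfolding v leadA_comp[OF MM_NK MM_NK, OF c] leadB_comp[OF MM_NK MM_NK, OF c]
      using i p q by (cases x; cases y; cases "leadB k r p") simp_all
    ultimately show ?thesis by (rule rev_image_eqI[where f = ?\<psi>, OF _ sym])
  qed
  then show "?\<psi> ` MM k r = carrier (add_monoid F2 \<times>\<times> add_monoid F2)"
    unfolding carrier_add_bit by blast
qed (simp_all only: MM_normal elementary_2_group_DirProd elementary_2_group_add_bit card_add_bit, auto simp: add_bit_simps leadA_comp[OF MM_NK MM_NK] leadB_comp[OF MM_NK MM_NK] MM_Suc_iff[OF r(2)] r)

lemma rank_series:
  assumes "1 \<le> n"
  shows "rank_F2 (GG\<lparr>carrier := series n\<rparr> Mod series (n + 1)) = (if n = 1 then 3 else if even n then 2 else 1)"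
proof (cases n rule: series_cases)
  case 2 then show ?thesis using rank_series_1 by (simp add: series_def)
next
  case 3
  have "series 3 = LL" using series_eq[of 0 0] MM_0[of 0] by simp
  then show ?thesis using 3 rank_series_2 by (simp add: series_small)
next
  case (4 k r)
  have n: "n + 1 = 2 ^ Suc k + 1 + Suc r" "even n \<longleftrightarrow> odd r" "n \<noteq> 1" using 4 by auto
  have "series n = MM k r" using series_eq[of r k] 4 by simp
  moreover have "series (n + 1) = MM k (Suc r)" using series_eq[of "Suc r" k] 4 unfolding n(1) by simp
  ultimately show ?thesis using rank_series_even[of r k] rank_series_odd[of r k] 4(2) n by simp
qed (use assms in simp)

subsection \<open>The modules \<open>V\<^sub>n\<close> as spaces of functions\<close>

text \<open>Modulo the relations \<open>X\<^sub>i\<^sup>2 = 1\<close> a monomial only depends on the set of variables of odd exponent, and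
  the class of a polynomial is determined by the sums of its coefficients over the monomials with a given set.\<close>

definition odd_support :: "(nat \<Rightarrow>\<^sub>0 nat) \<Rightarrow> nat set" where
  "odd_support e = {i. odd (Poly_Mapping.lookup e i)}"

definition pcoef :: "mpoly2 \<Rightarrow> nat set \<Rightarrow> bit" where
  "pcoef p A = (\<Sum>e\<in>Poly_Mapping.keys p. if odd_support e = A then Poly_Mapping.lookup p e else 0)"

lemma odd_support_add: "odd_support (e + e') = A \<longleftrightarrow> odd_support e' = sym_diff A (odd_support e)"
  unfolding odd_support_def lookup_add by auto

lemma odd_support_zero [simp]: "odd_support 0 = {}" and odd_support_single [simp]: "odd_support (Poly_Mapping.single i (Suc 0)) = {i}"
  by (auto simp: odd_support_def lookup_single when_def)

lemma odd_support_subset_keys: "odd_support e \<subseteq> Poly_Mapping.keys e"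
proof
  fix i assume "i \<in> odd_support e"
  then have "Poly_Mapping.lookup e i \<noteq> 0" unfolding odd_support_def by (intro notI) simp
  then show "i \<in> Poly_Mapping.keys e" by (simp add: in_keys_iff)
qed

lemma pcoef_superset:
  assumes "finite K" "Poly_Mapping.keys p \<subseteq> K"
  shows "pcoef p A = (\<Sum>e\<in>K. if odd_support e = A then Poly_Mapping.lookup p e else 0)"
  unfolding pcoef_def by (rule sum.mono_neutral_left) (use assms in \<open>auto simp: in_keys_iff\<close>)

lemma pcoef_add: "pcoef (p + q) A = pcoef p A + pcoef q A"
proof -
  let ?K = "Poly_Mapping.keys p \<union> Poly_Mapping.keys q"
  have K: "finite ?K" "Poly_Mapping.keys p \<subseteq> ?K" "Poly_Mapping.keys q \<subseteq> ?K" "Poly_Mapping.keys (p + q) \<subseteq> ?K"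
    using keys_add[of p q] by auto
  show ?thesis unfolding K(2-)[THEN pcoef_superset[OF K(1)]]
    unfolding sum.distrib[symmetric] by (rule sum.cong) (simp_all add: lookup_add)
qed

lemma pcoef_zero [simp]: "pcoef 0 A = 0" by (simp add: pcoef_def)

lemma pcoef_single: "pcoef (Poly_Mapping.single e c) A = (if odd_support e = A then c else 0)"
  by (simp add: pcoef_def lookup_single)

lemma pcoef_one: "pcoef 1 A = (if A = {} then 1 else 0)"
  by (metis pcoef_single odd_support_zero single_one)

lemma pcoef_single_mult:
  "pcoef (Poly_Mapping.single e c * p) A = c * pcoef p (sym_diff A (odd_support e))"
  using subset_UNIV[of "Poly_Mapping.keys p"]
proof (induction p rule: group_algebra_induct)
  case (single g d)
  then show ?case by (simp add: mult_single pcoef_single odd_support_add)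
next
  case (add p q)
  then show ?case by (simp add: distrib_left pcoef_add)
qed simp

lemma pcoef_mult_zero:
  assumes "\<And>A. pcoef p A = 0" shows "pcoef (q * p) A = 0"
  using subset_UNIV[of "Poly_Mapping.keys q"]
  by (induction q rule: group_algebra_induct) (simp_all add: pcoef_single_mult assms distrib_right pcoef_add)

lemma pcoef_mult_zero_right: "(\<And>A. pcoef p A = 0) \<Longrightarrow> pcoef (p * q) A = 0"
  by (subst mult.commute) (rule pcoef_mult_zero)

lemma pcoef_sum: "pcoef (sum f F) A = (\<Sum>i\<in>F. pcoef (f i) A)"
  by (induction F rule: infinite_finite_induct) (simp_all add: pcoef_add)

text \<open>One formula covers word monomials, with factors 1 or X_i, and the elements v_n^r, with
  factors 1 or 1 - X_i.\<close>

lemma pcoef_prod: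
  assumes "finite F"
  shows "pcoef (\<Prod>i\<in>F. Poly_Mapping.single 0 (c i) + Poly_Mapping.single (Poly_Mapping.single i 1) (d i)) A
    = (if A \<subseteq> F then \<Prod>i\<in>F. if i \<in> A then d i else c i else 0)"
  using assms
proof (induction F arbitrary: A rule: finite_induct)
  case empty
  show ?case using pcoef_one by auto
next
  case (insert j F)
  let ?q = "\<Prod>i\<in>F. Poly_Mapping.single 0 (c i) + Poly_Mapping.single (Poly_Mapping.single i 1) (d i)"
  have "pcoef (\<Prod>i\<in>insert j F. Poly_Mapping.single 0 (c i) + Poly_Mapping.single (Poly_Mapping.single i 1) (d i)) A
     = c j * pcoef ?q A + d j * pcoef ?q (sym_diff A {j})"
    using insert(1,2) by (simp add: distrib_right pcoef_add pcoef_single_mult)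
  also have "\<dots> = (if A \<subseteq> insert j F then \<Prod>i\<in>insert j F. if i \<in> A then d i else c i else 0)"
  proof (cases "j \<in> A")
    case True
    have "\<not> A \<subseteq> F" "sym_diff A {j} \<subseteq> F \<longleftrightarrow> A \<subseteq> insert j F" using True insert(2) by auto
    moreover have "(\<Prod>i\<in>F. if i \<in> sym_diff A {j} then d i else c i) = (\<Prod>i\<in>F. if i \<in> A then d i else c i)"
      using insert(2) by (intro prod.cong) auto
    ultimately show ?thesis using True insert by simp
  next
    case False
    have "\<not> sym_diff A {j} \<subseteq> F" "A \<subseteq> F \<longleftrightarrow> A \<subseteq> insert j F" using False insert(2) by auto
    then show ?thesis using False insert by simp
  qed
  finally show ?case .
qed

context
  fixes n :: nat
begin

abbreviation "RR \<equiv> poly_ring_F2 n"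

lemma poly_ring_carrier: "p \<in> carrier RR \<longleftrightarrow> (\<forall>e\<in>Poly_Mapping.keys p. Poly_Mapping.keys e \<subseteq> {1..n})"
  and poly_ring_simps: "monoid.mult RR = (*)" "add RR = (+)" "one RR = 1" "ring.zero RR = 0"
  by (auto simp: poly_ring_F2_def ring_of_type_algebra_def)

lemma poly_ring_carrier_subset: "p \<in> carrier RR \<longleftrightarrow> Poly_Mapping.keys p \<subseteq> {e. Poly_Mapping.keys e \<subseteq> {1..n}}"
  unfolding poly_ring_carrier by blast

lemma poly_ring_add: "p \<in> carrier RR \<Longrightarrow> q \<in> carrier RR \<Longrightarrow> p + q \<in> carrier RR"
  using keys_add[of p q] by (auto simp: poly_ring_carrier_subset)

lemma poly_ring_mult: "p \<in> carrier RR \<Longrightarrow> q \<in> carrier RR \<Longrightarrow> p * q \<in> carrier RR"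
proof -
  assume pq: "p \<in> carrier RR" "q \<in> carrier RR"
  have "Poly_Mapping.keys e \<subseteq> {1..n}" if e: "e \<in> Poly_Mapping.keys (p * q)" for e
  proof -
    obtain a b where ab: "e = a + b" "a \<in> Poly_Mapping.keys p" "b \<in> Poly_Mapping.keys q" using e keys_mult[of p q] by blast
    then have "Poly_Mapping.keys a \<subseteq> {1..n}" "Poly_Mapping.keys b \<subseteq> {1..n}" using pq by (simp_all add: poly_ring_carrier)
    then show ?thesis unfolding ab(1) using keys_add[of a b] by blast
  qed
  then show ?thesis unfolding poly_ring_carrier by blast
qed

lemma poly_ring_const: "0 \<in> carrier RR" "1 \<in> carrier RR"
  by (simp_all add: poly_ring_carrier)

lemma poly_ring_X: "i \<in> {1..n} \<Longrightarrow> X_var i \<in> carrier RR"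
  by (simp add: poly_ring_carrier X_var_def)

lemma poly_ring_prod: "(\<And>i. i \<in> F \<Longrightarrow> f i \<in> carrier RR) \<Longrightarrow> prod f F \<in> carrier RR"
  by (induction F rule: infinite_finite_induct) (simp_all add: poly_ring_const poly_ring_mult)

lemma poly_ring_sum: "(\<And>i. i \<in> F \<Longrightarrow> f i \<in> carrier RR) \<Longrightarrow> sum f F \<in> carrier RR"
  by (induction F rule: infinite_finite_induct) (simp_all add: poly_ring_const poly_ring_add)

lemma poly_ring_power: "p \<in> carrier RR \<Longrightarrow> p ^ k \<in> carrier RR"
  by (induction k) (simp_all add: poly_ring_const poly_ring_mult)

lemma cring_poly_ring: "cring RR"
proof (rule cringI)
  show "abelian_group RR"
  proof (rule abelian_groupI)
    fix x assume "x \<in> carrier RR"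
    then show "\<exists>y\<in>carrier RR. y \<oplus>\<^bsub>RR\<^esub> x = \<zero>\<^bsub>RR\<^esub>" by (intro bexI[of _ x]) (simp_all add: poly_ring_simps)
  qed (simp_all add: poly_ring_simps poly_ring_const poly_ring_add ac_simps)
  show "comm_monoid RR"
    by (rule comm_monoidI) (simp_all add: poly_ring_simps poly_ring_const poly_ring_mult ac_simps)
qed (simp_all add: poly_ring_simps distrib_right)

interpretation RR: cring RR by (rule cring_poly_ring)

lemma poly_ring_minus: "p \<in> carrier RR \<Longrightarrow> q \<in> carrier RR \<Longrightarrow> p \<ominus>\<^bsub>RR\<^esub> q = p + q"
proof -
  assume pq: "p \<in> carrier RR" "q \<in> carrier RR"
  have "\<ominus>\<^bsub>RR\<^esub> q = q" by (rule RR.minus_equality) (simp_all add: poly_ring_simps pq)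
  then show ?thesis by (simp add: a_minus_def poly_ring_simps)
qed

lemma X_square_carrier: "{X_var i ^ 2 - 1 | i. i \<in> {1..n}} \<subseteq> carrier RR"
  by (auto simp: poly_mapping_bit_diff intro!: poly_ring_add poly_ring_power poly_ring_X poly_ring_const)

lemma ideal_V_ideal: "ideal (V_ideal n) RR"
  unfolding V_ideal_def by (rule RR.genideal_ideal[OF X_square_carrier])

lemma V_class_eq_iff: "p \<in> carrier RR \<Longrightarrow> q \<in> carrier RR \<Longrightarrow> V_class n p = V_class n q \<longleftrightarrow> p + q \<in> V_ideal n"
  unfolding V_class_def using RR.quotient_eq_iff_same_a_r_cos[OF ideal_V_ideal] poly_ring_minus by simp

lemma V_class_add: "p \<in> carrier RR \<Longrightarrow> q \<in> carrier RR \<Longrightarrow> V_class n p \<oplus>\<^bsub>V_mod n\<^esub> V_class n q = V_class n (p + q)"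
  unfolding V_class_def V_mod_def FactRing_def using ideal.a_rcos_sum[OF ideal_V_ideal] by (simp add: poly_ring_simps)

lemma V_class_carrier: "carrier (V_mod n) = V_class n ` carrier RR"
  unfolding V_class_def V_mod_def FactRing_def A_RCOSETS_def' by auto

lemma V_class_zero: "V_class n 0 = \<zero>\<^bsub>V_mod n\<^esub>"
proof -
  have "V_ideal n \<subseteq> carrier RR" using additive_subgroup.a_subset[OF ideal.axioms(1)[OF ideal_V_ideal]] .
  then show ?thesis
    unfolding V_class_def V_mod_def FactRing_def using RR.a_coset_add_zero by (simp add: poly_ring_simps)
qed

lemma V_class_mult_cong:
  assumes "p \<in> carrier RR" "p' \<in> carrier RR" "q \<in> carrier RR" "q' \<in> carrier RR"
    "V_class n p = V_class n p'" "V_class n q = V_class n q'"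
  shows "V_class n (p * q) = V_class n (p' * q')"
proof -
  have "V_class n (p * q) = [mod V_ideal n:] V_class n p \<Otimes>\<^bsub>RR\<^esub> V_class n q" if "p \<in> carrier RR" "q \<in> carrier RR" for p q
    using ideal.rcoset_mult_add[OF ideal_V_ideal that] by (simp add: V_class_def poly_ring_simps)
  then show ?thesis using assms by metis
qed

lemma V_class_prod_cong:
  assumes "\<And>i. i \<in> F \<Longrightarrow> f i \<in> carrier RR" "\<And>i. i \<in> F \<Longrightarrow> g i \<in> carrier RR"
    "\<And>i. i \<in> F \<Longrightarrow> V_class n (f i) = V_class n (g i)"
  shows "V_class n (prod f F) = V_class n (prod g F)"
  using assms
proof (induction F rule: infinite_finite_induct)
  case (insert i F)
  have "V_class n (f i * prod f F) = V_class n (g i * prod g F)"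
    by (rule V_class_mult_cong) (use insert in \<open>auto intro: poly_ring_prod\<close>)
  then show ?case using insert by simp
qed simp_all

lemma V_class_X_power:
  assumes i: "i \<in> {1..n}" shows "V_class n (X_var i ^ k) = V_class n (if odd k then X_var i else 1)"
proof (induction k rule: nat_induct2)
  case (step k)
  have "X_var i ^ 2 + 1 \<in> V_ideal n"
    unfolding V_ideal_def using i by (intro subsetD[OF RR.genideal_self[OF X_square_carrier]]) (auto simp: poly_mapping_bit_diff)
  then have "V_class n (X_var i ^ 2) = V_class n 1"
    using V_class_eq_iff poly_ring_power[OF poly_ring_X[OF i]] poly_ring_const by simp
  then have "V_class n (X_var i ^ k * X_var i ^ 2) = V_class n ((if odd k then X_var i else 1) * 1)"
    using step i by (intro V_class_mult_cong) (simp_all add: poly_ring_power poly_ring_X poly_ring_const)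
  then have "V_class n (X_var i ^ (k + 2)) = V_class n (if odd k then X_var i else 1)" by (simp only: power_add mult_1_right)
  moreover have "odd (k + 2) \<longleftrightarrow> odd k" by simp
  ultimately show ?case by (simp only:)
qed simp_all

lemma single_eq_prod:
  assumes "finite F" "Poly_Mapping.keys e \<subseteq> F"
  shows "(Poly_Mapping.single e 1 :: mpoly2) = (\<Prod>i\<in>F. X_var i ^ Poly_Mapping.lookup e i)"
proof -
  have X: "X_var i ^ k = Poly_Mapping.single (Poly_Mapping.single i k) 1" for i k
    by (induction k) (simp_all add: X_var_def mult_single single_add[symmetric])
  have "(\<Prod>i\<in>F. X_var i ^ Poly_Mapping.lookup e i) = Poly_Mapping.single (\<Sum>i\<in>F. Poly_Mapping.single i (Poly_Mapping.lookup e i)) 1"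
    using assms(1) by (induction F rule: finite_induct) (simp_all add: X mult_single)
  also have "(\<Sum>i\<in>F. Poly_Mapping.single i (Poly_Mapping.lookup e i)) = e"
    using assms by (intro poly_mapping_eqI) (auto simp: lookup_sum lookup_single when_def in_keys_iff)
  finally show ?thesis by simp
qed

lemma V_class_single:
  assumes "Poly_Mapping.keys e \<subseteq> {1..n}"
  shows "V_class n (Poly_Mapping.single e 1) = V_class n (\<Prod>i\<in>{1..n}. if i \<in> odd_support e then X_var i else 1)"
  unfolding single_eq_prod[OF finite_atLeastAtMost assms]
  by (rule V_class_prod_cong) (use V_class_X_power in \<open>auto simp: odd_support_def poly_ring_X poly_ring_power poly_ring_const\<close>)

text \<open>The polynomials with vanishing \<open>pcoef\<close> form an ideal containing the
  relations. Conversely every polynomial is congruent to a sum of squarefree monomials,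
  \<open>?N p\<close>, which depends on \<open>pcoef p\<close> alone.\<close>

lemma V_ideal_pcoef:
  assumes p: "p \<in> carrier RR" shows "p \<in> V_ideal n \<longleftrightarrow> (\<forall>A. pcoef p A = 0)"
proof
  let ?J = "{p \<in> carrier RR. \<forall>A. pcoef p A = 0}"
  have zero: "pcoef (a * x) A = 0" "pcoef (x * a) A = 0" if "\<forall>A. pcoef a A = 0" for a x :: mpoly2 and A
    by (rule pcoef_mult_zero_right pcoef_mult_zero, simp add: that)+
  have "ideal ?J RR"
  proof (rule idealI)
    show "subgroup ?J (add_monoid RR)"
    proof (rule RR.add.subgroupI)
      fix a assume "a \<in> ?J"
      moreover from this have "\<ominus>\<^bsub>RR\<^esub> a = a" by (intro RR.minus_equality) (simp_all add: poly_ring_simps)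
      ultimately show "\<ominus>\<^bsub>RR\<^esub> a \<in> ?J" by simp
    qed (auto simp: poly_ring_simps pcoef_add poly_ring_add intro!: exI[of _ 0] simp: poly_ring_const)
  qed (use RR.ring_axioms in \<open>auto simp: poly_ring_simps poly_ring_mult zero\<close>)
  moreover have "{X_var i ^ 2 - 1 | i. i \<in> {1..n}} \<subseteq> ?J"
  proof -
    have "pcoef (X_var i ^ 2 - 1) A = 0" for i A
    proof -
      have "X_var i ^ 2 = Poly_Mapping.single (Poly_Mapping.single i 2) 1"
        by (simp add: X_var_def mult_single numeral_2_eq_2 single_add[symmetric])
      moreover have "odd_support (Poly_Mapping.single i 2) = {}" by (auto simp: odd_support_def lookup_single when_def)
      ultimately show ?thesis by (simp add: poly_mapping_bit_diff pcoef_add pcoef_single pcoef_one)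
    qed
    then show ?thesis using X_square_carrier by auto
  qed
  ultimately have "V_ideal n \<subseteq> ?J" unfolding V_ideal_def by (rule RR.genideal_minimal)
  then show "\<forall>A. pcoef p A = 0" if "p \<in> V_ideal n" using that by blast
next
  define m where "m A = (\<Prod>i\<in>{1..n}. if i \<in> A then X_var i else 1)" for A
  let ?N = "\<lambda>p. \<Sum>A\<in>Pow {1..n}. if pcoef p A = 1 then m A else 0"
  have m: "m A \<in> carrier RR" for A unfolding m_def by (auto intro!: poly_ring_prod poly_ring_const poly_ring_X)
  have N: "?N p \<in> carrier RR" for p
    by (rule poly_ring_sum) (use m poly_ring_const in auto)
  have "V_class n p = V_class n (?N p)"
    using p unfolding poly_ring_carrier_subset
  proof (induction p rule: group_algebra_induct)
    case zero
    then show ?case by simp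
  next
    case (single e c)
    show ?case
    proof (cases c)
      case zero then show ?thesis by simp
    next
      case one
      have "odd_support e \<in> Pow {1..n}" using single odd_support_subset_keys[of e] by blast
      then have "?N (Poly_Mapping.single e c) = m (odd_support e)"
      proof -
        have "pcoef (Poly_Mapping.single e c) A = 1 \<longleftrightarrow> odd_support e = A" for A by (simp add: pcoef_single one)
        then show ?thesis using \<open>odd_support e \<in> _\<close> by (simp only: sum.delta' finite_Pow_iff finite_atLeastAtMost if_True)
      qed
      then show ?thesis using V_class_single[of e] single one by (simp only: m_def mem_Collect_eq)
    qed
  next
    case (add p q)
    have "(if x + y = 1 then a else 0) = (if x = 1 then a else 0) + (if y = 1 then a else 0)" for x y :: bit and a :: mpoly2
      by (cases x; cases y) simp_all
    then have "?N (p + q) = ?N p + ?N q" by (simp add: pcoef_add sum.distrib)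
    moreover have "p \<in> carrier RR" "q \<in> carrier RR" using add by (simp_all add: poly_ring_carrier_subset)
    then have "V_class n (p + q) = V_class n p \<oplus>\<^bsub>V_mod n\<^esub> V_class n q" by (rule V_class_add[symmetric])
    moreover have "V_class n (?N p) \<oplus>\<^bsub>V_mod n\<^esub> V_class n (?N q) = V_class n (?N p + ?N q)" by (rule V_class_add[OF N N])
    ultimately show ?case using add(3,4) by (simp only:)
  qed
  moreover assume "\<forall>A. pcoef p A = 0"
  then have "?N p = 0" by simp
  ultimately have "V_class n p = V_class n 0" by simp
  then show "p \<in> V_ideal n" using V_class_eq_iff[OF p poly_ring_const(1)] by simp
qed

lemma V_class_eq_pcoef:
  assumes "p \<in> carrier RR" "q \<in> carrier RR"
  shows "V_class n p = V_class n q \<longleftrightarrow> (\<forall>A. pcoef p A = pcoef q A)"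
proof -
  have "pcoef p A + pcoef q A = 0 \<longleftrightarrow> pcoef p A = pcoef q A" for A
    by (cases "pcoef p A"; cases "pcoef q A") simp_all
  then show ?thesis
    using V_class_eq_iff[OF assms] V_ideal_pcoef[OF poly_ring_add[OF assms]] by (simp add: pcoef_add)
qed

lemma pcoef_support:
  assumes "p \<in> carrier RR" "\<not> A \<subseteq> {1..n}" shows "pcoef p A = 0"
  unfolding pcoef_def
proof (rule sum.neutral, intro ballI)
  fix e assume "e \<in> Poly_Mapping.keys p"
  then have "Poly_Mapping.keys e \<subseteq> {1..n}" using assms(1) by (simp add: poly_ring_carrier)
  then have "odd_support e \<subseteq> {1..n}" using odd_support_subset_keys[of e] by blast
  then show "(if odd_support e = A then Poly_Mapping.lookup p e else 0) = 0" using assms(2) by auto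
qed

end

section \<open>Elements of the modules as functions on words\<close>

lemma bit_prod: "finite F \<Longrightarrow> (\<Prod>i\<in>F. f i :: bit) = (if \<forall>i\<in>F. f i = 1 then 1 else 0)"
  by (induction F rule: finite_induct) (auto simp: bit_not_one_iff)

lemma finite_words: "finite {\<sigma> :: word. length \<sigma> = n}"
  using finite_lists_length_eq[OF finite_bit[of UNIV], of n] by simp

definition ones :: "word \<Rightarrow> nat set" where
  "ones \<sigma> = {i \<in> {1..length \<sigma>}. \<sigma> ! (i - 1) = 1}"

lemma ones_eq_iff: assumes "length \<sigma> = length \<tau>" shows "ones \<sigma> = ones \<tau> \<longleftrightarrow> \<sigma> = \<tau>"
proof
  assume eq: "ones \<sigma> = ones \<tau>"
  show "\<sigma> = \<tau>"
  proof (rule nth_equalityI[OF assms])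
    fix i assume "i < length \<sigma>"
    then have "Suc i \<in> ones \<sigma> \<longleftrightarrow> \<sigma> ! i = 1" "Suc i \<in> ones \<tau> \<longleftrightarrow> \<tau> ! i = 1" using assms by (auto simp: ones_def)
    then show "\<sigma> ! i = \<tau> ! i" using eq by (cases "\<sigma> ! i"; cases "\<tau> ! i") simp_all
  qed
qed simp

lemma ex_ones: assumes "A \<subseteq> {1..n}" obtains \<sigma> where "length \<sigma> = n" "ones \<sigma> = A"
proof
  let ?\<sigma> = "map (\<lambda>i. if Suc i \<in> A then 1 else 0) [0..<n] :: word"
  show "length ?\<sigma> = n" by simp
  have "i \<in> ones ?\<sigma> \<longleftrightarrow> i \<in> A" for i
    using assms by (cases i) (auto simp: ones_def split: if_splits)
  then show "ones ?\<sigma> = A" by blast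
qed

definition word_monomial :: "word \<Rightarrow> mpoly2" where
  "word_monomial \<sigma> = (\<Prod>i = 1..length \<sigma>. X_var i ^ (if \<sigma> ! (i - 1) = 1 then 1 else 0))"

lemma word_monomial_carrier: "word_monomial \<sigma> \<in> carrier (poly_ring_F2 (length \<sigma>))"
  unfolding word_monomial_def by (intro poly_ring_prod poly_ring_power poly_ring_X)

lemma pcoef_word_monomial: "pcoef (word_monomial \<sigma>) A = (if A = ones \<sigma> then 1 else 0)"
proof -
  let ?b = "\<lambda>i. \<sigma> ! (i - 1)" and ?F = "{1..length \<sigma>}"
  have "word_monomial \<sigma> = (\<Prod>i\<in>?F. Poly_Mapping.single 0 (1 + ?b i) + Poly_Mapping.single (Poly_Mapping.single i 1) (?b i))"
    unfolding word_monomial_def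
  proof (rule prod.cong[OF refl])
    fix i
    show "X_var i ^ (if ?b i = 1 then 1 else 0) = Poly_Mapping.single 0 (1 + ?b i) + Poly_Mapping.single (Poly_Mapping.single i 1) (?b i)"
      by (cases "?b i") (simp_all add: X_var_def)
  qed
  then have "pcoef (word_monomial \<sigma>) A = (if A \<subseteq> ?F then \<Prod>i\<in>?F. if i \<in> A then ?b i else 1 + ?b i else 0)"
    by (simp only: pcoef_prod finite_atLeastAtMost)
  also have "(\<Prod>i\<in>?F. if i \<in> A then ?b i else 1 + ?b i) = (if \<forall>i\<in>?F. (i \<in> A \<longleftrightarrow> ?b i = 1) then 1 else 0)"
  proof -
    have "(if i \<in> A then ?b i else 1 + ?b i) = 1 \<longleftrightarrow> (i \<in> A \<longleftrightarrow> ?b i = 1)" for i by (cases "?b i") simp_all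
    then show ?thesis by (simp only: bit_prod finite_atLeastAtMost)
  qed
  also have "(if A \<subseteq> ?F then if \<forall>i\<in>?F. (i \<in> A \<longleftrightarrow> ?b i = 1) then 1 else 0 else 0) = (if A = ones \<sigma> then 1 else (0::bit))"
  proof -
    have "A \<subseteq> ?F \<and> (\<forall>i\<in>?F. (i \<in> A \<longleftrightarrow> ?b i = 1)) \<longleftrightarrow> A = ones \<sigma>" unfolding ones_def by blast
    then show ?thesis by argo
  qed
  finally show ?thesis .
qed

definition word_poly :: "nat \<Rightarrow> (word \<Rightarrow> bit) \<Rightarrow> mpoly2" where
  "word_poly n f = (\<Sum>\<sigma> | length \<sigma> = n \<and> f \<sigma> = 1. word_monomial \<sigma>)"

text \<open>The passage from functions on words to V_n; only the values at words of length n matter,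
  and by \<open>Theta_eq_iff\<close> these are determined by the image.\<close>

definition Theta :: "nat \<Rightarrow> (word \<Rightarrow> bit) \<Rightarrow> mpoly2 set" where
  "Theta n f = V_class n (word_poly n f)"

lemma word_poly_carrier: "word_poly n f \<in> carrier (poly_ring_F2 n)"
  unfolding word_poly_def by (rule poly_ring_sum) (use word_monomial_carrier in auto)

lemma pcoef_word_poly:
  assumes "length \<sigma> = n" shows "pcoef (word_poly n f) (ones \<sigma>) = f \<sigma>"
proof -
  have fin: "finite {\<tau>. length \<tau> = n \<and> f \<tau> = 1}" by (rule finite_subset[OF _ finite_words[of n]]) auto
  have "pcoef (word_poly n f) (ones \<sigma>) = (\<Sum>\<tau> | length \<tau> = n \<and> f \<tau> = 1. if \<sigma> = \<tau> then 1 else 0)"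
    unfolding word_poly_def pcoef_sum by (rule sum.cong[OF refl]) (use assms ones_eq_iff[of \<sigma>] in \<open>simp add: pcoef_word_monomial\<close>)
  also have "\<dots> = f \<sigma>" using assms fin by (cases "f \<sigma>") simp_all
  finally show ?thesis .
qed

lemma V_class_eq_ones:
  assumes "p \<in> carrier (poly_ring_F2 n)" "q \<in> carrier (poly_ring_F2 n)"
  shows "V_class n p = V_class n q \<longleftrightarrow> (\<forall>\<sigma>. length \<sigma> = n \<longrightarrow> pcoef p (ones \<sigma>) = pcoef q (ones \<sigma>))"
proof -
  have "pcoef p A = pcoef q A" if "\<forall>\<sigma>. length \<sigma> = n \<longrightarrow> pcoef p (ones \<sigma>) = pcoef q (ones \<sigma>)" for A
  proof (cases "A \<subseteq> {1..n}")
    case True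
    then obtain \<sigma> where "length \<sigma> = n" "ones \<sigma> = A" by (rule ex_ones)
    then show ?thesis using that by blast
  next
    case False
    then show ?thesis using pcoef_support[OF assms(1)] pcoef_support[OF assms(2)] by simp
  qed
  then show ?thesis using V_class_eq_pcoef[OF assms] by blast
qed

lemma Theta_eq_iff: "Theta n f = Theta n g \<longleftrightarrow> (\<forall>\<sigma>. length \<sigma> = n \<longrightarrow> f \<sigma> = g \<sigma>)"
  unfolding Theta_def V_class_eq_ones[OF word_poly_carrier word_poly_carrier] using pcoef_word_poly by auto

lemma V_class_Theta: "p \<in> carrier (poly_ring_F2 n) \<Longrightarrow> V_class n p = Theta n (\<lambda>\<sigma>. pcoef p (ones \<sigma>))"
  unfolding Theta_def by (subst V_class_eq_ones[OF _ word_poly_carrier]) (simp_all add: pcoef_word_poly)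

lemma Theta_cong: "(\<And>\<sigma>. length \<sigma> = n \<Longrightarrow> f \<sigma> = g \<sigma>) \<Longrightarrow> Theta n f = Theta n g"
  unfolding Theta_eq_iff by blast

lemma Theta_add: "Theta n f \<oplus>\<^bsub>V_mod n\<^esub> Theta n g = Theta n (\<lambda>\<sigma>. f \<sigma> + g \<sigma>)"
proof -
  have "Theta n f \<oplus>\<^bsub>V_mod n\<^esub> Theta n g = Theta n (\<lambda>\<sigma>. pcoef (word_poly n f + word_poly n g) (ones \<sigma>))"
    unfolding Theta_def[of n f] Theta_def[of n g] V_class_add[OF word_poly_carrier word_poly_carrier]
    by (rule V_class_Theta[OF poly_ring_add[OF word_poly_carrier word_poly_carrier]])
  also have "\<dots> = Theta n (\<lambda>\<sigma>. f \<sigma> + g \<sigma>)" by (rule Theta_cong) (simp add: pcoef_add pcoef_word_poly)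
  finally show ?thesis .
qed

lemma Theta_zero: "Theta n (\<lambda>_. 0) = \<zero>\<^bsub>V_mod n\<^esub>"
  unfolding Theta_def word_poly_def by (simp add: V_class_zero)

lemma carrier_V_mod: "carrier (V_mod n) = range (Theta n)"
proof -
  have "V_class n p \<in> range (Theta n)" if "p \<in> carrier (poly_ring_F2 n)" for p
    unfolding V_class_Theta[OF that] by (rule rangeI)
  moreover have "Theta n f \<in> V_class n ` carrier (poly_ring_F2 n)" for f
    unfolding Theta_def using word_poly_carrier by (rule imageI)
  ultimately show ?thesis unfolding V_class_carrier by blast
qed

lemma V_monomial_Theta: "V_monomial \<sigma> = Theta (length \<sigma>) (\<lambda>\<tau>. if \<tau> = \<sigma> then 1 else 0)"
proof -
  have "V_monomial \<sigma> = V_class (length \<sigma>) (word_monomial \<sigma>)" by (simp only: V_monomial_def word_monomial_def)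
  also have "\<dots> = Theta (length \<sigma>) (\<lambda>\<tau>. pcoef (word_monomial \<sigma>) (ones \<tau>))" by (rule V_class_Theta[OF word_monomial_carrier])
  also have "\<dots> = Theta (length \<sigma>) (\<lambda>\<tau>. if \<tau> = \<sigma> then 1 else 0)"
    by (rule Theta_cong) (simp add: pcoef_word_monomial ones_eq_iff)
  finally show ?thesis .
qed

lemma vfun_eq:
  "length \<sigma> = n \<Longrightarrow> vfun n r \<sigma> = (if \<forall>i\<in>{1..n}. \<sigma> ! (i - 1) = 1 \<longrightarrow> odd (r div 2 ^ (i - 1)) then 1 else 0)"
proof (induction n arbitrary: r \<sigma>)
  case (Suc n)
  then obtain y \<tau> where \<sigma>: "\<sigma> = y # \<tau>" "length \<tau> = n" by (auto simp: length_Suc_conv)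
  let ?P = "\<lambda>i. \<sigma> ! (i - 1) = 1 \<longrightarrow> odd (r div 2 ^ (i - 1))"
  let ?Q = "\<lambda>i. \<tau> ! (i - 1) = 1 \<longrightarrow> odd (r div 2 div 2 ^ (i - 1))"
  have set: "{1..Suc n} = insert 1 (Suc ` {1..n})" by auto
  have "?P (Suc i) \<longleftrightarrow> ?Q i" if "i \<in> {1..n}" for i
    using that by (cases i) (simp_all add: \<sigma> div_mult2_eq)
  then have "(\<forall>i\<in>{1..Suc n}. ?P i) \<longleftrightarrow> ?P 1 \<and> (\<forall>i\<in>{1..n}. ?Q i)" unfolding set by blast
  moreover have "?P 1 \<longleftrightarrow> odd r \<or> y = 0" by (auto simp: \<sigma> bit_not_one_iff)
  ultimately have eq: "(\<forall>i\<in>{1..Suc n}. ?P i) \<longleftrightarrow> (odd r \<or> y = 0) \<and> (\<forall>i\<in>{1..n}. ?Q i)" by blast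
  have "vfun (Suc n) r \<sigma> = (if odd r \<or> y = 0 then vfun n (r div 2) \<tau> else 0)" by (simp add: \<sigma>(1))
  then show ?case unfolding eq Suc.IH[OF \<sigma>(2), of "r div 2"] by argo
qed simp

lemma of_nat_bit: "(of_nat k :: bit) = (if odd k then 1 else 0)"
  by (induction k) auto

lemma v_elt_Theta: "v_elt n r = Theta n (vfun n r)"
proof -
  let ?p = "\<Prod>i\<in>{1..n}. (1 - X_var i) ^ (r div 2 ^ (i - 1) mod 2)"
  have p: "?p \<in> carrier (poly_ring_F2 n)"
    by (intro poly_ring_prod poly_ring_power) (simp only: poly_mapping_bit_diff poly_ring_add poly_ring_const poly_ring_X)
  have "?p = (\<Prod>i\<in>{1..n}. Poly_Mapping.single 0 1 + Poly_Mapping.single (Poly_Mapping.single i 1) (of_nat (r div 2 ^ (i - 1))))"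
  proof (rule prod.cong[OF refl])
    fix i
    show "(1 - X_var i) ^ (r div 2 ^ (i - 1) mod 2) = Poly_Mapping.single 0 1 + Poly_Mapping.single (Poly_Mapping.single i 1) (of_nat (r div 2 ^ (i - 1)))"
      by (simp add: of_nat_bit X_var_def poly_mapping_bit_diff odd_iff_mod_2_eq_one)
  qed
  then have pc: "pcoef ?p A = (if A \<subseteq> {1..n} then \<Prod>i\<in>{1..n}. if i \<in> A then of_nat (r div 2 ^ (i - 1)) else 1 else 0)" for A
    by (simp only: pcoef_prod finite_atLeastAtMost)
  have o: "(of_nat k :: bit) = 1 \<longleftrightarrow> odd k" for k by (simp add: of_nat_bit)
  have "v_elt n r = Theta n (\<lambda>\<sigma>. pcoef ?p (ones \<sigma>))" unfolding v_elt_def by (rule V_class_Theta[OF p])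
  also have "\<dots> = Theta n (vfun n r)"
  proof (rule Theta_cong)
    fix \<sigma> :: word assume \<sigma>: "length \<sigma> = n"
    have "ones \<sigma> \<subseteq> {1..n}" unfolding ones_def \<sigma> by blast
    moreover have "(if i \<in> ones \<sigma> then of_nat (r div 2 ^ (i - 1)) else (1::bit)) = 1 \<longleftrightarrow> (\<sigma> ! (i - 1) = 1 \<longrightarrow> odd (r div 2 ^ (i - 1)))" if "i \<in> {1..n}" for i
      using that \<sigma> o by (simp add: ones_def)
    then have "(\<forall>i\<in>{1..n}. (if i \<in> ones \<sigma> then of_nat (r div 2 ^ (i - 1)) else (1::bit)) = 1) \<longleftrightarrow>
        (\<forall>i\<in>{1..n}. \<sigma> ! (i - 1) = 1 \<longrightarrow> odd (r div 2 ^ (i - 1)))" by (rule ball_cong[OF refl])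
    ultimately show "pcoef ?p (ones \<sigma>) = vfun n r \<sigma>"
      unfolding pc vfun_eq[OF \<sigma>] bit_prod[OF finite_atLeastAtMost] by argo
  qed
  finally show ?thesis .
qed

lemma elementary_2_group_V_mod: "elementary_2_group (add_monoid (V_mod n))"
proof (intro elementary_2_group.intro elementary_2_group_axioms.intro)
  show "comm_group (add_monoid (V_mod n))"
    unfolding V_mod_def using ideal.quotient_is_ring[OF ideal_V_ideal]
    by (intro abelian_group.a_comm_group ring.is_abelian_group)
  show "x \<otimes>\<^bsub>add_monoid (V_mod n)\<^esub> x = \<one>\<^bsub>add_monoid (V_mod n)\<^esub>" if "x \<in> carrier (add_monoid (V_mod n))" for x
    using that by (auto simp: carrier_V_mod Theta_add Theta_zero)
qed

text \<open>The v_n^s with r \<le> s < 2^n have degree exactly 2^n - 1 - s, so each degree below 2^n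
  - r occurs once. Eliminating leading coefficients with them expresses every function of bounded
  degree.\<close>

lemma V_sub_eq:
  assumes "r \<le> 2 ^ n" shows "V_sub n r = Theta n ` {f. deg_lt n (2 ^ n - r) f}"
proof -
  define W where "W = F2_space (add_monoid (V_mod n))"
  interpret vectorspace F2 W unfolding W_def by (rule elementary_2_group.vectorspace_F2_space[OF elementary_2_group_V_mod])
  have V: "carrier W = range (Theta n)" "add W = add (V_mod n)" "ring.zero W = Theta n (\<lambda>_. 0)"
    "c \<odot>\<^bsub>W\<^esub> v = (if c = 0 then Theta n (\<lambda>_. 0) else v)" for c v
    by (simp_all add: W_def F2_space_def carrier_V_mod Theta_zero)
  let ?N = "Theta n ` {f. deg_lt n (2 ^ n - r) f}" and ?S = "{v_elt n s | s. r \<le> s \<and> s < 2 ^ n}"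
  have N: "submodule F2 ?N W"
  proof (rule submodule.intro)
    show "module F2 W" by (rule module_axioms)
    fix v w assume "v \<in> ?N" "w \<in> ?N"
    then show "v \<oplus>\<^bsub>W\<^esub> w \<in> ?N" by (auto simp: V Theta_add deg_lt_add)
  qed (auto simp: V intro: imageI)
  have S: "?S \<subseteq> ?N"
  proof
    fix v assume "v \<in> ?S"
    then obtain s where s: "v = Theta n (vfun n s)" "r \<le> s" "s < 2 ^ n" using v_elt_Theta by blast
    have "deg_lt n (2 ^ n - r) (vfun n s)"
      by (rule deg_lt_mono[of n "2 ^ n - s"]) (use deg_lt_vfun[OF s(3)] s(2) in auto)
    then show "v \<in> ?N" using s by blast
  qed
  have SC: "?S \<subseteq> carrier W" using S N by (auto simp: submodule_def)
  have sp: "submodule F2 (span ?S) W" by (rule span_is_submodule[OF SC])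
  have "Theta n f \<in> span ?S" if "e \<le> 2 ^ n - r" "deg_lt n e f" for e f
    using that
  proof (induction e arbitrary: f)
    case 0
    then have "Theta n f = \<zero>\<^bsub>W\<^esub>" unfolding V deg_lt_zero_iff by (intro Theta_cong) blast
    then show ?case using submodule.zero_closed[OF sp] by simp
  next
    case (Suc e)
    then have e: "e < 2 ^ n" by simp
    show ?case
    proof (cases "coef n e f = 0")
      case True
      then show ?thesis using Suc deg_lt_Suc[OF e] by simp
    next
      case False
      define s where "s = 2 ^ n - 1 - e"
      have s: "r \<le> s" "s < 2 ^ n" "2 ^ n - s = Suc e" "2 ^ n - 1 - s = e" using Suc.prems(1) e assms by (auto simp: s_def)
      have v: "deg_lt n (Suc e) (vfun n s)" "coef n e (vfun n s) = 1" using deg_lt_vfun[OF s(2)] unfolding s(3,4) by auto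
      let ?f = "\<lambda>\<sigma>. f \<sigma> + vfun n s \<sigma>"
      have "deg_lt n e ?f" unfolding deg_lt_Suc[OF e] using deg_lt_add[OF Suc.prems(2) v(1)] v(2) False by (simp add: coef_add bit_not_zero_iff)
      then have 1: "Theta n ?f \<in> span ?S" using Suc by simp
      have "v_elt n s \<in> ?S" using s by blast
      then have 2: "Theta n (vfun n s) \<in> span ?S" using in_own_span[OF SC] v_elt_Theta by auto
      have "Theta n f = Theta n ?f \<oplus>\<^bsub>W\<^esub> Theta n (vfun n s)" unfolding V Theta_add by simp
      then show ?thesis using submodule.m_closed[OF sp 1 2] by simp
    qed
  qed
  moreover have "span ?S \<subseteq> ?N" by (rule span_is_subset[OF S N])
  ultimately show ?thesis unfolding V_sub_def W_def by blast
qed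

subsection \<open>The subgroups \<open>N\<^sub>m\<close> and the isomorphism \<open>\<alpha> \<oplus> \<beta>\<close>\<close>

lemma pairs_pow_mono: "Q \<subseteq> Q' \<Longrightarrow> pairs_pow Q m \<subseteq> pairs_pow Q' m"
  by (induction m) auto

declare pairs_pow.simps [simp del]

lemma pairs_pow_KK_NK: "pairs_pow KK (Suc k) \<subseteq> NK k"
proof (induction k)
  case 0
  have "pairs_pow KK (Suc 0) = K1" by (simp add: K1_def pairs_pow.simps)
  then show ?case using K1_LL by (simp add: pairs_pow.simps)
next
  case (Suc k)
  then show ?case unfolding pairs_pow.simps(2)[of KK "Suc k"] pairs_pow.simps(2)[of LL k] by blast
qed

lemma TT_LL: "TT \<subseteq> LL"
  unfolding TT_def using xx2_LL by (intro GG.normal_closure_minimal LL_normal) simp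

lemma NN_eq_NK: "NN (Suc k) = NK k"
proof
  have eq: "NN (Suc k) = pairs_pow KK (Suc k) <#>\<^bsub>GG\<^esub> pairs_pow TT k"
    unfolding NN_def using normal_tree_aut[OF KK_normal] normal_tree_aut[OF TT_normal] by (simp add: level_power_eq_pairs_pow)
  show "NN (Suc k) \<subseteq> NK k"
    unfolding eq set_mult_def using pairs_pow_KK_NK[of k] pairs_pow_mono[OF TT_LL, of k] normal_GG_comp[OF NK_normal[of k]]
    by auto
  show "NK k \<subseteq> NN (Suc k)"
    unfolding eq set_mult_def using NK_decomp[of _ k] by auto
qed

lemma at_vertex_Cons: "at_vertex (y # \<sigma>) g = (if y = 0 then pair (at_vertex \<sigma> g) id else pair id (at_vertex \<sigma> g))"
proof
  fix w
  show "at_vertex (y # \<sigma>) g w = (if y = 0 then pair (at_vertex \<sigma> g) id else pair id (at_vertex \<sigma> g)) w"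
    by (cases w; cases "hd w"; cases y) (auto simp: at_vertex_def id_apply)
qed

lemma at_vertex_comp: "at_vertex \<sigma> (g \<circ> h) = at_vertex \<sigma> g \<circ> at_vertex \<sigma> h"
  by (rule ext) (simp add: at_vertex_def comp_apply)

lemma xtuple_zero: "(\<And>\<tau>. f \<tau> = 0) \<Longrightarrow> xtuple m f = id"
  by (induction m arbitrary: f) simp_all

lemma at_vertex_xx: "at_vertex \<sigma> xx = xtuple (length \<sigma>) (\<lambda>\<tau>. if \<tau> = \<sigma> then 1 else 0)"
proof (induction \<sigma>)
  case Nil
  have "at_vertex [] xx = xx" by (rule ext) (simp add: at_vertex_def)
  then show ?case by simp
next
  case (Cons y \<sigma>)
  then show ?case by (cases y) (simp_all add: at_vertex_Cons xtuple_zero)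
qed

lemma mem_Theta_image: "Theta n f \<in> Theta n ` {f. deg_lt n e f} \<longleftrightarrow> deg_lt n e f"
proof
  assume "Theta n f \<in> Theta n ` {f. deg_lt n e f}"
  then obtain h where h: "Theta n f = Theta n h" "deg_lt n e h" by blast
  then have "\<And>\<sigma>. length \<sigma> = n \<Longrightarrow> f \<sigma> = h \<sigma>" unfolding Theta_eq_iff by blast
  then show "deg_lt n e f" using h(2) deg_lt_cong by metis
qed blast

definition VV :: "nat \<Rightarrow> (mpoly2 set \<times> mpoly2 set) monoid" where
  "VV k = add_monoid (V_mod (Suc k)) \<times>\<times> add_monoid (V_mod k)"

lemma carrier_VV: "carrier (VV k) = range (Theta (Suc k)) \<times> range (Theta k)"
  and mult_VV: "(u, v) \<otimes>\<^bsub>VV k\<^esub> (u', v') = (u \<oplus>\<^bsub>V_mod (Suc k)\<^esub> u', v \<oplus>\<^bsub>V_mod k\<^esub> v')"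
  and one_VV: "\<one>\<^bsub>VV k\<^esub> = (\<zero>\<^bsub>V_mod (Suc k)\<^esub>, \<zero>\<^bsub>V_mod k\<^esub>)"
  by (simp_all add: VV_def carrier_V_mod)

definition ThetaAB :: "nat \<Rightarrow> (word \<Rightarrow> word) \<Rightarrow> mpoly2 set \<times> mpoly2 set" where
  "ThetaAB k g = (Theta (Suc k) (Af g), Theta k (Bf g))"

text \<open>\<open>ThetaAB k\<close> is constant on the cosets of its kernel, so the image of a
  coset is a singleton.\<close>

definition Phi :: "nat \<Rightarrow> (word \<Rightarrow> word) set \<Rightarrow> mpoly2 set \<times> mpoly2 set" where
  "Phi k C = the_elem (ThetaAB k ` C)"

context
  fixes k :: nat
begin

abbreviation "GN \<equiv> GG\<lparr>carrier := NK k\<rparr>"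

lemma group_GN: "group GN"
  by (rule GG.subgroup_imp_group[OF normal_imp_subgroup[OF NK_normal]])

lemma ThetaAB_comp: "g \<in> NK k \<Longrightarrow> h \<in> NK k \<Longrightarrow> ThetaAB k (g \<circ> h) = ThetaAB k g \<otimes>\<^bsub>VV k\<^esub> ThetaAB k h"
  unfolding ThetaAB_def mult_VV Theta_add by (simp add: Af_comp Bf_comp cong: Theta_cong)

lemma group_hom_ThetaAB: "group_hom GN (VV k) (ThetaAB k)"
proof -
  interpret V: elementary_2_group "VV k" unfolding VV_def by (intro elementary_2_group_DirProd elementary_2_group_V_mod)
  have "ThetaAB k \<in> hom GN (VV k)"
    by (rule homI) (simp_all add: ThetaAB_comp, simp add: ThetaAB_def carrier_VV)
  then show ?thesis by (intro group_hom.intro group_GN V.group_axioms group_hom_axioms.intro)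
qed

lemma ThetaAB_surj: "ThetaAB k ` NK k = carrier (VV k)"
proof -
  have "(Theta (Suc k) f, Theta k h) \<in> ThetaAB k ` NK k" for f h
  proof
    let ?a = "xtuple (Suc k) f" and ?b = "xtuple k h \<circ> xtuple k h"
    note n = xtuple_NK[of k f] xtuple_square(1)[of k h]
    show "?a \<circ> ?b \<in> NK k" using normal_GG_comp[OF NK_normal] n by blast
    have "Theta (Suc k) f = Theta (Suc k) (Af (?a \<circ> ?b))"
      by (rule Theta_cong) (simp only: Af_comp[OF n] Af_xtuple xtuple_square(2) add_0_right)
    moreover have "Theta k h = Theta k (Bf (?a \<circ> ?b))"
      by (rule Theta_cong) (simp only: Bf_comp[OF n] Bf_xtuple xtuple_square(3) add_0_left)
    ultimately show "(Theta (Suc k) f, Theta k h) = ThetaAB k (?a \<circ> ?b)" by (simp only: ThetaAB_def)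
  qed
  then show ?thesis unfolding carrier_VV by (auto simp: ThetaAB_def)
qed

lemma ThetaAB_kernel: "kernel GN (VV k) (ThetaAB k) = NK (Suc k)"
proof -
  have "deg_lt n 0 f \<longleftrightarrow> Theta n f = \<zero>\<^bsub>V_mod n\<^esub>" for n f
    unfolding deg_lt_zero_iff Theta_zero[symmetric] Theta_eq_iff ..
  then show ?thesis
    unfolding MM_top[symmetric] MM_def by (simp add: kernel_def ThetaAB_def one_VV del: deg_lt.simps)
qed

lemma r_coset_GN: "H #>\<^bsub>GN\<^esub> g = H #>\<^bsub>GG\<^esub> g"
  by (simp add: r_coset_def)

lemma Phi_iso: "Phi k \<in> iso (GN Mod NK (Suc k)) (VV k)"
  unfolding Phi_def[abs_def] ThetaAB_kernel[symmetric]
  by (rule group_hom.FactGroup_iso_set[OF group_hom_ThetaAB]) (simp add: ThetaAB_surj)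

lemma ThetaAB_coset:
  assumes "g \<in> NK k" "h \<in> NK (Suc k) #>\<^bsub>GG\<^esub> g" shows "ThetaAB k h = ThetaAB k g"
proof -
  interpret group_hom GN "VV k" "ThetaAB k" by (rule group_hom_ThetaAB)
  obtain u where u: "u \<in> NK (Suc k)" "h = u \<circ> g" using assms(2) by (auto simp: r_coset_def)
  then have "u \<in> NK k" "ThetaAB k u = \<one>\<^bsub>VV k\<^esub>" unfolding ThetaAB_kernel[symmetric] by (auto simp: kernel_def)
  then show ?thesis using hom_mult[of u g] assms(1) u(2) hom_closed[of g] H.l_one by simp
qed

lemma Phi_coset: assumes "g \<in> NK k" shows "Phi k (NK (Suc k) #>\<^bsub>GG\<^esub> g) = ThetaAB k g"
proof -
  have "g \<in> NK (Suc k) #>\<^bsub>GG\<^esub> g"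
    using normal_GG_id[OF NK_normal[of "Suc k"]] unfolding r_coset_def by (intro UN_I[of id]) simp_all
  then have "ThetaAB k ` (NK (Suc k) #>\<^bsub>GG\<^esub> g) = {ThetaAB k g}" using ThetaAB_coset[OF assms] by blast
  then show ?thesis by (simp add: Phi_def)
qed

lemma at_vertex_NK:
  shows "length \<sigma> = Suc k \<Longrightarrow> at_vertex \<sigma> xx \<in> NK k" "length \<rho> = k \<Longrightarrow> at_vertex \<rho> xx2 \<in> NK k"
  unfolding at_vertex_comp at_vertex_xx by (simp_all only: xtuple_NK xtuple_square(1))

lemma ThetaAB_at_vertex:
  shows "length \<sigma> = Suc k \<Longrightarrow> ThetaAB k (at_vertex \<sigma> xx) = (V_monomial \<sigma>, \<zero>\<^bsub>V_mod k\<^esub>)"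
    and "length \<rho> = k \<Longrightarrow> ThetaAB k (at_vertex \<rho> xx2) = (\<zero>\<^bsub>V_mod (Suc k)\<^esub>, V_monomial \<rho>)"
proof -
  assume l: "length \<sigma> = Suc k"
  have "Theta (Suc k) (Af (at_vertex \<sigma> xx)) = V_monomial \<sigma>"
    unfolding at_vertex_xx V_monomial_Theta l by (rule Theta_cong) (rule Af_xtuple)
  moreover have "Theta k (Bf (at_vertex \<sigma> xx)) = \<zero>\<^bsub>V_mod k\<^esub>"
    unfolding at_vertex_xx l Theta_zero[symmetric] by (rule Theta_cong) (rule Bf_xtuple)
  ultimately show "ThetaAB k (at_vertex \<sigma> xx) = (V_monomial \<sigma>, \<zero>\<^bsub>V_mod k\<^esub>)" by (simp only: ThetaAB_def)
next
  assume l: "length \<rho> = k"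
  have "Theta (Suc k) (Af (at_vertex \<rho> xx2)) = \<zero>\<^bsub>V_mod (Suc k)\<^esub>"
    unfolding at_vertex_comp at_vertex_xx l Theta_zero[symmetric] by (rule Theta_cong) (rule xtuple_square(2))
  moreover have "Theta k (Bf (at_vertex \<rho> xx2)) = V_monomial \<rho>"
    unfolding at_vertex_comp at_vertex_xx V_monomial_Theta l by (rule Theta_cong) (rule xtuple_square(3))
  ultimately show "ThetaAB k (at_vertex \<rho> xx2) = (\<zero>\<^bsub>V_mod (Suc k)\<^esub>, V_monomial \<rho>)" by (simp only: ThetaAB_def)
qed

lemma is_alpha_beta_NK:
  "is_alpha_beta (Suc k) \<phi> \<longleftrightarrow> \<phi> \<in> iso (GN Mod NK (Suc k)) (VV k) \<and>
     (\<forall>\<sigma>. length \<sigma> = Suc k \<longrightarrow> \<phi> (NK (Suc k) #>\<^bsub>GG\<^esub> at_vertex \<sigma> xx) = ThetaAB k (at_vertex \<sigma> xx)) \<and>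
     (\<forall>\<sigma>. length \<sigma> = k \<longrightarrow> \<phi> (NK (Suc k) #>\<^bsub>GG\<^esub> at_vertex \<sigma> xx2) = ThetaAB k (at_vertex \<sigma> xx2))"
  unfolding is_alpha_beta_def VV_def[symmetric] Suc_eq_plus1[symmetric] NN_eq_NK diff_Suc_1 GG_simps
  using ThetaAB_at_vertex by auto

lemma is_alpha_beta_Phi: "is_alpha_beta (Suc k) (Phi k)"
  unfolding is_alpha_beta_NK using Phi_iso Phi_coset at_vertex_NK by blast

text \<open>\<open>alpha_beta\<close> is obtained by choice, so its values must be forced. The set
  of elements where \<phi> agrees with \<open>ThetaAB k\<close> is closed under products, and
  membership depends only on the value of \<open>ThetaAB k\<close>; products of entries at single
  vertices already realize every value.\<close>

lemma is_alpha_beta_unique: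
  assumes "is_alpha_beta (Suc k) \<phi>" "g \<in> NK k"
  shows "\<phi> (NK (Suc k) #>\<^bsub>GG\<^esub> g) = ThetaAB k g"
proof -
  define E where "E = {g \<in> NK k. \<phi> (NK (Suc k) #>\<^bsub>GG\<^esub> g) = ThetaAB k g}"
  interpret hom: group_hom GN "VV k" "ThetaAB k" by (rule group_hom_ThetaAB)
  interpret N: normal "NK (Suc k)" GN using hom.normal_kernel unfolding ThetaAB_kernel .
  interpret Q: group "GN Mod NK (Suc k)" by (rule N.factorgroup_is_group)
  interpret \<phi>: group_hom "GN Mod NK (Suc k)" "VV k" \<phi>
    using assms(1) unfolding is_alpha_beta_NK by unfold_locales (auto simp: iso_def)
  have cosets: "NK (Suc k) #>\<^bsub>GG\<^esub> g \<in> carrier (GN Mod NK (Suc k))" if "g \<in> NK k" for g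
    using that unfolding r_coset_GN[symmetric] carrier_FactGroup by simp
  have comp: "g \<circ> h \<in> E" if "g \<in> E" "h \<in> E" for g h
  proof -
    have gh: "g \<in> NK k" "h \<in> NK k" using that by (auto simp: E_def)
    have "NK (Suc k) #>\<^bsub>GG\<^esub> (g \<circ> h) = (NK (Suc k) #>\<^bsub>GG\<^esub> g) \<otimes>\<^bsub>GN Mod NK (Suc k)\<^esub> (NK (Suc k) #>\<^bsub>GG\<^esub> h)"
      using N.rcos_sum[of g h] gh unfolding r_coset_GN by simp
    then have "\<phi> (NK (Suc k) #>\<^bsub>GG\<^esub> (g \<circ> h)) = \<phi> (NK (Suc k) #>\<^bsub>GG\<^esub> g) \<otimes>\<^bsub>VV k\<^esub> \<phi> (NK (Suc k) #>\<^bsub>GG\<^esub> h)"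
      using \<phi>.hom_mult[OF cosets[OF gh(1)] cosets[OF gh(2)]] by (simp only:)
    also have "\<dots> = ThetaAB k g \<otimes>\<^bsub>VV k\<^esub> ThetaAB k h" using that by (simp only: E_def mem_Collect_eq)
    also have "\<dots> = ThetaAB k (g \<circ> h)" by (rule ThetaAB_comp[OF gh, symmetric])
    finally show ?thesis using normal_GG_comp[OF NK_normal gh] by (simp add: E_def)
  qed
  have E_coset: "u \<in> E" if "v \<in> E" "u \<in> NK k" "ThetaAB k u = ThetaAB k v" for u v
  proof -
    have v: "v \<in> NK k" using that(1) by (simp add: E_def)
    have "NK (Suc k) #>\<^bsub>GG\<^esub> u = NK (Suc k) #>\<^bsub>GG\<^esub> v"
    proof -
      have "inj_on (Phi k) (carrier (GN Mod NK (Suc k)))" using Phi_iso by (auto simp: iso_def bij_betw_def)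
      moreover have "Phi k (NK (Suc k) #>\<^bsub>GG\<^esub> u) = Phi k (NK (Suc k) #>\<^bsub>GG\<^esub> v)" using Phi_coset that v by simp
      ultimately show ?thesis using cosets that(2) v by (meson inj_onD)
    qed
    then show ?thesis using that by (simp add: E_def)
  qed
  have ind: "Theta n (\<lambda>\<tau>. if \<tau> \<in> insert \<sigma> S then 1 else 0) = V_monomial \<sigma> \<oplus>\<^bsub>V_mod n\<^esub> Theta n (\<lambda>\<tau>. if \<tau> \<in> S then 1 else 0)"
    if "length \<sigma> = n" "\<sigma> \<notin> S" for n \<sigma> S
  proof -
    have "Theta n (\<lambda>\<tau>. if \<tau> \<in> insert \<sigma> S then 1 else 0) = Theta n (\<lambda>\<tau>. (if \<tau> = \<sigma> then 1 else 0) + (if \<tau> \<in> S then 1 else 0))"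
      by (rule Theta_cong) (use that in auto)
    then show ?thesis unfolding Theta_add[symmetric] V_monomial_Theta that(1) .
  qed
  have zero: "\<zero>\<^bsub>V_mod n\<^esub> \<oplus>\<^bsub>V_mod n\<^esub> Theta n f = Theta n f" for n f
    unfolding Theta_zero[symmetric] Theta_add by simp
  have one: "\<exists>g\<in>E. ThetaAB k g = (Theta (Suc k) (\<lambda>\<tau>. if \<tau> \<in> S then 1 else 0), Theta k (\<lambda>\<tau>. if \<tau> \<in> T then 1 else 0))"
    if "finite S" "S \<subseteq> {\<sigma>. length \<sigma> = Suc k}" "finite T" "T \<subseteq> {\<sigma>. length \<sigma> = k}" for S T
    using that(1,2)
  proof (induction S rule: finite_induct)
    case empty
    show ?case using that(3,4)
    proof (induction T rule: finite_induct)
      case empty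
      have id: "ThetaAB k id = \<one>\<^bsub>VV k\<^esub>" using hom.hom_one by simp
      have "\<phi> (NK (Suc k)) = \<one>\<^bsub>VV k\<^esub>" using \<phi>.hom_one by simp
      moreover have "NK (Suc k) #>\<^bsub>GG\<^esub> id = NK (Suc k)" by (auto simp: r_coset_def)
      ultimately have "id \<in> E" using normal_GG_id[OF NK_normal] id by (simp only: E_def mem_Collect_eq)
      then show ?case using id by (intro bexI[of _ id]) (simp_all add: Theta_zero one_VV)
    next
      case (insert \<sigma> T)
      then obtain g where g: "g \<in> E" "ThetaAB k g = (Theta (Suc k) (\<lambda>\<tau>. if \<tau> \<in> {} then 1 else 0), Theta k (\<lambda>\<tau>. if \<tau> \<in> T then 1 else 0))" by blast
      have l: "length \<sigma> = k" using insert by simp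
      have v: "at_vertex \<sigma> xx2 \<in> E" using assms(1) at_vertex_NK(2)[OF l] l unfolding is_alpha_beta_NK E_def by blast
      have "g \<in> NK k" using g(1) by (simp add: E_def)
      from ThetaAB_comp[OF at_vertex_NK(2)[OF l] this] have "ThetaAB k (at_vertex \<sigma> xx2 \<circ> g) = (Theta (Suc k) (\<lambda>\<tau>. if \<tau> \<in> {} then 1 else 0), Theta k (\<lambda>\<tau>. if \<tau> \<in> insert \<sigma> T then 1 else 0))"
        unfolding ThetaAB_at_vertex(2)[OF l] g(2) ind[OF l insert(2)] by (simp add: mult_VV zero)
      then show ?case using comp[OF v g(1)] by blast
    qed
  next
    case (insert \<sigma> S)
    then obtain g where g: "g \<in> E" "ThetaAB k g = (Theta (Suc k) (\<lambda>\<tau>. if \<tau> \<in> S then 1 else 0), Theta k (\<lambda>\<tau>. if \<tau> \<in> T then 1 else 0))" by blast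
    have l: "length \<sigma> = Suc k" using insert by simp
    have v: "at_vertex \<sigma> xx \<in> E" using assms(1) at_vertex_NK(1)[OF l] l unfolding is_alpha_beta_NK E_def by blast
    have "g \<in> NK k" using g(1) by (simp add: E_def)
    from ThetaAB_comp[OF at_vertex_NK(1)[OF l] this] have "ThetaAB k (at_vertex \<sigma> xx \<circ> g) = (Theta (Suc k) (\<lambda>\<tau>. if \<tau> \<in> insert \<sigma> S then 1 else 0), Theta k (\<lambda>\<tau>. if \<tau> \<in> T then 1 else 0))"
      unfolding ThetaAB_at_vertex(1)[OF l] g(2) ind[OF l insert(2)] by (simp add: mult_VV zero)
    then show ?case using comp[OF v g(1)] by blast
  qed
  have supp: "Theta n f = Theta n (\<lambda>\<tau>. if \<tau> \<in> {\<sigma>. length \<sigma> = n \<and> f \<sigma> = 1} then 1 else 0)" for n f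
    by (rule Theta_cong) (simp add: bit_not_one_iff)
  have fin: "finite {\<sigma>. length \<sigma> = n \<and> f \<sigma> = 1}" for n and f :: "word \<Rightarrow> bit"
    by (rule finite_subset[OF _ finite_words[of n]]) auto
  obtain g' where "g' \<in> E" "ThetaAB k g' = ThetaAB k g"
    using one[OF fin[of "Suc k" "Af g"] _ fin[of k "Bf g"]] unfolding ThetaAB_def[of k g] supp[symmetric] by blast
  then have "g \<in> E" using E_coset assms(2) by simp
  then show ?thesis by (simp add: E_def)
qed

lemma alpha_beta_coset: "g \<in> NK k \<Longrightarrow> alpha_beta (Suc k) (NK (Suc k) #>\<^bsub>GG\<^esub> g) = ThetaAB k g"
  unfolding alpha_beta_def by (rule is_alpha_beta_unique[OF someI[of "is_alpha_beta (Suc k)", OF is_alpha_beta_Phi]])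

lemma N_preimage_eq_MM:
  assumes "r \<le> 2 ^ Suc k"
  shows "N_preimage (Suc k) (V_sub (Suc k) r) (V_sub k (r div 2)) = MM k r"
proof -
  have "r div 2 \<le> 2 ^ k" using assms by simp
  note V = V_sub_eq[OF assms] V_sub_eq[OF this]
  show ?thesis
    unfolding N_preimage_def alpha_map_def beta_map_def V MM_def Suc_eq_plus1[symmetric] NN_eq_NK
    using alpha_beta_coset
    by (intro Collect_cong conj_cong) (simp_all add: ThetaAB_def mem_Theta_image del: deg_lt.simps power_Suc)
qed

end

theorem theorem6p6:
  shows "(\<forall>m\<ge>1. dimension_subgroup GG (2 ^ m + 1) = NN m) \<and>
    (\<forall>m\<ge>1. \<forall>r\<le>2 ^ m. dimension_subgroup GG (2 ^ m + 1 + r) =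
       (if even r then N_preimage m (V_sub m r) (V_sub (m - 1) (r div 2))
        else N_preimage m (V_sub m r) (V_sub (m - 1) ((r - 1) div 2)))) \<and>
    (\<forall>i\<ge>1. rank_F2 (GG\<lparr>carrier := dimension_subgroup GG i\<rparr> Mod dimension_subgroup GG (i + 1)) =
       (if i = 1 then 3 else if even i then 2 else 1))"
proof (intro conjI allI impI)
  fix m :: nat assume "1 \<le> m"
  then obtain k where m: "m = Suc k" by (cases m) auto
  show "dimension_subgroup GG (2 ^ m + 1) = NN m"
    using dimension_subgroup_GG[of "2 ^ m + 1"] series_eq[of 0 k] by (simp add: m NN_eq_NK MM_0)
  fix r :: nat assume r: "r \<le> 2 ^ m"
  have "dimension_subgroup GG (2 ^ m + 1 + r) = N_preimage m (V_sub m r) (V_sub (m - 1) (r div 2))"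
  proof -
    have "dimension_subgroup GG (2 ^ m + 1 + r) = series (2 ^ m + 1 + r)" by (rule dimension_subgroup_GG) simp
    also have "\<dots> = MM k r" using series_eq r unfolding m by blast
    also have "\<dots> = N_preimage m (V_sub m r) (V_sub (m - 1) (r div 2))"
      using N_preimage_eq_MM[of r k] r unfolding m diff_Suc_1 by simp
    finally show ?thesis .
  qed
  moreover have "(r - 1) div 2 = r div 2" if "odd r" using that by (auto elim!: oddE)
  ultimately show "dimension_subgroup GG (2 ^ m + 1 + r) =
       (if even r then N_preimage m (V_sub m r) (V_sub (m - 1) (r div 2))
        else N_preimage m (V_sub m r) (V_sub (m - 1) ((r - 1) div 2)))" by simp
next
  fix i :: nat assume "1 \<le> i"
  then have "dimension_subgroup GG i = series i" "dimension_subgroup GG (i + 1) = series (i + 1)"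
    by (intro dimension_subgroup_GG; simp)+
  then show "rank_F2 (GG\<lparr>carrier := dimension_subgroup GG i\<rparr> Mod dimension_subgroup GG (i + 1)) =
       (if i = 1 then 3 else if even i then 2 else 1)"
    using rank_series[OF \<open>1 \<le> i\<close>] by (simp only:)
qed

end
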